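(* Let $n>2$, and let $M$ and $\overline M$ be hypersurfaces of the pseudo-Euclidean space $\mathbb R_s^{n+1}$ whose induced metrics $g$ and $\bar g$ are (nondegenerate and) indefinite. Let $f:M\to\overline M$ be a diffeomorphism such that, for each isotropic tangent vector $\xi$ on $M$, $$\lim_{x\to\xi}\frac{\overline K_{\bar h}(f_*x)}{K_h(x)}=1,$$ where $\xi$ is approximated by nonzero nonisotropic vectors $x$ whose images $f_*x$ are also nonisotropic. If the nonquasi-umbilic points are dense in $M$ and if $M$ is not conformally flat, then $f$ is a congruence.
   Context: A hypersurface $M$ of $\mathbb R_s^{n+1}$ (so $\dim M=n$) is always assumed to be such that the restriction $g$ of the usual metric of $\mathbb R_s^{n+1}$ to $M$ is nondegenerate. $\nabla$ is the Levi-Civita connection, $R$ the curvature tensor (of type (0,4)) of $(M,g)$, and $h$ is the (scalar-valued) second fundamental form of $M$; the equations of Gauss and Codazzi are taken in the form $$R(X,Y,Z,U)=h(X,U)h(Y,Z)-h(X,Z)h(Y,U),\qquad (\nabla_Xh)(Y,Z)-(\nabla_Yh)(X,Z)=0 .$$ The corresponding objects for $\overline M$ are denoted with a bar ($\bar g,\bar h,\overline R,\dots$) and satisfy the same equations. A tangent vector $\xi$ is isotropic if $\xi\neq0$ and $g(\xi,\xi)=0$. The bending $K_h$ of $M$ is the function assigning to each nonzero nonisotropic tangent vector $x$ the number $K_h(x)=h(x,x)/g(x,x)$; $\overline K_{\bar h}$ is the bending of $\overline M$. A point $p\in M$ is quasi-umbilic if at $p$ one has $h=\alpha\,g+\beta\,\omega\otimes\omega$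 for some real $\alpha,\beta$ and some 1-form $\omega$; otherwise it is nonquasi-umbilic. Conformally flat has its usual meaning: for $n>3$ it is equivalent to the vanishing of the Weyl conformal curvature tensor, and for $n=3$ to $\left(\nabla_X\left(S-\frac\tau4 g\right)\right)(Y,Z)-\left(\nabla_Y\left(S-\frac\tau4 g\right)\right)(X,Z)=0$, where $S$ is the Ricci tensor and $\tau$ the scalar curvature. $f$ is a congruence if it can be extended to a motion (isometry) of $\mathbb R_s^{n+1}$.
   Formalization: M and its image are assumed connected (otherwise f could be a different motion on each component), and the two hypersurfaces carry global smooth unit normals of the same causal character, as the common form of the Gauss equation presupposes. *)

theory Defs
  imports "HOL-Analysis.Analysis"
begin

section \<open>Smooth maps\<close>

text \<open>\<open>Ck_on k f U\<close> is only meaningful for open \<open>U\<close>: all iterated directional derivatives of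
  order at most \<open>k\<close> exist as Frechet derivatives and are continuous.\<close>

primrec Ck_on :: "nat \<Rightarrow> ('a::euclidean_space \<Rightarrow> 'b::euclidean_space) \<Rightarrow> 'a set \<Rightarrow> bool" where
  "Ck_on 0 f U \<longleftrightarrow> continuous_on U f"
| "Ck_on (Suc k) f U \<longleftrightarrow>
     (\<forall>x\<in>U. f differentiable (at x)) \<and>
     (\<forall>v. Ck_on k (\<lambda>x. frechet_derivative f (at x) v) U)"

text \<open>On an arbitrary subset of a Euclidean space, smooth means locally the restriction of a
  \<open>C\<^sup>\<infinity>\<close> map defined on an open set of the ambient space.\<close>

definition smooth_on :: "'a::euclidean_space set \<Rightarrow> ('a \<Rightarrow> 'b::euclidean_space) \<Rightarrow> bool" where
  "smooth_on M f \<longleftrightarrow>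
     (\<forall>p\<in>M. \<exists>U F. open U \<and> p \<in> U \<and> (\<forall>k. Ck_on k F U) \<and> (\<forall>x\<in>M \<inter> U. F x = f x))"

definition diffeomorphism ::
    "'a::euclidean_space set \<Rightarrow> 'b::euclidean_space set \<Rightarrow> ('a \<Rightarrow> 'b) \<Rightarrow> bool" where
  "diffeomorphism A B f \<longleftrightarrow> bij_betw f A B \<and> smooth_on A f \<and> smooth_on B (inv_into A f)"

text \<open>For a smooth map on a submanifold \<open>M\<close> the derivative within \<open>M\<close> is determined only on vectors
  tangent to \<open>M\<close>; there it is the differential \<open>f\<^sub>*\<close>. It must not be applied to
  other vectors.\<close>

definition differential ::
    "'a::euclidean_space set \<Rightarrow> ('a \<Rightarrow> 'b::euclidean_space) \<Rightarrow> 'a \<Rightarrow> 'a \<Rightarrow> 'b" where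
  "differential M f p = frechet_derivative f (at p within M)"

definition tangent_space :: "'a::euclidean_space set \<Rightarrow> 'a \<Rightarrow> 'a set" where
  "tangent_space M p =
     {v. \<exists>c \<delta>. \<delta> > 0 \<and> smooth_on {-\<delta><..<\<delta>} c \<and> c ` {-\<delta><..<\<delta>} \<subseteq> M \<and>
             c (0::real) = p \<and> (c has_vector_derivative v) (at 0)}"


section \<open>Pseudo-Euclidean space and its hypersurfaces\<close>

text \<open>The pseudo-Euclidean space of dimension \<open>CARD('m)\<close> and index \<open>card N\<close>: the coordinates with
  index in \<open>N\<close> are the negative ones.\<close>

definition pdot :: "'m::finite set \<Rightarrow> real ^ 'm \<Rightarrow> real ^ 'm \<Rightarrow> real" where
  "pdot N v w = (\<Sum>i\<in>UNIV. (if i \<in> N then - 1 else 1) * v $ i * w $ i)"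

text \<open>Embedded hypersurfaces, described by slice charts: near each of its points, \<open>M\<close> can be
  straightened by an ambient diffeomorphism to a piece of a coordinate hyperplane.\<close>

definition hypersurface :: "(real ^ 'm::finite) set \<Rightarrow> bool" where
  "hypersurface M \<longleftrightarrow>
     (\<forall>p\<in>M. \<exists>U V \<Phi> k. open U \<and> p \<in> U \<and> open V \<and> diffeomorphism U V \<Phi> \<and>
                \<Phi> ` (M \<inter> U) = V \<inter> {y :: real ^ 'm. y $ k = 0})"

definition nondegenerate_metric :: "'m::finite set \<Rightarrow> (real ^ 'm) set \<Rightarrow> bool" where
  "nondegenerate_metric N M \<longleftrightarrow>
     (\<forall>p\<in>M. \<forall>v\<in>tangent_space M p. (\<forall>w\<in>tangent_space M p. pdot N v w = 0) \<longrightarrow> v = 0)"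

definition indefinite_metric :: "'m::finite set \<Rightarrow> (real ^ 'm) set \<Rightarrow> bool" where
  "indefinite_metric N M \<longleftrightarrow>
     (\<forall>p\<in>M. (\<exists>v\<in>tangent_space M p. pdot N v v < 0) \<and> (\<exists>v\<in>tangent_space M p. pdot N v v > 0))"

text \<open>The Gauss equation in a form free of the sign \<open>\<epsilon> = \<langle>\<nu>,\<nu>\<rangle>\<close>, the same for two hypersurfaces, means that
  both have the same \<open>\<epsilon>\<close>. For opposite signs in a space of neutral signature, restrictions of ambient
  anti-isometries can preserve the bending.\<close>

definition unit_normal_field ::
    "'m::finite set \<Rightarrow> (real ^ 'm) set \<Rightarrow> real \<Rightarrow> (real ^ 'm \<Rightarrow> real ^ 'm) \<Rightarrow> bool" where
  "unit_normal_field N M \<epsilon> \<nu> \<longleftrightarrow>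
     smooth_on M \<nu> \<and>
     (\<forall>p\<in>M. pdot N (\<nu> p) (\<nu> p) = \<epsilon> \<and> (\<forall>v\<in>tangent_space M p. pdot N (\<nu> p) v = 0))"

text \<open>The scalar-valued form \<open>h\<close> of the Gauss formula \<open>D\<^sub>X Y = \<nabla>\<^sub>X Y + h(X,Y) \<nu>\<close>. Pairing with \<open>\<nu>\<close> and
  differentiating \<open>\<langle>Y,\<nu>\<rangle> = 0\<close> gives \<open>\<langle>\<nu>,\<nu>\<rangle> h(X,Y) = - \<langle>D\<^sub>X \<nu>, Y\<rangle>\<close>, where \<open>\<langle>\<nu>,\<nu>\<rangle>\<close> is \<open>1\<close> or \<open>-1\<close>.\<close>

definition second_fundamental_form ::
    "'m::finite set \<Rightarrow> (real ^ 'm) set \<Rightarrow> (real ^ 'm \<Rightarrow> real ^ 'm) \<Rightarrow> real ^ 'm \<Rightarrow> real ^ 'm \<Rightarrow> real ^ 'm \<Rightarrow> real"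
  where
  "second_fundamental_form N M \<nu> p v w =
     - pdot N (\<nu> p) (\<nu> p) * pdot N (differential M \<nu> p v) w"

definition bending ::
    "'m::finite set \<Rightarrow> (real ^ 'm) set \<Rightarrow> (real ^ 'm \<Rightarrow> real ^ 'm) \<Rightarrow> real ^ 'm \<Rightarrow> real ^ 'm \<Rightarrow> real" where
  "bending N M \<nu> p x = second_fundamental_form N M \<nu> p x x / pdot N x x"

definition isotropic :: "'m::finite set \<Rightarrow> real ^ 'm \<Rightarrow> bool" where
  "isotropic N \<xi> \<longleftrightarrow> \<xi> \<noteq> 0 \<and> pdot N \<xi> \<xi> = 0"

text \<open>Every linear form on a tangent space extends to the ambient space, so \<open>\<omega>\<close> may be taken there.\<close>

definition quasi_umbilic ::
    "'m::finite set \<Rightarrow> (real ^ 'm) set \<Rightarrow> (real ^ 'm \<Rightarrow> real ^ 'm) \<Rightarrow> real ^ 'm \<Rightarrow> bool" where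
  "quasi_umbilic N M \<nu> p \<longleftrightarrow>
     (\<exists>\<alpha> \<beta> \<omega>. linear \<omega> \<and>
        (\<forall>v\<in>tangent_space M p. \<forall>w\<in>tangent_space M p.
           second_fundamental_form N M \<nu> p v w = \<alpha> * pdot N v w + \<beta> * \<omega> v * \<omega> w))"

text \<open>Every point has a neighbourhood in \<open>M\<close> which is conformally diffeomorphic to an open piece of a
  flat pseudo-Euclidean space of the dimension of \<open>M\<close>. The latter is realised as a coordinate
  hyperplane \<open>y\<^sub>k = 0\<close>, with an arbitrary set \<open>N'\<close> of negative coordinates. Smoothness of the conformal
  factor is automatic.\<close>

definition conformally_flat :: "'m::finite set \<Rightarrow> (real ^ 'm) set \<Rightarrow> bool" where
  "conformally_flat N M \<longleftrightarrow>
     (\<forall>p\<in>M. \<exists>U V N' k \<psi>. open U \<and> p \<in> U \<and> open V \<and>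
        diffeomorphism (M \<inter> U) (V \<inter> {y :: real ^ 'm. y $ k = 0}) \<psi> \<and>
        (\<forall>q\<in>M \<inter> U. \<exists>\<sigma>>0. \<forall>v\<in>tangent_space M q. \<forall>w\<in>tangent_space M q.
           pdot N' (differential M \<psi> q v) (differential M \<psi> q w) = \<sigma> * pdot N v w))"

text \<open>Isometries of the ambient space in the pseudo-Riemannian sense.\<close>

definition motion :: "'m::finite set \<Rightarrow> (real ^ 'm \<Rightarrow> real ^ 'm) \<Rightarrow> bool" where
  "motion N T \<longleftrightarrow>
     diffeomorphism UNIV UNIV T \<and>
     (\<forall>p v w. pdot N (differential UNIV T p v) (differential UNIV T p w) = pdot N v w)"

definition congruence :: "'m::finite set \<Rightarrow> (real ^ 'm) set \<Rightarrow> (real ^ 'm \<Rightarrow> real ^ 'm) \<Rightarrow> bool" where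
  "congruence N M f \<longleftrightarrow> (\<exists>T. motion N T \<and> (\<forall>p\<in>M. T p = f p))"

text \<open>The quotient of the bendings is a partial function of \<open>x\<close>; the limit is taken over its
  domain in the tangent space at \<open>p\<close>. The condition \<open>bending N M \<nu> p x \<noteq> 0\<close> belongs to that domain:
  without it the convention \<open>a / 0 = 0\<close> would make the limit fail even for the identity map wherever
  \<open>h(\<xi>,\<xi>) = 0\<close> and \<open>h\<close> vanishes on nonisotropic vectors arbitrarily close to \<open>\<xi>\<close>. Nonisotropic
  vectors are automatically nonzero.\<close>

definition asymptotically_bending_preserving ::
    "'m::finite set \<Rightarrow> (real ^ 'm) set \<Rightarrow> (real ^ 'm \<Rightarrow> real ^ 'm) \<Rightarrow>
     (real ^ 'm) set \<Rightarrow> (real ^ 'm \<Rightarrow> real ^ 'm) \<Rightarrow> (real ^ 'm \<Rightarrow> real ^ 'm) \<Rightarrow> bool" where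
  "asymptotically_bending_preserving N M \<nu> M' \<nu>' f \<longleftrightarrow>
     (\<forall>p\<in>M. \<forall>\<xi>\<in>tangent_space M p. isotropic N \<xi> \<longrightarrow>
        ((\<lambda>x. bending N M' \<nu>' (f p) (differential M f p x) / bending N M \<nu> p x) \<longlongrightarrow> 1)
          (at \<xi> within
             {x \<in> tangent_space M p.
                pdot N x x \<noteq> 0 \<and>
                pdot N (differential M f p x) (differential M f p x) \<noteq> 0 \<and>
                bending N M \<nu> p x \<noteq> 0}))"

end

theory Submission
  imports Defs "HOL-Computational_Algebra.Polynomial"
begin

text \<open>
  At a nonquasi-umbilic point the limit condition forces the quartic form \<open>g'(x,x) h(x,x)\<close> to vanish
  on the null cone of \<open>g\<close>, where \<open>g'\<close>, \<open>h'\<close> are the forms pulled back by \<open>f\<close>. The null cone is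
  irreducible and \<open>h\<close> is not a multiple of \<open>g\<close>, so \<open>g' = \<sigma> g\<close>; the same argument for
  \<open>(h' - \<sigma> h) h\<close> gives \<open>h' = \<sigma> h + \<rho> g\<close>. By density both identities hold everywhere.

  Comparing the Codazzi equations of the two hypersurfaces yields
  \<open>d\<sigma>(w) h(u,v) - d\<sigma>(u) h(w,v) = 2 (\<theta>(w) g(u,v) - \<theta>(u) g(w,v))\<close>
  for some \<open>\<theta>\<close>, and a nonzero \<open>d\<sigma>\<close> would make \<open>h\<close> quasi-umbilic; hence \<open>\<sigma>\<close> is locally constant.
  Then the Gauss equations say that the curvature-like tensors of \<open>h'\<close> and \<open>h\<close> differ by the factor
  \<open>\<sigma>\<close>. If \<open>\<sigma> \<noteq> 1\<close>, completing the square produces a multiple of \<open>g\<close> whose sum with \<open>h\<close> has rank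
  at most one or is itself a multiple of \<open>g\<close>, which is excluded; and \<open>\<sigma> = 1\<close> forces \<open>\<rho> = 0\<close>.
  So \<open>f\<close> preserves both fundamental forms, and the linear map carrying the frame
  \<open>(X\<^sub>u, \<nu>)\<close> to \<open>((f \<circ> X)\<^sub>u, \<nu>' \<circ> f)\<close> is constant along \<open>M\<close>.
\<close>

section \<open>Calculus of smooth maps\<close>

text \<open>Written as h'(x,x) g(x,x) / (g'(x,x) h(x,x)), the quotient of the bendings has g(x,x) in
  its numerator, so it would tend to 0 instead of 1 at a null vector where g' h does not vanish;
  this is the source of the quartic form. The order of the two structure equations matters. The
  Gauss equation of a conformally changed metric contains second derivatives of \<sigma>, the
  Codazzi equation only first ones. Codazzi is therefore used to make the derivative of \<sigma>
  vanish on a whole open set; afterwards the Christoffel symbols of the first kind are just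
  multiplied by \<sigma>, and the Gauss equations can be compared. No connection or curvature tensor
  is formed: products of first and second derivatives of a parametrisation X replace them. M' is
  parametrised by f o X over the same domain. At a single point, the value of f, its differential
  and the normals determine an affine isometry uniquely. Local isometries therefore agree on
  overlaps, and connectedness of M yields a global one.\<close>

abbreviation dird :: "('a::euclidean_space \<Rightarrow> 'b::euclidean_space) \<Rightarrow> 'a \<Rightarrow> 'a \<Rightarrow> 'b" where
  "dird f v x \<equiv> frechet_derivative f (at x) v"

lemma differentiable_imp_dird:
  "f differentiable (at x) \<Longrightarrow> (f has_derivative (\<lambda>v. dird f v x)) (at x)"
  using frechet_derivative_works[of f "at x"] by simp

lemma dirdI: "(f has_derivative f') (at x) \<Longrightarrow> dird f v x = f' v"
  using frechet_derivative_at by metis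

lemma dird_cong:
  assumes "open U" "x \<in> U" "\<And>y. y \<in> U \<Longrightarrow> f y = g y" "f differentiable (at x)"
  shows "dird f v x = dird g v x"
  using frechet_derivative_transform_within_open[of f x U g] assms by simp

lemma Ck_on_continuous: "Ck_on k f U \<Longrightarrow> continuous_on U f"
  by (cases k) (auto simp: differentiable_at_withinI differentiable_imp_continuous_on differentiable_on_def)

lemma Ck_on_dird: "Ck_on (Suc k) f U \<Longrightarrow> Ck_on k (dird f v) U"
  by simp

lemma Ck_on_SucD: "Ck_on (Suc k) f U \<Longrightarrow> Ck_on k f U"
proof (induction k arbitrary: f)
  case 0
  then show ?case by (simp only: Ck_on.simps(1) Ck_on_continuous)
next
  case (Suc k)
  have "Ck_on k (dird f v) U" for v by (rule Suc.IH, rule Ck_on_dird, rule Suc.prems)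
  then show ?case using Suc.prems by simp
qed

lemma Ck_on_subset: "Ck_on k f U \<Longrightarrow> V \<subseteq> U \<Longrightarrow> Ck_on k f V"
  by (induction k arbitrary: f) (auto intro: continuous_on_subset)

lemma differentiable_cong_open:
  assumes "open U" "x \<in> U" "\<And>y. y \<in> U \<Longrightarrow> f y = g y" "f differentiable (at x)"
  shows "g differentiable (at x)"
  using assms unfolding differentiable_def by (meson has_derivative_transform_within_open)

lemma Ck_on_cong:
  assumes "open U" "\<And>x. x \<in> U \<Longrightarrow> f x = g x" "Ck_on k f U"
  shows "Ck_on k g U"
  using assms(2,3)
proof (induction k arbitrary: f g)
  case 0
  then show ?case by (simp cong: continuous_on_cong)
next
  case (Suc k)
  have d: "f differentiable (at x)" if "x \<in> U" for x using Suc that by simp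
  have "Ck_on k (\<lambda>x. dird g v x) U" for v
    by (rule Suc.IH[of "\<lambda>x. dird f v x"])
       (use Suc.prems d in \<open>auto intro!: dird_cong[OF \<open>open U\<close>]\<close>)
  moreover have "g differentiable (at x)" if "x \<in> U" for x
    by (rule differentiable_cong_open[OF \<open>open U\<close> that Suc.prems(1) d[OF that]])
  ultimately show ?case by simp
qed

text \<open>\<open>smooth_on\<close> provides a different extension near each point, so the
  regularity of a composition is obtained on small neighbourhoods first and then assembled.\<close>

lemma Ck_on_local:
  assumes "\<And>x. x \<in> U \<Longrightarrow> \<exists>V. open V \<and> x \<in> V \<and> Ck_on k f V"
  shows "Ck_on k f U"
  using assms
proof (induction k arbitrary: f)
  case 0
  have "continuous (at x within U) f" if x: "x \<in> U" for x
  proof -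
    obtain V where "open V" "x \<in> V" "continuous_on V f" using 0[OF x] by auto
    then show ?thesis by (simp add: continuous_on_eq_continuous_at continuous_at_imp_continuous_within)
  qed
  then show ?case by (simp add: continuous_on_eq_continuous_within)
next
  case (Suc k)
  have "Ck_on k (\<lambda>x. dird f v x) U" for v
    by (rule Suc.IH) (use Suc.prems in force)
  moreover have "f differentiable (at x)" if "x \<in> U" for x using Suc.prems[OF that] by auto
  ultimately show ?case by simp
qed

lemma Ck_on_const: "Ck_on k (\<lambda>x. c) U"
  by (induction k arbitrary: c) auto

lemma Ck_on_linear:
  assumes "bounded_linear L" "open U"
  shows "Ck_on k f U \<Longrightarrow> Ck_on k (\<lambda>x. L (f x)) U"
proof (induction k arbitrary: f)
  case 0
  then show ?case
    using assms(1) by (simp add: bounded_linear.continuous_on)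
next
  case (Suc k)
  have d: "((\<lambda>x. L (f x)) has_derivative (\<lambda>v. L (dird f v x))) (at x)" if "x \<in> U" for x
    using Suc.prems that
    by (intro bounded_linear.has_derivative[OF assms(1)] differentiable_imp_dird) auto
  have "Ck_on k (\<lambda>x. dird (\<lambda>x. L (f x)) v x) U" for v
    by (rule Ck_on_cong[OF \<open>open U\<close>, of "\<lambda>x. L (dird f v x)"])
       (use Suc dirdI[OF d] in auto)
  then show ?case using d by (auto simp: differentiable_def)
qed

lemma Ck_on_add:
  assumes "open U"
  shows "Ck_on k f U \<Longrightarrow> Ck_on k g U \<Longrightarrow> Ck_on k (\<lambda>x. f x + g x) U"
proof (induction k arbitrary: f g)
  case 0
  then show ?case by (simp add: continuous_on_add)
next
  case (Suc k)
  have d: "((\<lambda>x. f x + g x) has_derivative (\<lambda>v. dird f v x + dird g v x)) (at x)" if "x \<in> U" for x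
    using Suc.prems that
    by (intro has_derivative_add differentiable_imp_dird) auto
  have "Ck_on k (\<lambda>x. dird (\<lambda>x. f x + g x) v x) U" for v
    by (rule Ck_on_cong[OF \<open>open U\<close>, of "\<lambda>x. dird f v x + dird g v x"])
       (use Suc dirdI[OF d] in auto)
  then show ?case using d by (auto simp: differentiable_def)
qed

lemma Ck_on_sum:
  assumes "open U" "\<And>i. i \<in> S \<Longrightarrow> Ck_on k (f i) U"
  shows "Ck_on k (\<lambda>x. \<Sum>i\<in>S. f i x) U"
  using assms(2)
  by (induction S rule: infinite_finite_induct) (auto intro: Ck_on_const Ck_on_add[OF assms(1)])

lemma Ck_on_bilinear:
  assumes "bounded_bilinear B" "open U"
  shows "Ck_on k f U \<Longrightarrow> Ck_on k g U \<Longrightarrow> Ck_on k (\<lambda>x. B (f x) (g x)) U"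
proof (induction k arbitrary: f g)
  case 0
  then show ?case
    using bounded_bilinear.continuous_on[OF assms(1)] by simp
next
  case (Suc k)
  have d: "((\<lambda>x. B (f x) (g x)) has_derivative (\<lambda>v. B (f x) (dird g v x) + B (dird f v x) (g x))) (at x)"
    if "x \<in> U" for x
    using Suc.prems that
    by (intro bounded_bilinear.FDERIV[OF assms(1)] differentiable_imp_dird) auto
  have C: "Ck_on k f U" "Ck_on k g U" using Suc.prems by (blast intro: Ck_on_SucD)+
  have "Ck_on k (\<lambda>x. dird (\<lambda>x. B (f x) (g x)) v x) U" for v
    by (rule Ck_on_cong[OF \<open>open U\<close>, of "\<lambda>x. B (f x) (dird g v x) + B (dird f v x) (g x)"])
       (use Suc C dirdI[OF d] in \<open>auto intro!: Ck_on_add[OF assms(2)]\<close>)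
  then show ?case using d by (auto simp: differentiable_def)
qed

lemma Ck_on_compose:
  fixes g :: "'b::euclidean_space \<Rightarrow> 'c::euclidean_space" and f :: "'a::euclidean_space \<Rightarrow> 'b"
  assumes "open U" "open V" "f ` U \<subseteq> V"
  shows "Ck_on k g V \<Longrightarrow> Ck_on k f U \<Longrightarrow> Ck_on k (\<lambda>x. g (f x)) U"
proof (induction k arbitrary: g)
  case 0
  then show ?case using continuous_on_compose2 assms(3) by fastforce
next
  case (Suc k)
  have dg: "(g has_derivative (\<lambda>v. dird g v (f x))) (at (f x))" if "x \<in> U" for x
    using Suc.prems(1) that assms(3) by (intro differentiable_imp_dird) (simp add: image_subset_iff)
  have df: "(f has_derivative (\<lambda>v. dird f v x)) (at x)" if "x \<in> U" for x
    using Suc.prems(2) that by (intro differentiable_imp_dird) simp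
  have d: "((\<lambda>x. g (f x)) has_derivative (\<lambda>v. dird g (dird f v x) (f x))) (at x)" if "x \<in> U" for x
    using has_derivative_compose[OF df[OF that] dg[OF that]] .
  \<comment> \<open>The chain rule produces the direction \<open>dird f v x\<close>, which varies
    with x, while \<open>Ck_on\<close> speaks of fixed directions. Expanding it in the basis leaves
    derivatives of g along fixed vectors, to which the induction hypothesis applies.\<close>
  have e: "dird g w (f x) = (\<Sum>b\<in>Basis. (w \<bullet> b) *\<^sub>R dird g b (f x))" if "x \<in> U" for x w
  proof -
    have l: "linear (\<lambda>v. dird g v (f x))"
      using dg[OF that] has_derivative_bounded_linear bounded_linear.linear by blast
    have "dird g w (f x) = dird g (\<Sum>b\<in>Basis. (w \<bullet> b) *\<^sub>R b) (f x)"
      by (simp add: euclidean_representation)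
    also have "\<dots> = (\<Sum>b\<in>Basis. (w \<bullet> b) *\<^sub>R dird g b (f x))"
      using linear_sum[OF l, of "\<lambda>b. (w \<bullet> b) *\<^sub>R b" Basis] linear_cmul[OF l] by simp
    finally show ?thesis .
  qed
  have C: "Ck_on k f U" using Suc.prems by (blast intro: Ck_on_SucD)
  have "Ck_on k (\<lambda>x. (dird f v x \<bullet> b) *\<^sub>R dird g b (f x)) U" for v b
    by (rule Ck_on_bilinear[OF bounded_bilinear_scaleR \<open>open U\<close>])
       (use Suc C in \<open>auto intro!: Ck_on_linear[OF bounded_linear_inner_left \<open>open U\<close>]\<close>)
  then have "Ck_on k (\<lambda>x. \<Sum>b\<in>Basis. (dird f v x \<bullet> b) *\<^sub>R dird g b (f x)) U" for v
    by (intro Ck_on_sum[OF \<open>open U\<close>])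
  then have "Ck_on k (\<lambda>x. dird (\<lambda>x. g (f x)) v x) U" for v
    by (rule Ck_on_cong[OF \<open>open U\<close>, rotated]) (simp only: dirdI[OF d] e[symmetric])
  moreover have "(\<lambda>x. g (f x)) differentiable (at x)" if "x \<in> U" for x
    by (rule differentiableI[OF d[OF that]])
  ultimately show ?case by (simp only: Ck_on.simps) simp
qed

section \<open>Smooth maps on open sets and on subsets\<close>

definition Cinf_on :: "('a::euclidean_space \<Rightarrow> 'b::euclidean_space) \<Rightarrow> 'a set \<Rightarrow> bool" where
  "Cinf_on f U \<longleftrightarrow> open U \<and> (\<forall>k. Ck_on k f U)"

lemma Cinf_on_open: "Cinf_on f U \<Longrightarrow> open U"
  by (simp add: Cinf_on_def)

lemma Cinf_on_continuous: "Cinf_on f U \<Longrightarrow> continuous_on U f"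
  using Ck_on_continuous by (auto simp: Cinf_on_def)

lemma Cinf_on_subset: "Cinf_on f U \<Longrightarrow> open V \<Longrightarrow> V \<subseteq> U \<Longrightarrow> Cinf_on f V"
  unfolding Cinf_on_def by (blast intro: Ck_on_subset)

lemma Cinf_on_differentiable: "Cinf_on f U \<Longrightarrow> x \<in> U \<Longrightarrow> f differentiable (at x)"
  by (auto simp: Cinf_on_def dest: spec[of _ "Suc 0"])

lemma Cinf_on_has_derivative:
  "Cinf_on f U \<Longrightarrow> x \<in> U \<Longrightarrow> (f has_derivative (\<lambda>v. dird f v x)) (at x)"
  by (intro differentiable_imp_dird Cinf_on_differentiable)

lemma Cinf_on_dird: "Cinf_on f U \<Longrightarrow> Cinf_on (dird f v) U"
  unfolding Cinf_on_def using Ck_on_dird by blast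

lemma dird_linear: "Cinf_on f U \<Longrightarrow> x \<in> U \<Longrightarrow> linear (\<lambda>v. dird f v x)"
  by (rule has_derivative_linear[OF Cinf_on_has_derivative])

lemma Cinf_on_compose:
  "Cinf_on g V \<Longrightarrow> Cinf_on f U \<Longrightarrow> f ` U \<subseteq> V \<Longrightarrow> Cinf_on (\<lambda>x. g (f x)) U"
  unfolding Cinf_on_def using Ck_on_compose by blast

lemma Cinf_on_linear: "bounded_linear L \<Longrightarrow> Cinf_on f U \<Longrightarrow> Cinf_on (\<lambda>x. L (f x)) U"
  unfolding Cinf_on_def using Ck_on_linear by blast

lemma Cinf_on_add: "Cinf_on f U \<Longrightarrow> Cinf_on g U \<Longrightarrow> Cinf_on (\<lambda>x. f x + g x) U"
  unfolding Cinf_on_def using Ck_on_add by blast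

lemma Cinf_on_const: "open U \<Longrightarrow> Cinf_on (\<lambda>x. c) U"
  unfolding Cinf_on_def using Ck_on_const by blast

lemma Ck_on_ident: "Ck_on k (\<lambda>x. x) U"
proof (cases k)
  case (Suc j)
  show ?thesis
    unfolding Suc Ck_on.simps frechet_derivative_ident by (intro conjI ballI allI Ck_on_const) simp
qed simp

lemma Cinf_on_ident: "open U \<Longrightarrow> Cinf_on (\<lambda>x. x) U"
  unfolding Cinf_on_def using Ck_on_ident by blast

lemma smooth_onE:
  assumes "smooth_on M f" "p \<in> M"
  obtains F U where "Cinf_on F U" "p \<in> U" "\<forall>x\<in>M \<inter> U. F x = f x"
proof -
  obtain U F where *: "open U \<and> p \<in> U \<and> (\<forall>k. Ck_on k F U) \<and> (\<forall>x\<in>M \<inter> U. F x = f x)"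
    using bspec[OF assms(1)[unfolded smooth_on_def] assms(2)] by (elim exE)
  show thesis
    by (rule that[of F U]) (use * in \<open>simp_all add: Cinf_on_def\<close>)
qed

text \<open>Near each parameter, f agrees along X with a smooth extension. Composing with a
  parametrisation thus turns maps known only on M into maps on an open set, where all derivatives
  can be taken.\<close>

lemma smooth_on_compose:
  assumes "smooth_on M f" "Cinf_on X W" "X ` W \<subseteq> M"
  shows "Cinf_on (\<lambda>y. f (X y)) W"
proof -
  have W: "open W" using assms(2) by (rule Cinf_on_open)
  have loc: "\<exists>V. open V \<and> y \<in> V \<and> Ck_on k (\<lambda>y. f (X y)) V" if "y \<in> W" for y k
  proof -
    have "X y \<in> M" using assms(3) that by (simp add: image_subset_iff)
    with assms(1) obtain F U where
      U: "Cinf_on F U" "X y \<in> U" "\<forall>x\<in>M \<inter> U. F x = f x"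
      by (rule smooth_onE)
    define V where "V = W \<inter> X -` U"
    have V: "open V"
      unfolding V_def
      by (rule continuous_open_preimage[OF Cinf_on_continuous[OF assms(2)] W Cinf_on_open[OF U(1)]])
    have "Cinf_on X V" using assms(2) V by (rule Cinf_on_subset) (simp add: V_def)
    with U(1) have "Cinf_on (\<lambda>y. F (X y)) V"
      by (rule Cinf_on_compose) (simp add: V_def image_subset_iff)
    then have "Ck_on k (\<lambda>y. F (X y)) V" by (simp add: Cinf_on_def)
    moreover have "F (X y) = f (X y)" if "y \<in> V" for y
      using U(3) assms(3) that by (simp add: V_def image_subset_iff)
    ultimately have "Ck_on k (\<lambda>y. f (X y)) V"
      by (rule Ck_on_cong[OF V, rotated])
    moreover have "y \<in> V" using that U(2) by (simp add: V_def)
    ultimately show ?thesis using V by (intro exI[of _ V]) simp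
  qed
  show ?thesis
    unfolding Cinf_on_def by (intro conjI allI W Ck_on_local loc)
qed

lemma smooth_on_open_iff: "open U \<Longrightarrow> smooth_on U f \<longleftrightarrow> Cinf_on f U"
proof
  assume "open U" "smooth_on U f"
  then show "Cinf_on f U" using smooth_on_compose[of U f "\<lambda>x. x" U] Cinf_on_ident[of U] by simp
next
  assume "Cinf_on f U"
  then show "smooth_on U f"
    unfolding smooth_on_def Cinf_on_def by (intro ballI exI[of _ U] exI[of _ f]) simp
qed

text \<open>\<open>differential\<close> is a choice among the derivatives within M; the derivative
  of a local extension shows that there is one to choose.\<close>

lemma smooth_on_imp_has_derivative_within:
  assumes "smooth_on M f" "p \<in> M"
  shows "(f has_derivative differential M f p) (at p within M)"
proof -
  from assms obtain F U where
    U: "Cinf_on F U" "p \<in> U" "\<forall>x\<in>M \<inter> U. F x = f x"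
    by (rule smooth_onE)
  obtain e where e: "e > 0" "ball p e \<subseteq> U"
    using Cinf_on_open[OF U(1)] U(2) open_contains_ball by blast
  have "(F has_derivative (\<lambda>v. dird F v p)) (at p within M)"
    by (rule has_derivative_at_withinI[OF Cinf_on_has_derivative[OF U(1,2)]])
  then have "(f has_derivative (\<lambda>v. dird F v p)) (at p within M)"
    by (rule has_derivative_transform_within[OF _ e(1) assms(2)])
       (use e(2) U(3) in \<open>simp add: subset_eq dist_commute\<close>)
  then show ?thesis
    unfolding differential_def using frechet_derivative_works differentiableI by blast
qed

text \<open>The second difference is symmetric in \<open>u\<close> and \<open>v\<close>; letting \<open>t\<close> tend to \<open>0\<close> interchanges the
  derivatives.\<close>

lemma second_difference_mvt:
  fixes f :: "'a::euclidean_space \<Rightarrow> real"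
  assumes C: "Cinf_on f (ball x r)" and t: "t > 0" "t * (norm u + norm v) < r"
  shows "\<exists>z. norm (z - x) \<le> t * (norm u + norm v) \<and>
    f (x + t *\<^sub>R u + t *\<^sub>R v) - f (x + t *\<^sub>R u) - (f (x + t *\<^sub>R v) - f x) = t\<^sup>2 * dird (dird f u) v z"
proof -
  have nrm: "norm (a *\<^sub>R u + b *\<^sub>R v) \<le> t * (norm u + norm v)" if "0 \<le> a" "a \<le> t" "0 \<le> b" "b \<le> t" for a b
  proof -
    have "norm (a *\<^sub>R u + b *\<^sub>R v) \<le> a * norm u + b * norm v"
      using norm_triangle_ineq[of "a *\<^sub>R u" "b *\<^sub>R v"] that by simp
    also have "\<dots> \<le> t * norm u + t * norm v"
      by (intro add_mono mult_right_mono) (use that in auto)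
    finally show ?thesis by (simp add: algebra_simps)
  qed
  have inb: "x + (a *\<^sub>R u + b *\<^sub>R v) \<in> ball x r" if "0 \<le> a" "a \<le> t" "0 \<le> b" "b \<le> t" for a b
  proof -
    have "dist x (x + w) = norm w" for w by (simp add: dist_norm)
    then show ?thesis using le_less_trans[OF nrm[OF that] t(2)] by (simp only: mem_ball)
  qed
  \<comment> \<open>The increment of f in direction v as a function of the step in direction u:
    \<open>\<phi> t - \<phi> 0\<close> is the second difference. The summand
    \<open>0 *\<^sub>R v\<close> gives both terms the shape that \<open>d1\<close> expects.\<close>
  define \<phi> where "\<phi> s = f (x + (s *\<^sub>R u + t *\<^sub>R v)) - f (x + (s *\<^sub>R u + 0 *\<^sub>R v))" for s
  have d1: "((\<lambda>s. f (x + (s *\<^sub>R u + b *\<^sub>R v))) has_derivative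
      (\<lambda>h. h * dird f u (x + (s *\<^sub>R u + b *\<^sub>R v)))) (at s)" if "0 \<le> s" "s \<le> t" "0 \<le> b" "b \<le> t" for s b
  proof -
    have "((\<lambda>s. x + (s *\<^sub>R u + b *\<^sub>R v)) has_derivative (\<lambda>h. h *\<^sub>R u)) (at s)"
      by (auto intro!: derivative_eq_intros)
    from has_derivative_compose[OF this Cinf_on_has_derivative[OF C inb[OF that]]]
    show ?thesis
      using linear_cmul[OF dird_linear[OF C inb[OF that]]] by simp
  qed
  have C2: "Cinf_on (dird f u) (ball x r)" using C by (rule Cinf_on_dird)
  have d2: "((\<lambda>b. dird f u (x + (s *\<^sub>R u + b *\<^sub>R v))) has_derivative
      (\<lambda>h. h * dird (dird f u) v (x + (s *\<^sub>R u + b *\<^sub>R v)))) (at b)" if "0 \<le> s" "s \<le> t" "0 \<le> b" "b \<le> t" for s b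
  proof -
    have "((\<lambda>b. x + (s *\<^sub>R u + b *\<^sub>R v)) has_derivative (\<lambda>h. h *\<^sub>R v)) (at b)"
      by (auto intro!: derivative_eq_intros)
    from has_derivative_compose[OF this Cinf_on_has_derivative[OF C2 inb[OF that]]]
    show ?thesis
      using linear_cmul[OF dird_linear[OF C2 inb[OF that]]] by simp
  qed
  have D1: "(\<phi> has_derivative (\<lambda>h. h * dird f u (x + (s *\<^sub>R u + t *\<^sub>R v)) -
      h * dird f u (x + (s *\<^sub>R u + 0 *\<^sub>R v)))) (at s within {0..t})" if "0 \<le> s" "s \<le> t" for s
    unfolding \<phi>_def
    by (intro has_derivative_diff has_derivative_at_withinI[OF d1]) (use t that in linarith)+
  obtain s where s: "0 < s" "s < t" "\<phi> t - \<phi> 0 =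
      t * (dird f u (x + (s *\<^sub>R u + t *\<^sub>R v)) - dird f u (x + (s *\<^sub>R u + 0 *\<^sub>R v)))"
    using mvt_simple[OF t(1) D1] by (force simp: right_diff_distrib)
  have D2: "((\<lambda>b. dird f u (x + (s *\<^sub>R u + b *\<^sub>R v))) has_derivative
      (\<lambda>h. h * dird (dird f u) v (x + (s *\<^sub>R u + b *\<^sub>R v)))) (at b within {0..t})"
    if "0 \<le> b" "b \<le> t" for b
    by (intro has_derivative_at_withinI[OF d2]) (use s that in linarith)+
  obtain b where b: "0 < b" "b < t"
    "dird f u (x + (s *\<^sub>R u + t *\<^sub>R v)) - dird f u (x + (s *\<^sub>R u + 0 *\<^sub>R v)) =
      t * dird (dird f u) v (x + (s *\<^sub>R u + b *\<^sub>R v))"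
    using mvt_simple[OF t(1) D2] by force
  have "\<phi> t - \<phi> 0 = t\<^sup>2 * dird (dird f u) v (x + (s *\<^sub>R u + b *\<^sub>R v))"
    using s(3) b(3) by (simp add: power2_eq_square)
  then show ?thesis
    using nrm[of s b] s b unfolding \<phi>_def
    by (intro exI[of _ "x + (s *\<^sub>R u + b *\<^sub>R v)"]) (auto simp: algebra_simps)
qed

lemma dird_commute_real:
  fixes f :: "'a::euclidean_space \<Rightarrow> real"
  assumes "Cinf_on f U" "x \<in> U"
  shows "dird (dird f u) v x = dird (dird f v) u x"
proof (rule ccontr)
  define \<Phi> where "\<Phi> = (\<lambda>y. dird (dird f u) v y)"
  define \<Psi> where "\<Psi> = (\<lambda>y. dird (dird f v) u y)"
  \<comment> \<open>Half of the assumed gap: if both second derivatives stay within e of their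
    values at x, they cannot take a common value near x.\<close>
  define e where "e = \<bar>\<Phi> x - \<Psi> x\<bar> / 2"
  assume "dird (dird f u) v x \<noteq> dird (dird f v) u x"
  then have e: "e > 0" by (simp add: e_def \<Phi>_def \<Psi>_def)
  have U: "open U" using assms(1) by (rule Cinf_on_open)
  have cont: "isCont \<Phi> x" "isCont \<Psi> x"
    unfolding \<Phi>_def \<Psi>_def
    using Cinf_on_continuous[OF Cinf_on_dird[OF Cinf_on_dird[OF assms(1)]]] U assms(2)
    by (auto simp: continuous_on_eq_continuous_at)
  obtain r0 where r0: "r0 > 0" "ball x r0 \<subseteq> U" using U assms(2) open_contains_ball by blast
  obtain d1 where d1: "d1 > 0" "\<And>y. dist y x < d1 \<Longrightarrow> dist (\<Phi> y) (\<Phi> x) < e"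
    using cont(1) e unfolding continuous_at_eps_delta by blast
  obtain d2 where d2: "d2 > 0" "\<And>y. dist y x < d2 \<Longrightarrow> dist (\<Psi> y) (\<Psi> x) < e"
    using cont(2) e unfolding continuous_at_eps_delta by blast
  define r where "r = Min {r0, d1, d2}"
  have r: "r > 0" "r \<le> r0" "r \<le> d1" "r \<le> d2" using r0 d1 d2 by (auto simp: r_def)
  \<comment> \<open>The \<open>1\<close> in the denominator covers u = v = 0 and makes the second
    estimate strict.\<close>
  define t where "t = r / (norm u + norm v + 1)"
  have t: "t > 0" "t * (norm u + norm v) < r"
    using r(1) by (auto simp: t_def field_simps add_nonneg_pos add_pos_nonneg intro!: divide_pos_pos)
  have C: "Cinf_on f (ball x r)"
    using assms(1) by (rule Cinf_on_subset) (use r r0 in auto)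
  obtain z where z: "norm (z - x) \<le> t * (norm u + norm v)"
    "f (x + t *\<^sub>R u + t *\<^sub>R v) - f (x + t *\<^sub>R u) - (f (x + t *\<^sub>R v) - f x) = t\<^sup>2 * \<Phi> z"
    using second_difference_mvt[OF C t] unfolding \<Phi>_def by blast
  obtain w where w: "norm (w - x) \<le> t * (norm v + norm u)"
    "f (x + t *\<^sub>R v + t *\<^sub>R u) - f (x + t *\<^sub>R v) - (f (x + t *\<^sub>R u) - f x) = t\<^sup>2 * \<Psi> w"
    using second_difference_mvt[OF C, of t v u] t unfolding \<Psi>_def by (auto simp: add.commute)
  have "f (x + t *\<^sub>R v + t *\<^sub>R u) = f (x + t *\<^sub>R u + t *\<^sub>R v)" by (simp add: algebra_simps)
  then have "t\<^sup>2 * \<Phi> z = t\<^sup>2 * \<Psi> w" using z(2) w(2) by linarith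
  then have "\<Phi> z = \<Psi> w" using t(1) by simp
  moreover have "dist (\<Phi> z) (\<Phi> x) < e" "dist (\<Psi> w) (\<Psi> x) < e"
  proof -
    have "dist z x < r" "dist w x < r"
      using z(1) w(1) t(2) by (simp_all add: dist_norm add.commute[of "norm v"])
    then show "dist (\<Phi> z) (\<Phi> x) < e" "dist (\<Psi> w) (\<Psi> x) < e"
      using r d1(2)[of z] d2(2)[of w] by linarith+
  qed
  ultimately show False unfolding e_def dist_real_def by (auto simp: abs_if split: if_splits)
qed

lemma dird_commute:
  assumes "Cinf_on f U" "x \<in> U"
  shows "dird (dird f u) v x = dird (dird f v) u x"
proof (rule euclidean_eqI)
  fix b :: 'b assume "b \<in> Basis"
  have U: "open U" using assms(1) by (rule Cinf_on_open)
  have C: "Cinf_on (\<lambda>x. f x \<bullet> b) U"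
    by (rule Cinf_on_linear[OF bounded_linear_inner_left assms(1)])
  have i: "dird (\<lambda>y. g y \<bullet> b) w y = dird g w y \<bullet> b" if "Cinf_on g U" "y \<in> U" for g w y
    by (rule dirdI, rule bounded_linear.has_derivative[OF bounded_linear_inner_left Cinf_on_has_derivative[OF that]])
  have ii: "dird (dird (\<lambda>y. f y \<bullet> b) w) w' x = dird (dird f w) w' x \<bullet> b" for w w'
  proof -
    have "dird (dird (\<lambda>y. f y \<bullet> b) w) w' x = dird (\<lambda>y. dird f w y \<bullet> b) w' x"
      using Cinf_on_differentiable[OF Cinf_on_dird[OF C] assms(2)]
      by (intro dird_cong[OF U assms(2)]) (auto simp: i[OF assms(1)])
    then show ?thesis using i[OF Cinf_on_dird[OF assms(1)] assms(2)] by simp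
  qed
  show "dird (dird f u) v x \<bullet> b = dird (dird f v) u x \<bullet> b"
    using dird_commute_real[OF C assms(2), of u v] by (simp add: ii)
qed

section \<open>Symmetric bilinear forms\<close>

lemma quadratic_roots:
  fixes a b c :: real
  assumes "a > 0" "c < 0"
  obtains s t where "s \<noteq> t" "a + 2 * b * s + c * s\<^sup>2 = 0" "a + 2 * b * t + c * t\<^sup>2 = 0"
proof -
  define d where "d = sqrt (b\<^sup>2 - a * c)"
  have "a * c < 0" using assms by (simp add: mult_pos_neg)
  then have p: "b\<^sup>2 - a * c > 0" using zero_le_power2[of b] by linarith
  have d: "d > 0" "d\<^sup>2 = b\<^sup>2 - a * c" using p by (simp_all add: d_def)
  have root: "a + 2 * b * ((r - b) / c) + c * ((r - b) / c)\<^sup>2 = 0" if "r\<^sup>2 = b\<^sup>2 - a * c" for r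
  proof -
    have "c * (a + 2 * b * ((r - b) / c) + c * ((r - b) / c)\<^sup>2) = a * c + 2 * b * (r - b) + (r - b)\<^sup>2"
      using assms(2) by (simp add: field_simps power2_eq_square)
    also have "\<dots> = 0" using that by (simp add: power2_eq_square algebra_simps)
    finally show ?thesis using assms(2) by simp
  qed
  show thesis
    by (rule that[OF _ root[of d] root[of "- d"]]) (use d assms(2) in \<open>auto simp: field_simps\<close>)
qed

text \<open>For distinct roots s and t, Vieta gives the constant coefficient as s t times the
  leading one. This also holds for the zero polynomial, so no leading coefficient has to be
  nonzero.\<close>

lemma quadratics_proportional:
  fixes a b c a' b' c' :: real
  assumes "s \<noteq> t"
    "a + 2 * b * s + c * s\<^sup>2 = 0" "a + 2 * b * t + c * t\<^sup>2 = 0"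
    "a' + 2 * b' * s + c' * s\<^sup>2 = 0" "a' + 2 * b' * t + c' * t\<^sup>2 = 0"
  shows "a' * c = c' * a"
proof -
  have "(t - s) * (a - c * s * t) = 0" if "a + 2 * b * s + c * s\<^sup>2 = 0" "a + 2 * b * t + c * t\<^sup>2 = 0"
    for a b c :: real
    using that by algebra
  from this[OF assms(2,3)] this[OF assms(4,5)] show ?thesis using assms(1) by simp
qed

section \<open>Polynomial functions of one real variable\<close>

definition polynomial_map :: "(real \<Rightarrow> real) \<Rightarrow> bool" where
  "polynomial_map f \<longleftrightarrow> (\<exists>p. \<forall>t. f t = poly p t)"

lemma polynomial_map_const: "polynomial_map (\<lambda>t. c)"
  unfolding polynomial_map_def by (rule exI[of _ "[:c:]"]) simp

lemma polynomial_map_ident: "polynomial_map (\<lambda>t. t)"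
  unfolding polynomial_map_def by (rule exI[of _ "[:0, 1:]"]) simp

lemma polynomial_map_add:
  "polynomial_map f \<Longrightarrow> polynomial_map g \<Longrightarrow> polynomial_map (\<lambda>t. f t + g t)"
  unfolding polynomial_map_def by (metis poly_add)

lemma polynomial_map_diff:
  "polynomial_map f \<Longrightarrow> polynomial_map g \<Longrightarrow> polynomial_map (\<lambda>t. f t - g t)"
  unfolding polynomial_map_def by (metis poly_diff)

lemma polynomial_map_mult:
  "polynomial_map f \<Longrightarrow> polynomial_map g \<Longrightarrow> polynomial_map (\<lambda>t. f t * g t)"
  unfolding polynomial_map_def by (metis poly_mult)

lemmas polynomial_map_intros =
  polynomial_map_const polynomial_map_ident polynomial_map_add polynomial_map_diff polynomial_map_mult

text \<open>Real polynomials form an integral domain and are determined by their values. The points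
  a and b are unrelated: nonvanishing of f at one point makes g vanish everywhere.\<close>

lemma polynomial_map_mult_eq_0:
  assumes "polynomial_map f" "polynomial_map g" "\<And>t. f t * g t = 0" "f a \<noteq> 0"
  shows "g b = 0"
proof -
  obtain p q where pq: "f = poly p" "g = poly q" using assms(1,2) unfolding polynomial_map_def by blast
  have "p * q = 0" using assms(3) poly_all_0_iff_0[of "p * q"] by (simp add: pq)
  then show ?thesis using assms(4) by (auto simp: pq)
qed

lemma polynomial_map_eventually_nonzero:
  assumes "polynomial_map f" "f a \<noteq> 0"
  shows "eventually (\<lambda>t. f t \<noteq> 0) (at b)"
proof -
  obtain p where p: "f = poly p" using assms(1) unfolding polynomial_map_def by blast
  then have "finite {t. poly p t = 0}" using assms(2) by (intro poly_roots_finite) auto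
  \<comment> \<open>The point b may itself be a root. Removing it from the closed set keeps the
    complement a neighbourhood of b, and \<open>at b\<close> ignores b.\<close>
  then have "open (- ({t. poly p t = 0} - {b}))" by (intro open_Compl finite_imp_closed) simp
  then show ?thesis
    unfolding eventually_at_topological
    by (intro exI[of _ "- ({t. poly p t = 0} - {b})"]) (simp add: p)
qed

section \<open>Bilinear forms restricted to a subspace\<close>

text \<open>Two linear forms give a map into the plane, which cannot be injective on a space of
  dimension three; this is how the dimension enters. With the Euclidean product by a nonzero vector
  as one of the forms, the result is independent of that vector.\<close>

lemma subspace_common_kernel:
  fixes T :: "'a::euclidean_space set" and \<phi> \<psi> :: "'a \<Rightarrow> real"
  assumes "subspace T" "dim T \<ge> 3" "linear \<phi>" "linear \<psi>"
  obtains y where "y \<in> T" "y \<noteq> 0" "\<phi> y = 0" "\<psi> y = 0"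
proof (rule ccontr)
  note main = that
  let ?L = "\<lambda>y. (\<phi> y, \<psi> y)"
  assume "\<not> thesis"
  then have k: "y = 0" if "y \<in> T" "\<phi> y = 0" "\<psi> y = 0" for y using that main by blast
  have L: "linear ?L"
    using assms(3,4) by (auto simp: linear_iff)
  have "inj_on ?L (span T)"
  proof (rule inj_onI)
    fix x y assume xy: "x \<in> span T" "y \<in> span T" "?L x = ?L y"
    then have "x - y \<in> T" using assms(1) span_eq_iff[of T] subspace_diff by metis
    moreover have "\<phi> (x - y) = 0" "\<psi> (x - y) = 0"
      using xy(3) linear_diff[OF assms(3)] linear_diff[OF assms(4)] by auto
    ultimately show "x = y" using k by fastforce
  qed
  then have "dim T = dim (?L ` T)" using dim_image_eq[OF L] by simp
  also have "\<dots> \<le> DIM(real \<times> real)" by (rule dim_subset_UNIV)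
  finally show False using assms(2) by simp
qed

text \<open>The forms are bilinear on the whole space, but all that matters is their restriction to \<open>T\<close>.\<close>

definition sym_form_on :: "'a::euclidean_space set \<Rightarrow> ('a \<Rightarrow> 'a \<Rightarrow> real) \<Rightarrow> bool" where
  "sym_form_on T b \<longleftrightarrow> bilinear b \<and> (\<forall>x\<in>T. \<forall>y\<in>T. b x y = b y x)"

definition proportional_on :: "'a set \<Rightarrow> ('a \<Rightarrow> 'a \<Rightarrow> real) \<Rightarrow> ('a \<Rightarrow> 'a \<Rightarrow> real) \<Rightarrow> bool" where
  "proportional_on T b g \<longleftrightarrow> (\<exists>c. \<forall>x\<in>T. \<forall>y\<in>T. b x y = c * g x y)"

definition quasi_umbilic_form :: "'a::euclidean_space set \<Rightarrow> ('a \<Rightarrow> 'a \<Rightarrow> real) \<Rightarrow> ('a \<Rightarrow> 'a \<Rightarrow> real) \<Rightarrow> bool" where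
  "quasi_umbilic_form T g h \<longleftrightarrow>
     (\<exists>\<alpha> \<beta> \<omega>. linear \<omega> \<and> (\<forall>v\<in>T. \<forall>w\<in>T. h v w = \<alpha> * g v w + \<beta> * \<omega> v * \<omega> w))"

lemmas bilinear_simps =
  bilinear_ladd bilinear_radd bilinear_lmul bilinear_rmul bilinear_lsub bilinear_rsub
  bilinear_lneg bilinear_rneg bilinear_lzero bilinear_rzero

lemma sym_form_onD:
  assumes "sym_form_on T b"
  shows sym_form_on_bilinear: "bilinear b" and sym_form_on_commute: "x \<in> T \<Longrightarrow> y \<in> T \<Longrightarrow> b x y = b y x"
  using assms by (auto simp: sym_form_on_def)

lemma sym_form_on_combination:
  assumes "sym_form_on T b" "sym_form_on T c"
  shows "sym_form_on T (\<lambda>x y. r * b x y + s * c x y)"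
  using assms unfolding sym_form_on_def bilinear_def linear_iff
  by (auto simp: algebra_simps)

lemma proportional_on_imp_quasi_umbilic:
  "proportional_on T h g \<Longrightarrow> quasi_umbilic_form T g h"
  unfolding proportional_on_def quasi_umbilic_form_def
  by (metis add_0_right linear_zero mult_zero_left mult.commute)

lemma sym_form_on_line:
  assumes "sym_form_on T b" "subspace T" "x \<in> T" "y \<in> T"
  shows "b (x + t *\<^sub>R y) (x + t *\<^sub>R y) = b x x + 2 * b x y * t + b y y * t\<^sup>2"
  using sym_form_onD[OF assms(1)] assms(3,4)
  by (simp add: bilinear_simps algebra_simps power2_eq_square)

lemma polynomial_map_line:
  assumes "sym_form_on T b" "subspace T" "x \<in> T" "y \<in> T"
  shows "polynomial_map (\<lambda>t. b (x + t *\<^sub>R y) (x + t *\<^sub>R y))"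
  unfolding sym_form_on_line[OF assms] power2_eq_square by (intro polynomial_map_intros)

lemma polarization:
  assumes "sym_form_on T b" "subspace T" "x \<in> T" "y \<in> T"
  shows "b x y = (b (x + y) (x + y) - b x x - b y y) / 2"
  using sym_form_on_line[OF assms, of 1] by simp

section \<open>The null cone of an indefinite scalar product\<close>

text \<open>In the application T is the hyperplane of parameters whose k-th coordinate is zero. The
  pulled back metric annihilates the k-th axis, so all conditions are restricted to T.\<close>

locale indefinite_scalar_product =
  fixes T :: "'a::euclidean_space set" and g :: "'a \<Rightarrow> 'a \<Rightarrow> real"
  assumes subspace_T: "subspace T" and dim_T: "dim T \<ge> 3"
    and sym_g: "sym_form_on T g"
    and nondegenerate: "x \<in> T \<Longrightarrow> (\<And>y. y \<in> T \<Longrightarrow> g x y = 0) \<Longrightarrow> x = 0"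
    and pos: "\<exists>x\<in>T. g x x > 0" and neg: "\<exists>x\<in>T. g x x < 0"
begin

lemmas bil_g = sym_form_on_bilinear[OF sym_g]
lemmas g_commute = sym_form_on_commute[OF sym_g]

lemma linear_g: "linear (g x)"
  using bil_g by (simp add: bilinear_def)

lemmas T_closed = subspace_add[OF subspace_T] subspace_diff[OF subspace_T]
  subspace_scale[OF subspace_T] subspace_0[OF subspace_T]

lemma proportional_on_if_diagonal:
  assumes "sym_form_on T b" "\<And>x. x \<in> T \<Longrightarrow> b x x = c * g x x"
  shows "proportional_on T b g"
proof -
  have "b x y = c * g x y" if "x \<in> T" "y \<in> T" for x y
  proof -
    have "b x y = (b (x + y) (x + y) - b x x - b y y) / 2"
      by (rule polarization[OF assms(1) subspace_T that])
    also have "\<dots> = c * ((g (x + y) (x + y) - g x x - g y y) / 2)"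
      using that by (simp add: assms(2) T_closed right_diff_distrib)
    finally show ?thesis by (simp only: polarization[OF sym_g subspace_T that, symmetric])
  qed
  then show ?thesis unfolding proportional_on_def by blast
qed

text \<open>The line through a positive x in a negative direction y contains two null points. On it
  b and g are quadratics sharing these roots, so the ratio of b to g is the same at x and y.\<close>

lemma null_cone_imp_proportional:
  assumes b: "sym_form_on T b" and null: "\<And>x. x \<in> T \<Longrightarrow> g x x = 0 \<Longrightarrow> b x x = 0"
  shows "proportional_on T b g"
proof -
  have cross: "b x x * g y y = b y y * g x x" if xy: "x \<in> T" "y \<in> T" "g x x > 0" "g y y < 0" for x y
  proof -
    obtain s t where st: "s \<noteq> t" "g x x + 2 * g x y * s + g y y * s\<^sup>2 = 0"
      "g x x + 2 * g x y * t + g y y * t\<^sup>2 = 0"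
      using quadratic_roots[OF xy(3,4)] by blast
    have "b x x + 2 * b x y * r + b y y * r\<^sup>2 = 0" if "g x x + 2 * g x y * r + g y y * r\<^sup>2 = 0" for r
      using null[of "x + r *\<^sub>R y"] that xy(1,2)
      by (simp add: sym_form_on_line[OF sym_g subspace_T] sym_form_on_line[OF b subspace_T] T_closed)
    then show ?thesis using quadratics_proportional[OF st] st(2,3) by blast
  qed
  obtain x y where xy: "x \<in> T" "g x x > 0" "y \<in> T" "g y y < 0" using pos neg by blast
  have "b z z = (b y y / g y y) * g z z" if z: "z \<in> T" for z
  proof -
    consider "g z z > 0" | "g z z < 0" | "g z z = 0" by linarith
    then show ?thesis
    proof cases
      case 1
      then show ?thesis using cross[of z y] xy z by (simp add: field_simps)
    next
      \<comment> \<open>\<open>cross\<close> needs vectors of opposite signs, so a negative z is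
        compared with the negative y through the positive x.\<close>
      case 2
      have "b z z * g x x = b x x * g z z" "b x x = b y y / g y y * g x x"
        using cross[of x z] cross[of x y] xy z 2 by (simp_all add: field_simps)
      then have "(b z z - b y y / g y y * g z z) * g x x = 0" by (simp add: algebra_simps)
      then show ?thesis using xy(2) by simp
    next
      case 3
      then show ?thesis using null z by simp
    qed
  qed
  then show ?thesis by (rule proportional_on_if_diagonal[OF b])
qed

text \<open>x and y span a hyperbolic plane. If its orthogonal complement consisted of null vectors,
  polarization would make it totally isotropic, and a nonzero vector of it would be orthogonal to
  everything.\<close>

lemma orthogonal_nonisotropic:
  assumes x: "x \<in> T" "y \<in> T" "g x x = 0" "g y y = 0" "g x y \<noteq> 0"
  obtains z where "z \<in> T" "g x z = 0" "g y z = 0" "g z z \<noteq> 0"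
proof (rule ccontr)
  note main = that
  assume "\<not> thesis"
  then have iso: "g z z = 0" if "z \<in> T" "g x z = 0" "g y z = 0" for z
    using that main by blast
  obtain z where z: "z \<in> T" "z \<noteq> 0" "g x z = 0" "g y z = 0"
    using subspace_common_kernel[OF subspace_T dim_T linear_g linear_g] by blast
  have "g z v = 0" if v: "v \<in> T" for v
  proof -
    \<comment> \<open>The component of v orthogonal to x and y; since both are null, each
      coefficient uses the product of v with the other vector.\<close>
    define w where "w = v - (g y v / g x y) *\<^sub>R x - (g x v / g x y) *\<^sub>R y"
    have w: "w \<in> T" using x v by (simp add: w_def T_closed)
    have "g x w = 0" "g y w = 0"
      using x g_commute[of y x] by (simp_all add: w_def bilinear_simps[OF bil_g])
    then have "g z w = 0"
      using polarization[OF sym_g subspace_T z(1) w] iso[OF w] iso[OF z(1)] iso[of "z + w"] z w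
      by (simp add: bilinear_simps[OF bil_g] T_closed)
    moreover have "g z w = g z v"
      using z x g_commute[of z x] g_commute[of z y] by (simp add: w_def bilinear_simps[OF bil_g])
    ultimately show ?thesis by simp
  qed
  then show False using nondegenerate[OF z(1)] z(2) by blast
qed

text \<open>A null vector is produced by reflecting x in a suitable w. If x and y are orthogonal,
  any w orthogonal to neither works. Otherwise w = x + y would reflect x to a multiple of y, and a
  nonisotropic z orthogonal to both is added to it.\<close>

lemma null_not_orthogonal:
  assumes x: "x \<in> T" "x \<noteq> 0" "g x x = 0" and y: "y \<in> T" "y \<noteq> 0" "g y y = 0"
  obtains z where "z \<in> T" "g z z = 0" "g z x \<noteq> 0" "g z y \<noteq> 0"
proof -
  \<comment> \<open>For nonisotropic w this is \<open>- g w w\<close> times the reflection of x in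
    the hyperplane orthogonal to w; the formula gives a null vector or zero for every w.\<close>
  define n where "n w = (2 * g w x) *\<^sub>R w - g w w *\<^sub>R x" for w
  have n: "n w \<in> T" "g (n w) (n w) = 0" "g (n w) x = 2 * (g w x)\<^sup>2"
    "g (n w) y = 2 * g w x * g w y - g w w * g x y" if "w \<in> T" for w
    using x y that g_commute[of x w]
    by (simp_all add: n_def T_closed bilinear_simps[OF bil_g] power2_eq_square algebra_simps)
  show thesis
  proof (cases "g x y = 0")
    case True
    obtain u where u: "u \<in> T" "g x u \<noteq> 0" using nondegenerate[OF x(1)] x(2) by blast
    obtain v where v: "v \<in> T" "g y v \<noteq> 0" using nondegenerate[OF y(1)] y(2) by blast
    obtain w where w: "w \<in> T" "g w x \<noteq> 0" "g w y \<noteq> 0"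
    proof (cases "g x v = 0 \<or> g y u = 0")
      case True
      then consider "g x v = 0" "g y u = 0" | "g x v \<noteq> 0" | "g y u \<noteq> 0" by blast
      then show thesis
      proof cases
        case 1
        then show thesis
          using that[of "u + v"] u v g_commute[of u x] g_commute[of v x] g_commute[of u y] g_commute[of v y] x y
          by (simp add: T_closed bilinear_simps[OF bil_g])
      next
        case 2
        then show thesis using that[of v] v x y g_commute[of v] by simp
      next
        case 3
        then show thesis using that[of u] u x y g_commute[of u] by simp
      qed
    next
      case False
      then show thesis using that[of v] v x y g_commute[of v] by simp
    qed
    then show thesis using that[of "n w"] n[of w] True by simp
  next
    case False
    then obtain z where z: "z \<in> T" "g x z = 0" "g y z = 0" "g z z \<noteq> 0"
      using orthogonal_nonisotropic[OF x(1) y(1) x(3) y(3)] by blast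
    define w where "w = x + y + z"
    have w: "w \<in> T" using x y z by (simp add: w_def T_closed)
    have "g w x = g x y" "g w y = g x y" "g w w = 2 * g x y + g z z"
      using x y z g_commute[of y x] g_commute[of z x] g_commute[of z y]
      by (simp_all add: w_def bilinear_simps[OF bil_g])
    then have "g (n w) x \<noteq> 0" "g (n w) y = - g z z * g x y"
      using n[OF w] False by (simp_all add: algebra_simps)
    then show thesis using that[of "n w"] n[OF w] False z by simp
  qed
qed

text \<open>The null cone is irreducible: it is parametrised by the quadratic map
  \<open>z \<mapsto> g(z,z) \<xi> - 2 g(\<xi>,z) z\<close> (a multiple of the reflection of a fixed null vector \<open>\<xi>\<close>), and
  polynomials in one variable form an integral domain.\<close>

lemma null_cone_irreducible:
  assumes b: "sym_form_on T b" "sym_form_on T c"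
    and null: "\<And>x. x \<in> T \<Longrightarrow> g x x = 0 \<Longrightarrow> b x x * c x x = 0"
  shows "proportional_on T b g \<or> proportional_on T c g"
proof (rule ccontr)
  assume neg: "\<not> ?thesis"
  obtain x where x: "x \<in> T" "g x x = 0" "b x x \<noteq> 0"
    using neg null_cone_imp_proportional[OF b(1)] by blast
  obtain y where y: "y \<in> T" "g y y = 0" "c y y \<noteq> 0"
    using neg null_cone_imp_proportional[OF b(2)] by blast
  have "x \<noteq> 0" "y \<noteq> 0"
    using x y b by (auto simp: bilinear_simps dest!: sym_form_on_bilinear)
  then obtain \<xi> where \<xi>: "\<xi> \<in> T" "g \<xi> \<xi> = 0" "g \<xi> x \<noteq> 0" "g \<xi> y \<noteq> 0"
    using null_not_orthogonal x y by metis
  define z where "z t = x + t *\<^sub>R (y - x)" for t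
  \<comment> \<open>x and y are null and not orthogonal to \<xi>, so \<open>n 0\<close> and
    \<open>n 1\<close> are nonzero multiples of x and y: the curve n joins their lines inside the
    null cone.\<close>
  define n where "n t = g (z t) (z t) *\<^sub>R \<xi> - (2 * g \<xi> (z t)) *\<^sub>R z t" for t
  have z: "z t \<in> T" "z 0 = x" "z 1 = y" for t using x y by (auto simp: z_def T_closed)
  have nT: "n t \<in> T" for t using z \<xi> by (simp add: n_def T_closed)
  have "g (n t) (n t) = 0" for t
    using \<xi> z(1)[of t] g_commute[OF z(1) \<xi>(1)]
    by (simp add: n_def bilinear_simps[OF bil_g] algebra_simps)
  then have prod: "b (n t) (n t) * c (n t) (n t) = 0" for t using null nT by blast
  have bn: "B (n t) (n t) = g (z t) (z t) * g (z t) (z t) * B \<xi> \<xi>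
      - 4 * g (z t) (z t) * g \<xi> (z t) * B \<xi> (z t) + 4 * g \<xi> (z t) * g \<xi> (z t) * B (z t) (z t)"
    if "sym_form_on T B" for B t
    using sym_form_on_commute[OF that z(1) \<xi>(1)]
    by (simp add: n_def bilinear_simps[OF sym_form_on_bilinear[OF that]] algebra_simps)
  have lin: "polynomial_map (\<lambda>t. B \<xi> (z t))" if "sym_form_on T B" for B
    unfolding z_def bilinear_radd[OF sym_form_on_bilinear[OF that]] bilinear_rmul[OF sym_form_on_bilinear[OF that]]
      real_scaleR_def
    by (intro polynomial_map_intros)
  have quad: "polynomial_map (\<lambda>t. B (z t) (z t))" if "sym_form_on T B" for B
    unfolding z_def by (rule polynomial_map_line[OF that subspace_T]) (use x y in \<open>simp_all add: T_closed\<close>)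
  have pm: "polynomial_map (\<lambda>t. B (n t) (n t))" if "sym_form_on T B" for B
  proof -
    have "polynomial_map (\<lambda>t. p t * p t * k - 4 * p t * q t * r t + 4 * q t * q t * s t)"
      if "polynomial_map p" "polynomial_map q" "polynomial_map r" "polynomial_map s" for p q r s k
      by (intro polynomial_map_intros that)
    from this[OF quad[OF sym_g] lin[OF sym_g] lin[OF that] quad[OF that]]
    show ?thesis unfolding bn[OF that] .
  qed
  have "b (n 0) (n 0) \<noteq> 0" "c (n 1) (n 1) \<noteq> 0"
    using bn[OF b(1), of 0] bn[OF b(2), of 1] x y \<xi> by (simp_all add: z)
  then show False using polynomial_map_mult_eq_0[OF pm[OF b(1)] pm[OF b(2)] prod] by blast
qed

end

section \<open>Pointwise algebra of the bending limit and of the Codazzi and Gauss equations\<close>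

context indefinite_scalar_product
begin

lemma tendsto_bilinear_line:
  fixes b :: "'a \<Rightarrow> 'a \<Rightarrow> real"
  assumes "bilinear b"
  shows "((\<lambda>t. b (x + t *\<^sub>R w) (x + t *\<^sub>R w)) \<longlongrightarrow> b x x) (at 0)"
proof -
  have "((\<lambda>t. b x x + t * b x w + t * b w x + t * t * b w w) \<longlongrightarrow>
      b x x + 0 * b x w + 0 * b w x + 0 * 0 * b w w) (at 0)"
    by (intro tendsto_intros)
  then show ?thesis by (simp add: bilinear_simps[OF assms] algebra_simps)
qed

text \<open>The limit is evaluated along lines \<xi> + t w, with one w that is nonisotropic for both
  metrics. If h(\<xi>,\<xi>) is nonzero, the three forms are nonzero polynomials in t on such a
  line, so the line stays in the domain of the limit for small nonzero t.\<close>

lemma bending_limit: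
  assumes h: "sym_form_on T h" and g': "sym_form_on T g'" and h': "sym_form_on T h'"
    and nprop: "\<not> proportional_on T h g" and nz: "\<exists>x\<in>T. g' x x \<noteq> 0"
    and lim: "\<And>\<xi>. \<xi> \<in> T \<Longrightarrow> \<xi> \<noteq> 0 \<Longrightarrow> g \<xi> \<xi> = 0 \<Longrightarrow>
      ((\<lambda>x. (h' x x / g' x x) / (h x x / g x x)) \<longlongrightarrow> 1)
        (at \<xi> within {x \<in> T. g x x \<noteq> 0 \<and> g' x x \<noteq> 0 \<and> h x x / g x x \<noteq> 0})"
  obtains \<sigma> \<rho> where "\<sigma> \<noteq> 0" "\<And>x y. x \<in> T \<Longrightarrow> y \<in> T \<Longrightarrow> g' x y = \<sigma> * g x y"
    "\<And>x y. x \<in> T \<Longrightarrow> y \<in> T \<Longrightarrow> h' x y = \<sigma> * h x y + \<rho> * g x y"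
proof -
  note main = that
  obtain w1 where w1: "w1 \<in> T" "g' w1 w1 \<noteq> 0" using nz by blast
  obtain w2 where w2: "w2 \<in> T" "g w2 w2 > 0" using pos by blast
  \<comment> \<open>On the line from w1 to w2 neither g' nor g vanishes identically; being
    polynomial in t, they have a common point of nonvanishing.\<close>
  obtain w where w: "w \<in> T" "g w w \<noteq> 0" "g' w w \<noteq> 0"
  proof -
    define z where "z t = w1 + t *\<^sub>R (w2 - w1)" for t
    have zT: "z t \<in> T" for t using w1 w2 by (simp add: z_def T_closed)
    have "polynomial_map (\<lambda>t. g' (z t) (z t))" "polynomial_map (\<lambda>t. g (z t) (z t))"
      unfolding z_def
      by (rule polynomial_map_line[OF _ subspace_T]; use w1 w2 g' sym_g in \<open>simp add: T_closed\<close>)+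
    moreover have "z 0 = w1" "z 1 = w2" by (simp_all add: z_def)
    ultimately have "\<exists>t. g' (z t) (z t) * g (z t) (z t) \<noteq> 0"
      using polynomial_map_mult_eq_0[of "\<lambda>t. g' (z t) (z t)" "\<lambda>t. g (z t) (z t)" 0 1] w1 w2 by auto
    then show thesis using that zT by auto
  qed
  have lim': "((\<lambda>t. (h' (\<xi> + t *\<^sub>R w) (\<xi> + t *\<^sub>R w) * g (\<xi> + t *\<^sub>R w) (\<xi> + t *\<^sub>R w)) /
       (g' (\<xi> + t *\<^sub>R w) (\<xi> + t *\<^sub>R w) * h (\<xi> + t *\<^sub>R w) (\<xi> + t *\<^sub>R w))) \<longlongrightarrow> 1) (at 0)"
    and ev: "eventually (\<lambda>t. g (\<xi> + t *\<^sub>R w) (\<xi> + t *\<^sub>R w) \<noteq> 0) (at 0)"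
    if \<xi>: "\<xi> \<in> T" "g \<xi> \<xi> = 0" "h \<xi> \<xi> \<noteq> 0" for \<xi>
  proof -
    have "\<xi> \<noteq> 0" using \<xi>(3) bilinear_lzero[OF sym_form_on_bilinear[OF h]] by auto
    have line: "polynomial_map (\<lambda>t. b (\<xi> + t *\<^sub>R w) (\<xi> + t *\<^sub>R w))" if "sym_form_on T b" for b
      by (rule polynomial_map_line[OF that subspace_T \<xi>(1) w(1)])
    have nonzero: "eventually (\<lambda>t. b (\<xi> + t *\<^sub>R w) (\<xi> + t *\<^sub>R w) \<noteq> 0) (at 0)"
      if b: "sym_form_on T b" "b w w \<noteq> 0 \<or> b \<xi> \<xi> \<noteq> 0" for b
    proof -
      have "\<exists>t. b (\<xi> + t *\<^sub>R w) (\<xi> + t *\<^sub>R w) \<noteq> 0"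
      proof (rule ccontr)
        assume "\<not> ?thesis"
        then have z: "b \<xi> \<xi> + 2 * b \<xi> w * t + b w w * t\<^sup>2 = 0" for t
          using sym_form_on_line[OF b(1) subspace_T \<xi>(1) w(1), of t] by simp
        \<comment> \<open>The values at 0, 1 and -1 show that the constant and the leading
          coefficient vanish.\<close>
        show False using z[of 0] z[of 1] z[of "-1"] b(2) by simp
      qed
      then show ?thesis using polynomial_map_eventually_nonzero[OF line[OF b(1)]] by blast
    qed
    show ev: "eventually (\<lambda>t. g (\<xi> + t *\<^sub>R w) (\<xi> + t *\<^sub>R w) \<noteq> 0) (at 0)"
      by (rule nonzero[OF sym_g]) (use w in simp)
    have evs: "eventually (\<lambda>t. \<xi> + t *\<^sub>R w \<in> {x \<in> T. g x x \<noteq> 0 \<and> g' x x \<noteq> 0 \<and> h x x / g x x \<noteq> 0}) (at 0)"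
      using ev nonzero[OF g' disjI1[OF w(3)]] nonzero[OF h disjI2[OF \<xi>(3)]]
      by eventually_elim (use \<xi> w in \<open>simp add: T_closed\<close>)
    have "w \<noteq> 0" using w bilinear_lzero[OF bil_g] by auto
    then have "eventually (\<lambda>t. \<xi> + t *\<^sub>R w \<noteq> \<xi>) (at 0)"
      using eventually_neq_at_within[of "0::real" 0 UNIV] by simp
    moreover have "((\<lambda>t. \<xi> + t *\<^sub>R w) \<longlongrightarrow> \<xi>) (at 0)"
      by (rule tendsto_eq_intros refl)+ simp
    ultimately have "filterlim (\<lambda>t. \<xi> + t *\<^sub>R w)
        (at \<xi> within {x \<in> T. g x x \<noteq> 0 \<and> g' x x \<noteq> 0 \<and> h x x / g x x \<noteq> 0}) (at 0)"
      unfolding filterlim_at using evs by (auto elim: eventually_elim2)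
    from filterlim_compose[OF lim[OF \<xi>(1) \<open>\<xi> \<noteq> 0\<close> \<xi>(2)] this]
    show "((\<lambda>t. (h' (\<xi> + t *\<^sub>R w) (\<xi> + t *\<^sub>R w) * g (\<xi> + t *\<^sub>R w) (\<xi> + t *\<^sub>R w)) /
       (g' (\<xi> + t *\<^sub>R w) (\<xi> + t *\<^sub>R w) * h (\<xi> + t *\<^sub>R w) (\<xi> + t *\<^sub>R w))) \<longlongrightarrow> 1) (at 0)"
      by simp
  qed
  have "g' \<xi> \<xi> * h \<xi> \<xi> = 0" if \<xi>: "\<xi> \<in> T" "g \<xi> \<xi> = 0" for \<xi>
  proof (rule ccontr)
    assume n: "g' \<xi> \<xi> * h \<xi> \<xi> \<noteq> 0"
    \<comment> \<open>Here the denominator is nonzero in the limit while g(\<xi>,\<xi>) kills the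
      numerator, so the limit would be 0.\<close>
    have "((\<lambda>t. (h' (\<xi> + t *\<^sub>R w) (\<xi> + t *\<^sub>R w) * g (\<xi> + t *\<^sub>R w) (\<xi> + t *\<^sub>R w)) /
       (g' (\<xi> + t *\<^sub>R w) (\<xi> + t *\<^sub>R w) * h (\<xi> + t *\<^sub>R w) (\<xi> + t *\<^sub>R w))) \<longlongrightarrow>
       (h' \<xi> \<xi> * g \<xi> \<xi>) / (g' \<xi> \<xi> * h \<xi> \<xi>)) (at 0)"
      by (intro tendsto_divide tendsto_mult tendsto_bilinear_line n
          sym_form_on_bilinear[OF h] sym_form_on_bilinear[OF h'] sym_form_on_bilinear[OF g'] bil_g)
    moreover have "h \<xi> \<xi> \<noteq> 0" using n by simp
    ultimately have "(h' \<xi> \<xi> * g \<xi> \<xi>) / (g' \<xi> \<xi> * h \<xi> \<xi>) = 1"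
      by (rule LIM_unique[OF _ lim'[OF \<xi>]])
    then show False using \<xi> by simp
  qed
  then have "proportional_on T g' g"
    using null_cone_irreducible[OF g' h] nprop by blast
  then obtain \<sigma> where \<sigma>: "\<And>x y. x \<in> T \<Longrightarrow> y \<in> T \<Longrightarrow> g' x y = \<sigma> * g x y"
    unfolding proportional_on_def by blast
  have "\<sigma> \<noteq> 0" using \<sigma>[OF w1(1) w1(1)] w1(2) by auto
  define k where "k x y = 1 * h' x y + (- \<sigma>) * h x y" for x y
  have k: "sym_form_on T k"
    unfolding k_def by (rule sym_form_on_combination[OF h' h])
  \<comment> \<open>After cancelling g, the quotient tends to h'(\<xi>,\<xi>) / (\<sigma>
    h(\<xi>,\<xi>)); equating this with 1 annihilates k at null vectors where h does not
    vanish.\<close>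
  have "k \<xi> \<xi> * h \<xi> \<xi> = 0" if \<xi>: "\<xi> \<in> T" "g \<xi> \<xi> = 0" for \<xi>
  proof (cases "h \<xi> \<xi> = 0")
    case False
    have "((\<lambda>t. h' (\<xi> + t *\<^sub>R w) (\<xi> + t *\<^sub>R w) / (\<sigma> * h (\<xi> + t *\<^sub>R w) (\<xi> + t *\<^sub>R w))) \<longlongrightarrow> 1) (at 0)"
    proof (rule Lim_transform_eventually[OF lim'[OF \<xi> False]])
      show "eventually (\<lambda>t. (h' (\<xi> + t *\<^sub>R w) (\<xi> + t *\<^sub>R w) * g (\<xi> + t *\<^sub>R w) (\<xi> + t *\<^sub>R w)) /
        (g' (\<xi> + t *\<^sub>R w) (\<xi> + t *\<^sub>R w) * h (\<xi> + t *\<^sub>R w) (\<xi> + t *\<^sub>R w)) =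
        h' (\<xi> + t *\<^sub>R w) (\<xi> + t *\<^sub>R w) / (\<sigma> * h (\<xi> + t *\<^sub>R w) (\<xi> + t *\<^sub>R w))) (at 0)"
        using ev[OF \<xi> False] by eventually_elim (use \<xi> w in \<open>simp add: \<sigma> T_closed\<close>)
    qed
    moreover have "((\<lambda>t. h' (\<xi> + t *\<^sub>R w) (\<xi> + t *\<^sub>R w) / (\<sigma> * h (\<xi> + t *\<^sub>R w) (\<xi> + t *\<^sub>R w))) \<longlongrightarrow>
        h' \<xi> \<xi> / (\<sigma> * h \<xi> \<xi>)) (at 0)"
      using False \<open>\<sigma> \<noteq> 0\<close>
      by (intro tendsto_divide tendsto_mult tendsto_const tendsto_bilinear_line
          sym_form_on_bilinear[OF h] sym_form_on_bilinear[OF h']) simp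
    ultimately have "h' \<xi> \<xi> / (\<sigma> * h \<xi> \<xi>) = 1" by (rule LIM_unique[rotated])
    then show ?thesis using False \<open>\<sigma> \<noteq> 0\<close> by (simp add: k_def field_simps)
  qed simp
  then have "proportional_on T k g"
    using null_cone_irreducible[OF k h] nprop by blast
  then obtain \<rho> where \<rho>: "\<And>x y. x \<in> T \<Longrightarrow> y \<in> T \<Longrightarrow> k x y = \<rho> * g x y"
    unfolding proportional_on_def by blast
  show thesis
  proof (rule main[OF \<open>\<sigma> \<noteq> 0\<close> \<sigma>])
    show "h' x y = \<sigma> * h x y + \<rho> * g x y" if "x \<in> T" "y \<in> T" for x y
      using \<rho>[OF that] by (simp add: k_def)
  qed
qed

text \<open>For two independent vectors in the kernel of a, the equation is a relation between their
  products with g, so nondegeneracy makes \<theta> vanish there. Then h - c g with c = \<theta>(w) /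
  a(w) is annihilated by the kernel of a, hence a multiple of the square of a.\<close>

lemma codazzi_imp_quasi_umbilic:
  assumes h: "sym_form_on T h" and a: "linear a"
    and eq: "\<And>u v w. u \<in> T \<Longrightarrow> v \<in> T \<Longrightarrow> w \<in> T \<Longrightarrow>
      a w * h u v - a u * h w v = \<theta> w * g u v - \<theta> u * g w v"
    and nz: "w \<in> T" "a w \<noteq> 0"
  shows "quasi_umbilic_form T g h"
proof -
  \<comment> \<open>\<theta> is not assumed linear, so nothing is claimed about its value at
    0.\<close>
  have \<theta>: "\<theta> u = 0" if u: "u \<in> T" "a u = 0" "u \<noteq> 0" for u
  proof (rule ccontr)
    assume n: "\<theta> u \<noteq> 0"
    obtain x where x: "x \<in> T" "x \<noteq> 0" "a x = 0" "u \<bullet> x = 0"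
      using subspace_common_kernel[OF subspace_T dim_T a, of "(\<bullet>) u"]
      by (auto simp: bounded_linear.linear[OF bounded_linear_inner_right])
    have "g (\<theta> u *\<^sub>R x - \<theta> x *\<^sub>R u) v = 0" if "v \<in> T" for v
      using eq[OF u(1) that x(1)] u x by (simp add: bilinear_simps[OF bil_g])
    then have "\<theta> u *\<^sub>R x - \<theta> x *\<^sub>R u = 0"
      by (intro nondegenerate) (use u x in \<open>simp_all add: T_closed\<close>)
    then have "(\<theta> u *\<^sub>R x - \<theta> x *\<^sub>R u) \<bullet> x = 0" by (simp only: inner_zero_left)
    then show False using x(2,4) n by (simp add: inner_diff_left)
  qed
  define c where "c = \<theta> w / a w"
  define k where "k x y = 1 * h x y + (- c) * g x y" for x y
  have k: "sym_form_on T k"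
    unfolding k_def by (rule sym_form_on_combination[OF h sym_g])
  have ker: "k u v = 0" if "u \<in> T" "v \<in> T" "a u = 0" for u v
  proof (cases "u = 0")
    case False
    then have "a w * h u v = \<theta> w * g u v"
      using eq[OF that(1,2) nz(1)] \<theta>[OF that(1,3)] that(3) by simp
    then show ?thesis using nz by (simp add: k_def c_def field_simps)
  qed (simp add: bilinear_simps[OF sym_form_on_bilinear[OF k]])
  have red: "k u v = a u / a w * k w v" if "u \<in> T" "v \<in> T" for u v
  proof -
    have "k (u - (a u / a w) *\<^sub>R w) v = 0"
      using that nz by (intro ker) (simp_all add: T_closed linear_diff[OF a] linear_cmul[OF a])
    then show ?thesis by (simp add: bilinear_simps[OF sym_form_on_bilinear[OF k]])
  qed
  have "h u v = c * g u v + k w w / (a w * a w) * a u * a v" if "u \<in> T" "v \<in> T" for u v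
  proof -
    have "k u v = a u / a w * (a v / a w * k w w)"
      using red[OF that] red[OF that(2) nz(1)] sym_form_on_commute[OF k that(2) nz(1)] by simp
    then show ?thesis by (simp add: k_def mult_ac)
  qed
  then show ?thesis using a unfolding quasi_umbilic_form_def by blast
qed

text \<open>If k(x,x) is nonzero, the equation with x in two slots writes k as the square of the
  form k(x,-) divided by k(x,x); otherwise polarization gives k = 0.\<close>

lemma curvature_rank_one:
  assumes k: "sym_form_on T k"
    and eq: "\<And>x y z u. x \<in> T \<Longrightarrow> y \<in> T \<Longrightarrow> z \<in> T \<Longrightarrow> u \<in> T \<Longrightarrow> k x u * k y z = k x z * k y u"
  shows "quasi_umbilic_form T g k"
proof (cases "\<exists>x\<in>T. k x x \<noteq> 0")
  case True
  then obtain x where x: "x \<in> T" "k x x \<noteq> 0" by blast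
  have "k v w = 0 * g v w + (1 / k x x) * k x v * k x w" if "v \<in> T" "w \<in> T" for v w
    using eq[of x v w x] x that sym_form_on_commute[OF k, of v x] by (simp add: field_simps)
  moreover have "linear (k x)" using sym_form_on_bilinear[OF k] by (simp add: bilinear_def)
  ultimately show ?thesis unfolding quasi_umbilic_form_def by blast
next
  case False
  have "k v w = 0 * g v w" if "v \<in> T" "w \<in> T" for v w
    using polarization[OF k subspace_T that] False that by (simp add: T_closed)
  then show ?thesis
    by (intro proportional_on_imp_quasi_umbilic) (auto simp: proportional_on_def)
qed

text \<open>Nondegeneracy of g makes the radical of k trivial. For null x and y orthogonal to x, the
  equation with z = x has right side zero, so a nonzero k(x,x) would put a nontrivial combination of
  x and y into that radical.\<close>

lemma curvature_constant:
  assumes k: "sym_form_on T k" and r: "r \<noteq> 0"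
    and eq: "\<And>x y z u. x \<in> T \<Longrightarrow> y \<in> T \<Longrightarrow> z \<in> T \<Longrightarrow> u \<in> T \<Longrightarrow>
      k x u * k y z - k x z * k y u = r * (g x u * g y z - g x z * g y u)"
  shows "proportional_on T k g"
proof -
  have radical: "y = 0" if y: "y \<in> T" "\<And>u. u \<in> T \<Longrightarrow> k y u = 0" for y
  proof (rule ccontr)
    assume "y \<noteq> 0"
    then obtain z where z: "z \<in> T" "g y z \<noteq> 0" using nondegenerate y(1) by blast
    obtain x where x: "x \<in> T" "x \<noteq> 0" "g z x = 0"
      using subspace_common_kernel[OF subspace_T dim_T linear_g[of z] linear_g[of z]] by blast
    have "g x u = 0" if "u \<in> T" for u
      using eq[OF x(1) y(1) z(1) that] y z x r that g_commute[of x z] by simp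
    then show False using nondegenerate[OF x(1)] x(2) by blast
  qed
  have "k x x = 0" if x: "x \<in> T" "g x x = 0" for x
  proof (rule ccontr)
    assume n: "k x x \<noteq> 0"
    then have "x \<noteq> 0" using bilinear_lzero[OF sym_form_on_bilinear[OF k]] by auto
    obtain y where y: "y \<in> T" "y \<noteq> 0" "g x y = 0" "x \<bullet> y = 0"
      using subspace_common_kernel[OF subspace_T dim_T linear_g[of x], of "(\<bullet>) x"]
      by (auto simp: bounded_linear.linear[OF bounded_linear_inner_right])
    define w where "w = y - (k y x / k x x) *\<^sub>R x"
    have w: "w \<in> T" using x y by (simp add: w_def T_closed)
    have "k w u = 0" if "u \<in> T" for u
      using eq[OF x(1) y(1) x(1) that] x y n g_commute[of y x]
      by (simp add: w_def bilinear_simps[OF sym_form_on_bilinear[OF k]] field_simps)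
    then have "w = 0" using radical w by blast
    then have "w \<bullet> y = 0" by (simp only: inner_zero_left)
    then show False using y by (simp add: w_def inner_diff_left)
  qed
  then show ?thesis by (rule null_cone_imp_proportional[OF k])
qed

text \<open>The left side is, up to sign, the Kulkarni-Nomizu product of k and g. For null x with
  k(x,x) nonzero it makes every y orthogonal to x orthogonal to the whole complement of x, hence a
  multiple of x, which dimension three excludes.\<close>

lemma mixed_curvature_zero:
  assumes k: "sym_form_on T k"
    and eq: "\<And>x y z u. x \<in> T \<Longrightarrow> y \<in> T \<Longrightarrow> z \<in> T \<Longrightarrow> u \<in> T \<Longrightarrow>
      k x u * g y z + g x u * k y z - k x z * g y u - g x z * k y u = 0"
  shows "proportional_on T k g"
proof (rule null_cone_imp_proportional[OF k])
  fix x assume x: "x \<in> T" "g x x = 0"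
  show "k x x = 0"
  proof (rule ccontr)
    assume n: "k x x \<noteq> 0"
    then have "x \<noteq> 0" using bilinear_lzero[OF sym_form_on_bilinear[OF k]] by auto
    then obtain z where z: "z \<in> T" "g x z \<noteq> 0" using nondegenerate x(1) by blast
    obtain y where y: "y \<in> T" "y \<noteq> 0" "g x y = 0" "x \<bullet> y = 0"
      using subspace_common_kernel[OF subspace_T dim_T linear_g[of x], of "(\<bullet>) x"]
      by (auto simp: bounded_linear.linear[OF bounded_linear_inner_right])
    have perp: "g y v = 0" if "v \<in> T" "g x v = 0" for v
      using eq[OF x(1) y(1) that(1) x(1)] n x y that g_commute[of y x] by simp
    have "g (y - (g y z / g x z) *\<^sub>R x) v = 0" if v: "v \<in> T" for v
    proof -
      \<comment> \<open>Since g(x,z) is nonzero, subtracting a multiple of z moves v into the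
        orthogonal complement of x.\<close>
      have "g y (v - (g x v / g x z) *\<^sub>R z) = 0"
        using v z by (intro perp) (simp_all add: T_closed bilinear_simps[OF bil_g])
      then show ?thesis by (simp add: bilinear_simps[OF bil_g])
    qed
    then have "y - (g y z / g x z) *\<^sub>R x = 0"
      by (intro nondegenerate) (use x y in \<open>simp_all add: T_closed\<close>)
    then have "(y - (g y z / g x z) *\<^sub>R x) \<bullet> y = 0" by (simp only: inner_zero_left)
    then show False using y by (simp add: inner_diff_left)
  qed
qed

lemma gauss_imp_isometric:
  assumes h: "sym_form_on T h" and nqu: "\<not> quasi_umbilic_form T g h" and "c \<noteq> 0"
    and h': "\<And>x y. x \<in> T \<Longrightarrow> y \<in> T \<Longrightarrow> h' x y = c * h x y + \<rho> * g x y"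
    and eq: "\<And>x y z u. x \<in> T \<Longrightarrow> y \<in> T \<Longrightarrow> z \<in> T \<Longrightarrow> u \<in> T \<Longrightarrow>
      h' x u * h' y z - h' x z * h' y u = c * (h x u * h y z - h x z * h y u)"
  shows "c = 1 \<and> \<rho> = 0"
proof -
  have nprop: "\<not> proportional_on T k g"
    if k: "\<And>x y. k x y = 1 * h x y + s * g x y" for k s
  proof
    assume "proportional_on T k g"
    then obtain r where r: "\<forall>x\<in>T. \<forall>y\<in>T. k x y = r * g x y" unfolding proportional_on_def by blast
    have "\<forall>x\<in>T. \<forall>y\<in>T. h x y = (r - s) * g x y"
      using r k by (simp add: algebra_simps)
    then have "proportional_on T h g" unfolding proportional_on_def by blast
    then show False using nqu proportional_on_imp_quasi_umbilic by blast
  qed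
  have c1: "c = 1"
  proof (rule ccontr)
    assume "c \<noteq> 1"
    \<comment> \<open>The shift that completes the square: written in k = h + s g, the equation for
      h' = c h + \<rho> g has no mixed terms.\<close>
    define s where "s = \<rho> / (c - 1)"
    define k where "k x y = 1 * h x y + s * g x y" for x y
    have k: "sym_form_on T k" unfolding k_def by (rule sym_form_on_combination[OF h sym_g])
    have \<rho>: "\<rho> = s * (c - 1)" using \<open>c \<noteq> 1\<close> by (simp add: s_def)
    have keq: "k x u * k y z - k x z * k y u = s\<^sup>2 / c * (g x u * g y z - g x z * g y u)"
      if "x \<in> T" "y \<in> T" "z \<in> T" "u \<in> T" for x y z u
    proof -
      have "c * (c - 1) * (k x u * k y z - k x z * k y u) - (c - 1) * s\<^sup>2 * (g x u * g y z - g x z * g y u)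
         = h' x u * h' y z - h' x z * h' y u - c * (h x u * h y z - h x z * h y u)"
        using that by (simp add: k_def h' \<rho> power2_eq_square algebra_simps)
      also have "\<dots> = 0" using eq[OF that] by simp
      finally have "(c - 1) * (c * (k x u * k y z - k x z * k y u) - s\<^sup>2 * (g x u * g y z - g x z * g y u)) = 0"
        by (simp add: algebra_simps)
      then have "c * (k x u * k y z - k x z * k y u) = s\<^sup>2 * (g x u * g y z - g x z * g y u)"
        using \<open>c \<noteq> 1\<close> by simp
      then show ?thesis using \<open>c \<noteq> 0\<close> by (simp add: field_simps)
    qed
    show False
    proof (cases "s = 0")
      case True
      then have keq0: "k x u * k y z = k x z * k y u" if "x \<in> T" "y \<in> T" "z \<in> T" "u \<in> T" for x y z u
        using keq[OF that] by simp
      have "quasi_umbilic_form T g k" by (rule curvature_rank_one[OF k keq0])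
      moreover have "k = h" by (intro ext) (simp add: k_def True)
      ultimately show False using nqu by simp
    next
      case False
      then have "proportional_on T k g"
        using curvature_constant[OF k _ keq] \<open>c \<noteq> 0\<close> by simp
      then show False using nprop[of k s] k_def by blast
    qed
  qed
  have "\<rho> = 0"
  proof (rule ccontr)
    assume "\<rho> \<noteq> 0"
    \<comment> \<open>With c = 1 the terms quadratic in h cancel; half of \<rho> is the shift that
      absorbs the term quadratic in g into the mixed product of k and g.\<close>
    define k where "k x y = 1 * h x y + \<rho> / 2 * g x y" for x y
    have k: "sym_form_on T k" unfolding k_def by (rule sym_form_on_combination[OF h sym_g])
    have "k x u * g y z + g x u * k y z - k x z * g y u - g x z * k y u = 0"
      if "x \<in> T" "y \<in> T" "z \<in> T" "u \<in> T" for x y z u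
    proof -
      have "\<rho> * (k x u * g y z + g x u * k y z - k x z * g y u - g x z * k y u) =
          h' x u * h' y z - h' x z * h' y u - c * (h x u * h y z - h x z * h y u)"
        using that by (simp add: k_def h' c1 algebra_simps)
      then show ?thesis using eq[OF that] \<open>\<rho> \<noteq> 0\<close> by simp
    qed
    then have "proportional_on T k g" by (rule mixed_curvature_zero[OF k])
    then show False using nprop[of k "\<rho> / 2"] k_def by blast
  qed
  with c1 show ?thesis by simp
qed

end

section \<open>Parametrised hypersurfaces\<close>

lemma bilinear_pdot: "bilinear (pdot N)"
  unfolding bilinear_def linear_iff pdot_def
  by (simp add: sum.distrib sum_distrib_left algebra_simps)

lemmas bounded_bilinear_pdot = bilinear_conv_bounded_bilinear[THEN iffD1, OF bilinear_pdot]
lemmas pdot_simps = bilinear_simps[OF bilinear_pdot]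

lemma pdot_commute: "pdot N v w = pdot N w v"
  by (simp add: pdot_def mult_ac)

lemma pdot_nondegenerate:
  assumes "\<And>w. pdot N v w = 0"
  shows "v = 0"
proof (rule vec_eq_iff[THEN iffD2], rule allI)
  fix i
  have "pdot N v (axis i 1) = (\<Sum>j\<in>UNIV. if j = i then (if i \<in> N then - 1 else 1) * v $ i else 0)"
    unfolding pdot_def by (intro sum.cong) (auto simp: axis_def)
  then show "v $ i = 0 $ i" using assms[of "axis i 1"] by (simp split: if_splits)
qed

lemma Cinf_on_pdot: "Cinf_on a W \<Longrightarrow> Cinf_on b W \<Longrightarrow> Cinf_on (\<lambda>y. pdot N (a y) (b y)) W"
  unfolding Cinf_on_def using Ck_on_bilinear[OF bounded_bilinear_pdot] by blast

lemma dird_pdot: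
  assumes "Cinf_on a W" "Cinf_on b W" "y \<in> W"
  shows "dird (\<lambda>y. pdot N (a y) (b y)) u y = pdot N (dird a u y) (b y) + pdot N (a y) (dird b u y)"
  using dirdI[OF bounded_bilinear.FDERIV[OF bounded_bilinear_pdot
      Cinf_on_has_derivative[OF assms(1,3)] Cinf_on_has_derivative[OF assms(2,3)]]]
  by (simp add: add.commute)

text \<open>Only differentiability is asked for, since \<sigma> and \<rho> enter
  \<open>conformal_pair\<close> merely as differentiable functions.\<close>

lemma dird_mult:
  fixes a b :: "'a::euclidean_space \<Rightarrow> real"
  assumes "a differentiable (at y)" "b differentiable (at y)"
  shows "dird (\<lambda>y. a y * b y) u y = dird a u y * b y + a y * dird b u y"
  using dirdI[OF has_derivative_mult[OF differentiable_imp_dird[OF assms(1)] differentiable_imp_dird[OF assms(2)]]]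
  by (simp add: add.commute)

lemma dird_add:
  assumes "a differentiable (at y)" "b differentiable (at y)"
  shows "dird (\<lambda>y. a y + b y) u y = dird a u y + dird b u y"
  by (rule dirdI[OF has_derivative_add[OF differentiable_imp_dird[OF assms(1)] differentiable_imp_dird[OF assms(2)]]])

definition first_form where
  "first_form N X y u v = pdot N (dird X u y) (dird X v y)"

definition second_form where
  "second_form N \<epsilon> X n y u v = - \<epsilon> * pdot N (dird n u y) (dird X v y)"

text \<open>The parameters range over an open subset of the ambient space, the \<open>k\<close>-th of them being
  redundant, so that all derivatives are taken on open sets.\<close>

locale patch =
  fixes N :: "'m::finite set" and \<epsilon> :: real and X n :: "real ^ 'm \<Rightarrow> real ^ 'm"
    and W :: "(real ^ 'm) set" and k :: 'm
  assumes smooth_X: "Cinf_on X W" and smooth_n: "Cinf_on n W"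
    and eps: "\<epsilon> = 1 \<or> \<epsilon> = - 1"
    and n_unit: "y \<in> W \<Longrightarrow> pdot N (n y) (n y) = \<epsilon>"
    and n_normal: "y \<in> W \<Longrightarrow> pdot N (n y) (dird X u y) = 0"
    and dird_k: "y \<in> W \<Longrightarrow> dird X (axis k 1) y = 0"
    and immersion: "y \<in> W \<Longrightarrow> u $ k = 0 \<Longrightarrow> dird X u y = 0 \<Longrightarrow> u = 0"
begin

abbreviation "I \<equiv> first_form N X"
abbreviation "II \<equiv> second_form N \<epsilon> X n"

lemma open_W: "open W"
  using smooth_X by (rule Cinf_on_open)

lemma eps_sq [simp]: "\<epsilon> * \<epsilon> = 1" "\<epsilon> * (\<epsilon> * c) = c" "\<epsilon> \<noteq> 0"
  using eps by auto

lemmas smooth_dX = Cinf_on_dird[OF smooth_X]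
lemmas linear_X = dird_linear[OF smooth_X]
lemmas linear_n = dird_linear[OF smooth_n]

lemma dird_X_simps:
  assumes "y \<in> W"
  shows "dird X (u + v) y = dird X u y + dird X v y" "dird X (u - v) y = dird X u y - dird X v y"
    "dird X (c *\<^sub>R u) y = c *\<^sub>R dird X u y"
  using linear_add[OF linear_X[OF assms]] linear_diff[OF linear_X[OF assms]]
    linear_cmul[OF linear_X[OF assms]] by auto

lemma n_dn: "y \<in> W \<Longrightarrow> pdot N (n y) (dird n u y) = 0"
proof -
  assume y: "y \<in> W"
  have "dird (\<lambda>y. pdot N (n y) (n y)) u y = dird (\<lambda>y. \<epsilon>) u y"
    using Cinf_on_differentiable[OF Cinf_on_pdot[OF smooth_n smooth_n] y]
    by (intro dird_cong[OF open_W y]) (simp_all add: n_unit)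
  then show ?thesis
    using dird_pdot[OF smooth_n smooth_n y, where N = N] pdot_commute[of N "dird n u y"] by simp
qed

text \<open>Differentiating <n, X_v> = 0 moves the derivative from n to X. In this form the symmetry
  of the second form is that of second derivatives.\<close>

lemma second_form_eq:
  assumes y: "y \<in> W"
  shows "II y u v = \<epsilon> * pdot N (n y) (dird (dird X v) u y)"
proof -
  have "dird (\<lambda>y. pdot N (n y) (dird X v y)) u y = dird (\<lambda>y. 0) u y"
    using Cinf_on_differentiable[OF Cinf_on_pdot[OF smooth_n smooth_dX] y]
    by (intro dird_cong[OF open_W y]) (simp_all add: n_normal)
  then have "pdot N (dird n u y) (dird X v y) = - pdot N (n y) (dird (dird X v) u y)"
    using dird_pdot[OF smooth_n smooth_dX y, where N = N] by simp
  then show ?thesis by (simp add: second_form_def)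
qed

lemma second_form_commute: "y \<in> W \<Longrightarrow> II y u v = II y v u"
  using dird_commute[OF smooth_X, of y u v] by (simp add: second_form_eq)

lemma first_form_commute: "I y u v = I y v u"
  by (simp add: first_form_def pdot_commute)

lemma bilinear_forms:
  assumes "y \<in> W"
  shows "bilinear (I y)" "bilinear (II y)"
  unfolding bilinear_def linear_iff first_form_def second_form_def
  using linear_add[OF linear_X[OF assms]] linear_cmul[OF linear_X[OF assms]]
    linear_add[OF linear_n[OF assms]] linear_cmul[OF linear_n[OF assms]]
  by (simp_all add: pdot_simps algebra_simps)

text \<open>The redundant k-th direction is given to the normal, so that on W the frame is a linear
  automorphism of the ambient space.\<close>

definition "frame y e = dird X e y + e $ k *\<^sub>R n y"

lemma linear_frame:
  assumes "y \<in> W"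
  shows "linear (frame y)"
  unfolding frame_def linear_iff using dird_X_simps[OF assms] by (simp add: algebra_simps)

lemma inj_frame:
  assumes y: "y \<in> W"
  shows "inj (frame y)"
proof (rule linear_injective_0[THEN iffD2, OF linear_frame[OF y]], intro allI impI)
  fix e assume e: "frame y e = 0"
  then have "pdot N (n y) (frame y e) = 0" by (simp add: pdot_simps)
  then have "e $ k = 0" using y by (simp add: frame_def pdot_simps n_normal n_unit)
  then show "e = 0" using immersion[OF y, of e] e by (simp add: frame_def)
qed

lemma surj_frame: "y \<in> W \<Longrightarrow> surj (frame y)"
  by (rule linear_injective_imp_surjective[OF linear_frame inj_frame]) auto

lemma decompose:
  assumes y: "y \<in> W"
  obtains e where "Z = dird X e y + (\<epsilon> * pdot N (n y) Z) *\<^sub>R n y"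
proof -
  obtain e where e: "Z = dird X e y + e $ k *\<^sub>R n y"
    using surj_frame[OF y] unfolding frame_def surj_def by blast
  have "pdot N (n y) Z = e $ k * \<epsilon>"
    using y unfolding e by (simp add: pdot_simps n_normal n_unit)
  then have "\<epsilon> * pdot N (n y) Z = e $ k" by (simp add: mult_ac)
  then show thesis using that e by metis
qed

lemma tangent_eqI:
  assumes y: "y \<in> W" and n: "pdot N (n y) Z = pdot N (n y) Z'"
    and X: "\<And>w. pdot N Z (dird X w y) = pdot N Z' (dird X w y)"
  shows "Z = Z'"
proof -
  have "pdot N (Z - Z') V = 0" for V
  proof -
    obtain e where "V = dird X e y + (\<epsilon> * pdot N (n y) V) *\<^sub>R n y" by (rule decompose[OF y])
    then have "pdot N (Z - Z') V = pdot N (Z - Z') (dird X e y + (\<epsilon> * pdot N (n y) V) *\<^sub>R n y)" by simp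
    also have "\<dots> = 0"
      using n X[of e] pdot_commute[of N "n y"] by (simp add: pdot_simps)
    finally show ?thesis .
  qed
  then show ?thesis using pdot_nondegenerate[of N "Z - Z'"] by simp
qed

text \<open>The derivative of n is tangent because n has constant square; e is the shape operator
  applied to u, expressed in parameters.\<close>

lemma weingarten:
  assumes y: "y \<in> W"
  obtains e where "dird n u y = - \<epsilon> *\<^sub>R dird X e y" "\<And>v. II y u v = I y e v"
proof -
  obtain e where e: "dird n u y = dird X e y"
    using decompose[OF y, of "dird n u y"] n_dn[OF y] by auto
  have 1: "dird n u y = - \<epsilon> *\<^sub>R dird X (- \<epsilon> *\<^sub>R e) y"
    unfolding dird_X_simps(3)[OF y] e by simp
  show thesis
    by (rule that[OF 1]) (simp only: second_form_def first_form_def 1 pdot_simps, simp)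
qed

lemma gauss_formula:
  assumes y: "y \<in> W"
  obtains e where "dird (dird X u) v y = dird X e y + II y u v *\<^sub>R n y"
  using decompose[OF y, of "dird (dird X u) v y"] second_form_eq[OF y, of v u]
    second_form_commute[OF y, of u v] by auto

text \<open>The second derivatives of n commute and cancel in the difference. The connection terms
  are not split off; they remain in the products with second derivatives of X.\<close>

lemma codazzi:
  assumes y: "y \<in> W"
  shows "dird (\<lambda>y. II y u v) w y - dird (\<lambda>y. II y w v) u y =
    - \<epsilon> * (pdot N (dird n u y) (dird (dird X v) w y) - pdot N (dird n w y) (dird (dird X v) u y))"
proof -
  have D: "dird (\<lambda>y. II y a v) b y =
      - \<epsilon> * (pdot N (dird (dird n a) b y) (dird X v y) + pdot N (dird n a y) (dird (dird X v) b y))" for a b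
  proof -
    have C: "Cinf_on (\<lambda>y. pdot N (dird n a y) (dird X v y)) W"
      by (rule Cinf_on_pdot[OF Cinf_on_dird[OF smooth_n] smooth_dX])
    show ?thesis
      unfolding second_form_def
      using dird_mult[OF differentiable_const Cinf_on_differentiable[OF C y], of "- \<epsilon>" b]
        dird_pdot[OF Cinf_on_dird[OF smooth_n] smooth_dX y, where N = N] by simp
  qed
  show ?thesis
    unfolding D dird_commute[OF smooth_n y, of u w] by (simp add: algebra_simps)
qed

text \<open>The functions differentiated are Christoffel symbols of the first kind. The third
  derivatives of X cancel, and the normal parts of the remaining products carry the curvature
  expression in h.\<close>

lemma gauss:
  assumes y: "y \<in> W"
  shows "dird (\<lambda>y. pdot N (dird (dird X u) w y) (dird X v y)) z y -
      dird (\<lambda>y. pdot N (dird (dird X u) z y) (dird X v y)) w y =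
    pdot N (dird (dird X u) w y) (dird (dird X v) z y) - pdot N (dird (dird X u) z y) (dird (dird X v) w y)"
  using dird_commute[OF smooth_dX y, of u w z]
  by (simp add: dird_pdot[OF Cinf_on_dird[OF smooth_dX] smooth_dX y])

lemma smooth_first_form: "Cinf_on (\<lambda>y. I y u v) W"
  unfolding first_form_def by (rule Cinf_on_pdot[OF smooth_dX smooth_dX])

lemma smooth_second_form: "Cinf_on (\<lambda>y. II y u v) W"
  unfolding second_form_def
  using Cinf_on_linear[OF bounded_linear_mult_right
      Cinf_on_pdot[OF Cinf_on_dird[OF smooth_n] smooth_dX]] .

lemma dird_first_form:
  assumes y: "y \<in> W"
  shows "dird (\<lambda>y. I y u v) w y =
    pdot N (dird (dird X u) w y) (dird X v y) + pdot N (dird X u y) (dird (dird X v) w y)"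
  unfolding first_form_def by (rule dird_pdot[OF smooth_dX smooth_dX y])

end

section \<open>Codazzi and Gauss equations of conformally related patches\<close>

text \<open>The arithmetic core of \<open>conformal_codazzi\<close>. A, B, C stand for derivatives
  of h, h', g; p and q for products of first and second derivatives of X; s and r for derivatives of
  \<sigma> and \<rho>, with \<open>seu\<close> and \<open>sew\<close> taken along the shape
  operator. All p and q cancel.\<close>

lemma codazzi_algebra:
  fixes \<sigma> \<tau> A1 A2 :: real
  assumes "A1 - A2 = p1 - p2"
    "B1 - B2 = (\<sigma> * p1 + (sv * huw + sw * huv - seu * gvw) / 2 + \<tau> * (\<sigma> * q1 + (sv * guw + sw * guv - su * gvw) / 2))
      - (\<sigma> * p2 + (sv * huw + su * hwv - sew * guv) / 2 + \<tau> * (\<sigma> * q2 + (sv * guw + su * gvw - sw * guv) / 2))"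
    "C1 - C2 = q1 - q2"
    "B1 = sw * huv + \<sigma> * A1 + (rw * guv + \<tau> * \<sigma> * C1)"
    "B2 = su * hwv + \<sigma> * A2 + (ru * gvw + \<tau> * \<sigma> * C2)"
  shows "sw / 2 * huv - su / 2 * hwv = (sew / 2 + \<tau> * sw - rw) * guv - (seu / 2 + \<tau> * su - ru) * gvw"
proof -
  have A1: "A1 = A2 + p1 - p2" and C1: "C1 = C2 + q1 - q2" using assms(1,3) by simp_all
  show ?thesis using assms(2) unfolding assms(4,5) A1 C1 by (simp add: field_simps)
qed

locale patch_pair = A: patch N \<epsilon> X n W k + B: patch N \<epsilon> X' n' W k
  for N :: "'m::finite set" and \<epsilon> X n X' n' W k
begin

abbreviation "g \<equiv> first_form N X"
abbreviation "h \<equiv> second_form N \<epsilon> X n"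
abbreviation "g' \<equiv> first_form N X'"
abbreviation "h' \<equiv> second_form N \<epsilon> X' n'"

text \<open>A fixed vector u0 that is nowhere isotropic exhibits \<sigma> as a quotient of smooth
  functions.\<close>

lemma conformal_factor_differentiable:
  assumes metric: "\<And>y. y \<in> W \<Longrightarrow> g' y u0 u0 = \<sigma> y * g y u0 u0"
    and u0: "\<And>y. y \<in> W \<Longrightarrow> g y u0 u0 \<noteq> 0" and y: "y \<in> W"
  shows "\<sigma> differentiable (at y)"
proof -
  have "(\<lambda>y. g' y u0 u0 / g y u0 u0) differentiable (at y)"
    by (intro differentiable_divide Cinf_on_differentiable[OF A.smooth_first_form y]
        Cinf_on_differentiable[OF B.smooth_first_form y] u0[OF y])
  then show ?thesis
    by (rule differentiable_cong_open[OF A.open_W y, rotated]) (simp add: metric u0)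
qed

lemma umbilic_factor_differentiable:
  assumes second: "\<And>y. y \<in> W \<Longrightarrow> h' y u0 u0 = \<sigma> y * h y u0 u0 + \<rho> y * g y u0 u0"
    and u0: "\<And>y. y \<in> W \<Longrightarrow> g y u0 u0 \<noteq> 0" and y: "y \<in> W" and \<sigma>: "\<sigma> differentiable (at y)"
  shows "\<rho> differentiable (at y)"
proof -
  have "(\<lambda>y. (h' y u0 u0 - \<sigma> y * h y u0 u0) / g y u0 u0) differentiable (at y)"
    by (intro differentiable_divide differentiable_diff differentiable_mult \<sigma>
        Cinf_on_differentiable[OF A.smooth_first_form y]
        Cinf_on_differentiable[OF A.smooth_second_form y]
        Cinf_on_differentiable[OF B.smooth_second_form y] u0[OF y])
  then show ?thesis
    by (rule differentiable_cong_open[OF A.open_W y, rotated]) (simp add: second u0)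
qed

end

locale conformal_pair = patch_pair N \<epsilon> X n X' n' W k
  for N :: "'m::finite set" and \<epsilon> X n X' n' W k +
  fixes \<sigma> \<rho> :: "real ^ 'm \<Rightarrow> real"
  assumes metric: "y \<in> W \<Longrightarrow> g' y u v = \<sigma> y * g y u v"
    and second: "y \<in> W \<Longrightarrow> h' y u v = \<sigma> y * h y u v + \<rho> y * g y u v"
    and conformal_nz: "y \<in> W \<Longrightarrow> \<sigma> y \<noteq> 0"
    and \<sigma>_differentiable: "y \<in> W \<Longrightarrow> \<sigma> differentiable (at y)"
    and \<rho>_differentiable: "y \<in> W \<Longrightarrow> \<rho> differentiable (at y)"
begin

lemma continuous_\<sigma>: "continuous_on W \<sigma>"
  using \<sigma>_differentiable by (intro differentiable_imp_continuous_on)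
    (simp add: differentiable_on_def differentiable_at_withinI)

lemma continuous_\<rho>: "continuous_on W \<rho>"
  using \<rho>_differentiable by (intro differentiable_imp_continuous_on)
    (simp add: differentiable_on_def differentiable_at_withinI)

lemma dird_metric:
  assumes y: "y \<in> W"
  shows "dird (\<lambda>y. g' y u v) w y = dird \<sigma> w y * g y u v + \<sigma> y * dird (\<lambda>y. g y u v) w y"
proof -
  have "dird (\<lambda>y. g' y u v) w y = dird (\<lambda>y. \<sigma> y * g y u v) w y"
    by (rule dird_cong[OF A.open_W y metric Cinf_on_differentiable[OF B.smooth_first_form y]])
  then show ?thesis
    by (simp add: dird_mult[OF \<sigma>_differentiable[OF y] Cinf_on_differentiable[OF A.smooth_first_form y]])
qed

lemma dird_second:
  assumes y: "y \<in> W"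
  shows "dird (\<lambda>y. h' y u v) w y = dird \<sigma> w y * h y u v + \<sigma> y * dird (\<lambda>y. h y u v) w y +
    (dird \<rho> w y * g y u v + \<rho> y * dird (\<lambda>y. g y u v) w y)"
proof -
  note d = \<sigma>_differentiable[OF y] \<rho>_differentiable[OF y]
    Cinf_on_differentiable[OF A.smooth_first_form y] Cinf_on_differentiable[OF A.smooth_second_form y]
  have "dird (\<lambda>y. h' y u v) w y = dird (\<lambda>y. \<sigma> y * h y u v + \<rho> y * g y u v) w y"
    by (rule dird_cong[OF A.open_W y second Cinf_on_differentiable[OF B.smooth_second_form y]])
  also have "\<dots> = dird (\<lambda>y. \<sigma> y * h y u v) w y + dird (\<lambda>y. \<rho> y * g y u v) w y"
    by (rule dird_add) (intro differentiable_mult d)+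
  finally show ?thesis by (simp only: dird_mult[OF d(1,4)] dird_mult[OF d(2,3)])
qed

text \<open>The product rule for g' = \<sigma> g, solved for the derivative of \<sigma>. Continuity
  is what extends its vanishing from a dense set.\<close>

lemma continuous_dird_\<sigma>:
  assumes u0: "\<And>y. y \<in> W \<Longrightarrow> g y u0 u0 \<noteq> 0"
  shows "continuous_on W (\<lambda>y. dird \<sigma> u y)"
proof -
  have "continuous_on W (\<lambda>y. (dird (\<lambda>y. g' y u0 u0) u y - \<sigma> y * dird (\<lambda>y. g y u0 u0) u y) / g y u0 u0)"
    using u0 by (intro continuous_intros continuous_\<sigma>
        Cinf_on_continuous[OF Cinf_on_dird[OF A.smooth_first_form]]
        Cinf_on_continuous[OF Cinf_on_dird[OF B.smooth_first_form]]
        Cinf_on_continuous[OF A.smooth_first_form]) auto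
  then show ?thesis
    by (rule continuous_on_eq) (simp add: dird_metric u0)
qed

text \<open>Adding two and subtracting the third of the permuted derivatives of the metric isolates
  a single product, by symmetry of second derivatives. For g' = \<sigma> g this is the change of the
  Christoffel symbols of the first kind under a conformal change.\<close>

lemma koszul:
  assumes y: "y \<in> W"
  shows "pdot N (dird X' w y) (dird (dird X' u) v y) = \<sigma> y * pdot N (dird X w y) (dird (dird X u) v y) +
    (dird \<sigma> u y * g y v w + dird \<sigma> v y * g y u w - dird \<sigma> w y * g y u v) / 2"
proof -
  define P where "P a b c = pdot N (dird X a y) (dird (dird X b) c y)" for a b c
  define P' where "P' a b c = pdot N (dird X' a y) (dird (dird X' b) c y)" for a b c
  have s: "P a b c = P a c b" "P' a b c = P' a c b" for a b c
    unfolding P_def P'_def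
    using dird_commute[OF A.smooth_X y, of b c] dird_commute[OF B.smooth_X y, of b c] by simp_all
  have D: "P' b a c + P' a b c = dird \<sigma> c y * g y a b + (\<sigma> y * P b a c + \<sigma> y * P a b c)" for a b c
    using dird_metric[OF y, of a b c] pdot_commute[of N "dird (dird X a) c y"]
      pdot_commute[of N "dird (dird X' a) c y"]
    unfolding A.dird_first_form[OF y] B.dird_first_form[OF y] P_def P'_def
    by (simp add: distrib_left)
  have "2 * P' w u v = 2 * (\<sigma> y * P w u v) +
      (dird \<sigma> u y * g y v w + dird \<sigma> v y * g y u w - dird \<sigma> w y * g y u v)"
    using D[of w v u] D[of w u v] D[of v u w] s[of w v u] s[of v w u] s[of u w v]
    by (simp add: A.first_form_commute[of y w])
  then show ?thesis unfolding P_def P'_def by (simp add: field_simps)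
qed

text \<open>Raising an index of \<sigma> h + \<rho> g with \<sigma> g cancels \<sigma> in front of
  h: the second shape operator is the first plus \<rho> / \<sigma> times the identity.\<close>

lemma weingarten_pair:
  assumes y: "y \<in> W"
  obtains e where "dird n u y = - \<epsilon> *\<^sub>R dird X e y" "\<And>v. h y u v = g y e v"
    "dird n' u y = - \<epsilon> *\<^sub>R (dird X' e y + (\<rho> y / \<sigma> y) *\<^sub>R dird X' u y)"
proof -
  obtain e where e: "dird n u y = - \<epsilon> *\<^sub>R dird X e y" "\<And>v. h y u v = g y e v"
    using A.weingarten[OF y, of u] by blast
  have "dird n' u y = - \<epsilon> *\<^sub>R (dird X' e y + (\<rho> y / \<sigma> y) *\<^sub>R dird X' u y)"
  proof (rule B.tangent_eqI[OF y])
    fix w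
    have "- \<epsilon> * pdot N (dird n' u y) (dird X' w y) = h' y u w" by (simp add: second_form_def)
    also have "\<dots> = \<sigma> y * g y e w + \<rho> y * g y u w" by (simp only: second[OF y] e(2))
    also have "\<dots> = g' y e w + \<rho> y / \<sigma> y * g' y u w"
      using metric[OF y] conformal_nz[OF y] by simp
    finally have "- \<epsilon> * (- \<epsilon> * pdot N (dird n' u y) (dird X' w y)) =
        - \<epsilon> * (g' y e w + \<rho> y / \<sigma> y * g' y u w)" by simp
    then show "pdot N (dird n' u y) (dird X' w y) =
        pdot N (- \<epsilon> *\<^sub>R (dird X' e y + (\<rho> y / \<sigma> y) *\<^sub>R dird X' u y)) (dird X' w y)"
      by (simp add: first_form_def pdot_simps)
  qed (use y in \<open>simp add: B.n_dn B.n_normal pdot_simps\<close>)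
  then show thesis using that e by blast
qed

text \<open>With the shape operators and Koszul's formula inserted, the difference of the two
  Codazzi equations involves only derivatives of \<sigma> and \<rho>. The product rule contributes
  the full derivative of \<sigma> times h, and Koszul's formula takes half of it away.\<close>

lemma conformal_codazzi:
  assumes y: "y \<in> W"
  obtains \<theta> where "\<And>u v w. (dird \<sigma> w y / 2) * h y u v - (dird \<sigma> u y / 2) * h y w v =
    \<theta> w * g y u v - \<theta> u * g y w v"
proof -
  have "\<exists>e. \<forall>u. dird n u y = - \<epsilon> *\<^sub>R dird X (e u) y \<and> (\<forall>v. h y u v = g y (e u) v) \<and>
    dird n' u y = - \<epsilon> *\<^sub>R (dird X' (e u) y + (\<rho> y / \<sigma> y) *\<^sub>R dird X' u y)"
    by (rule choice) (metis weingarten_pair[OF y])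
  then obtain e where e: "\<And>u. dird n u y = - \<epsilon> *\<^sub>R dird X (e u) y" "\<And>u v. g y (e u) v = h y u v"
    "\<And>u. dird n' u y = - \<epsilon> *\<^sub>R (dird X' (e u) y + (\<rho> y / \<sigma> y) *\<^sub>R dird X' u y)"
    by metis
  define \<tau> where "\<tau> = \<rho> y / \<sigma> y"
  have \<rho>: "\<rho> y = \<tau> * \<sigma> y" using conformal_nz[OF y] by (simp add: \<tau>_def)
  \<comment> \<open>The coefficient of g that remains after the cancellation.\<close>
  define \<theta> where "\<theta> w = dird \<sigma> (e w) y / 2 + \<tau> * dird \<sigma> w y - dird \<rho> w y" for w
  have "(dird \<sigma> w y / 2) * h y u v - (dird \<sigma> u y / 2) * h y w v = \<theta> w * g y u v - \<theta> u * g y w v" for u v w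
  proof -
    define P where "P a b c = pdot N (dird X a y) (dird (dird X b) c y)" for a b c
    define s where "s a = dird \<sigma> a y" for a
    have K: "pdot N (dird X' a y) (dird (dird X' b) c y) = \<sigma> y * P a b c +
        (s b * g y c a + s c * g y b a - s a * g y b c) / 2" for a b c
      unfolding P_def s_def by (rule koszul[OF y])
    have G: "g y a (e b) = h y b a" for a b
      using e(2) A.first_form_commute[of y a "e b"] by simp
    have F1: "dird (\<lambda>y. h y u v) w y - dird (\<lambda>y. h y w v) u y = P (e u) v w - P (e w) v u"
      unfolding A.codazzi[OF y] e(1) P_def by (simp add: pdot_simps algebra_simps)
    have F2: "dird (\<lambda>y. h' y u v) w y - dird (\<lambda>y. h' y w v) u y =
        (\<sigma> y * P (e u) v w + (s v * h y u w + s w * h y u v - s (e u) * g y v w) / 2 +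
          \<tau> * (\<sigma> y * P u v w + (s v * g y u w + s w * g y u v - s u * g y v w) / 2))
        - (\<sigma> y * P (e w) v u + (s v * h y u w + s u * h y w v - s (e w) * g y u v) / 2 +
          \<tau> * (\<sigma> y * P w v u + (s v * g y u w + s u * g y v w - s w * g y u v) / 2))"
    proof -
      have "dird (\<lambda>y. h' y u v) w y - dird (\<lambda>y. h' y w v) u y =
        (pdot N (dird X' (e u) y) (dird (dird X' v) w y) + \<tau> * pdot N (dird X' u y) (dird (dird X' v) w y))
        - (pdot N (dird X' (e w) y) (dird (dird X' v) u y) + \<tau> * pdot N (dird X' w y) (dird (dird X' v) u y))"
        unfolding B.codazzi[OF y] e(3) \<tau>_def by (simp add: pdot_simps algebra_simps)
      then show ?thesis
        unfolding K G
        by (simp only: A.first_form_commute[of y w u] A.first_form_commute[of y v u]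
            A.second_form_commute[OF y, of w u] A.first_form_commute[of y w v])
    qed
    have F3: "dird (\<lambda>y. g y u v) w y - dird (\<lambda>y. g y w v) u y = P u v w - P w v u"
      unfolding A.dird_first_form[OF y] P_def dird_commute[OF A.smooth_X y, of u w] by simp
    have "s w / 2 * h y u v - s u / 2 * h y w v =
        (s (e w) / 2 + \<tau> * s w - dird \<rho> w y) * g y u v - (s (e u) / 2 + \<tau> * s u - dird \<rho> u y) * g y v w"
      by (rule codazzi_algebra[OF F1 F2 F3])
        (simp_all only: dird_second[OF y] s_def \<rho> A.first_form_commute[of y w v])
    then show ?thesis unfolding \<theta>_def s_def A.first_form_commute[of y w v] .
  qed
  then show thesis using that by blast
qed

text \<open>With \<sigma> stationary, Koszul's formula is a mere rescaling, so the tangential part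
  of the second derivative has the same parameter vector e for both hypersurfaces.\<close>

lemma gauss_formula_pair:
  assumes y: "y \<in> W" and d: "\<And>a. dird \<sigma> a y = 0"
  obtains e where "dird (dird X u) v y = dird X e y + h y u v *\<^sub>R n y"
    "dird (dird X' u) v y = dird X' e y + h' y u v *\<^sub>R n' y"
proof -
  obtain e where e: "dird (dird X u) v y = dird X e y + h y u v *\<^sub>R n y"
    using A.gauss_formula[OF y] by blast
  have "dird (dird X' u) v y = dird X' e y + h' y u v *\<^sub>R n' y"
  proof (rule B.tangent_eqI[OF y])
    show "pdot N (n' y) (dird (dird X' u) v y) = pdot N (n' y) (dird X' e y + h' y u v *\<^sub>R n' y)"
      using y B.second_form_eq[OF y, of v u] B.second_form_commute[OF y, of u v]
      by (simp add: pdot_simps B.n_normal B.n_unit)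
    fix w
    have "pdot N (dird (dird X' u) v y) (dird X' w y) = \<sigma> y * pdot N (dird X w y) (dird (dird X u) v y)"
      using koszul[OF y, of w u v] d pdot_commute[of N "dird X' w y"] by simp
    also have "\<dots> = \<sigma> y * g y e w"
      using y A.n_normal[of y w] pdot_commute[of N "dird X w y" "n y"]
      unfolding e by (simp add: pdot_simps first_form_def pdot_commute)
    also have "\<dots> = g' y e w" using metric[OF y] by simp
    finally show "pdot N (dird (dird X' u) v y) (dird X' w y) =
        pdot N (dird X' e y + h' y u v *\<^sub>R n' y) (dird X' w y)"
      using y by (simp add: pdot_simps B.n_normal first_form_def)
  qed
  then show thesis using that e by blast
qed

text \<open>The expressions in \<open>A.gauss\<close> and \<open>B.gauss\<close> differ by the
  factor \<sigma>, and so do the tangential parts g(p,q) of the products of second derivatives; what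
  is left compares the normal parts. The derivative of \<sigma> has to vanish throughout W because
  \<open>K\<close> is itself differentiated.\<close>

lemma conformal_gauss:
  assumes d: "\<And>y a. y \<in> W \<Longrightarrow> dird \<sigma> a y = 0" and y: "y \<in> W"
  shows "h' y u w * h' y v z - h' y u z * h' y v w = \<sigma> y * (h y u w * h y v z - h y u z * h y v w)"
proof -
  have K: "pdot N (dird (dird X' a) b y) (dird X' c y) = \<sigma> y * pdot N (dird (dird X a) b y) (dird X c y)"
    if "y \<in> W" for y a b c
    using koszul[OF that, of c a b] d[OF that] by (simp add: pdot_commute)
  have D: "dird (\<lambda>y. pdot N (dird (dird X' a) b y) (dird X' c y)) z y =
      \<sigma> y * dird (\<lambda>y. pdot N (dird (dird X a) b y) (dird X c y)) z y" for a b c z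
  proof -
    note S = Cinf_on_pdot[OF Cinf_on_dird[OF A.smooth_dX] A.smooth_dX]
      Cinf_on_pdot[OF Cinf_on_dird[OF B.smooth_dX] B.smooth_dX]
    have "dird (\<lambda>y. pdot N (dird (dird X' a) b y) (dird X' c y)) z y =
        dird (\<lambda>y. \<sigma> y * pdot N (dird (dird X a) b y) (dird X c y)) z y"
      by (rule dird_cong[OF A.open_W y K Cinf_on_differentiable[OF S(2) y]])
    then show ?thesis
      using dird_mult[OF \<sigma>_differentiable[OF y] Cinf_on_differentiable[OF S(1) y]] d[OF y] by simp
  qed
  have R: "pdot N (dird (dird X' u) w y) (dird (dird X' v) z y) - pdot N (dird (dird X' u) z y) (dird (dird X' v) w y)
    = \<sigma> y * (pdot N (dird (dird X u) w y) (dird (dird X v) z y) - pdot N (dird (dird X u) z y) (dird (dird X v) w y))"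
    unfolding A.gauss[OF y, symmetric] B.gauss[OF y, symmetric] D by (simp add: algebra_simps)
  have Q: "pdot N (dird (dird X' a) b y) (dird (dird X' c) e y) - \<epsilon> * (h' y a b * h' y c e) =
    \<sigma> y * (pdot N (dird (dird X a) b y) (dird (dird X c) e y) - \<epsilon> * (h y a b * h y c e))" for a b c e
  proof -
    obtain p where p: "dird (dird X a) b y = dird X p y + h y a b *\<^sub>R n y"
        "dird (dird X' a) b y = dird X' p y + h' y a b *\<^sub>R n' y"
      by (rule gauss_formula_pair[OF y d[OF y]])
    obtain q where q: "dird (dird X c) e y = dird X q y + h y c e *\<^sub>R n y"
        "dird (dird X' c) e y = dird X' q y + h' y c e *\<^sub>R n' y"
      by (rule gauss_formula_pair[OF y d[OF y]])
    have "pdot N (dird (dird X a) b y) (dird (dird X c) e y) = g y p q + \<epsilon> * (h y a b * h y c e)"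
      "pdot N (dird (dird X' a) b y) (dird (dird X' c) e y) = g' y p q + \<epsilon> * (h' y a b * h' y c e)"
      unfolding p q using y A.n_normal[OF y] B.n_normal[OF y]
        pdot_commute[of N "dird X p y" "n y"] pdot_commute[of N "dird X' p y" "n' y"]
      by (simp_all add: pdot_simps A.n_unit B.n_unit first_form_def)
    then show ?thesis using metric[OF y] by simp
  qed
  have "\<epsilon> * (h' y u w * h' y v z - h' y u z * h' y v w) =
      \<epsilon> * (\<sigma> y * (h y u w * h y v z - h y u z * h y v w))"
    using R Q[of u w v z] Q[of u z v w] by (simp add: right_diff_distrib mult.left_commute)
  then show ?thesis by simp
qed

end

section \<open>Rigidity\<close>

lemma continuous_zero_on_closure:
  fixes f :: "'a::metric_space \<Rightarrow> 'b::real_normed_vector"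
  assumes "open W" "continuous_on W f" "\<And>z. z \<in> D \<Longrightarrow> z \<in> W \<Longrightarrow> f z = 0" "y \<in> W" "y \<in> closure D"
  shows "f y = 0"
proof (rule ccontr)
  assume n: "f y \<noteq> 0"
  have "open (W \<inter> f -` (- {0}))"
    by (rule continuous_open_preimage[OF assms(2,1)]) (simp add: open_Compl)
  moreover have "y \<in> W \<inter> f -` (- {0})" using n assms(4) by simp
  ultimately obtain z where "z \<in> D" "z \<in> W \<inter> f -` (- {0})"
    using assms(5) closure_iff_nhds_not_empty[of y D] by blast
  then show False using assms(3) by blast
qed

definition proj :: "'m::finite \<Rightarrow> real ^ 'm \<Rightarrow> real ^ 'm" where
  "proj k u = u - u $ k *\<^sub>R axis k 1"

lemma linear_proj: "linear (proj k)"
  unfolding proj_def linear_iff by (simp add: algebra_simps)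

lemma proj_k [simp]: "proj k u $ k = 0"
  by (simp add: proj_def)

lemma proj_eq_self: "u $ k = 0 \<Longrightarrow> proj k u = u"
  by (simp add: proj_def)

context patch
begin

lemma dird_proj: "y \<in> W \<Longrightarrow> dird X (proj k u) y = dird X u y"
  by (simp add: proj_def dird_X_simps dird_k)

lemma forms_proj:
  assumes "y \<in> W"
  shows "I y (proj k u) (proj k v) = I y u v" "II y (proj k u) (proj k v) = II y u v"
proof -
  show "I y (proj k u) (proj k v) = I y u v" using assms by (simp add: first_form_def dird_proj)
  have P: "II y a (proj k b) = II y a b" for a b using assms by (simp add: second_form_def dird_proj)
  show "II y (proj k u) (proj k v) = II y u v"
    using P second_form_commute[OF assms] by metis
qed

text \<open>A tangent vector orthogonal to all tangent vectors is also orthogonal to n, hence zero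
  in the ambient space. Four coordinates leave dimension three for the hyperplane.\<close>

lemma parameter_scalar_product:
  assumes y: "y \<in> W" and card: "CARD('m) \<ge> 4"
    and pos: "\<exists>u. I y u u > 0" and neg: "\<exists>u. I y u u < 0"
  shows "indefinite_scalar_product {u. u $ k = 0} (I y)"
proof
  have E: "{u::real ^ 'm. u $ k = 0} = {u. axis k 1 \<bullet> u = 0}"
    by (simp add: inner_axis' )
  show "subspace {u::real ^ 'm. u $ k = 0}"
    unfolding E by (rule subspace_hyperplane)
  show "dim {u::real ^ 'm. u $ k = 0} \<ge> 3"
    unfolding E using card by (subst dim_hyperplane) auto
  show "sym_form_on {u. u $ k = 0} (I y)"
    unfolding sym_form_on_def using bilinear_forms[OF y] first_form_commute by blast
  show "x = 0" if x: "x \<in> {u. u $ k = 0}" "\<And>v. v \<in> {u. u $ k = 0} \<Longrightarrow> I y x v = 0" for x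
  proof (rule immersion[OF y])
    have "I y x v = 0" for v
      using x(2)[of "proj k v"] y by (simp add: first_form_def dird_proj)
    then show "dird X x y = 0"
      by (intro tangent_eqI[OF y]) (simp_all add: n_normal y first_form_def pdot_simps)
  qed (use x in simp)
  obtain u v where "I y u u > 0" "I y v v < 0" using pos neg by blast
  then have "I y (proj k u) (proj k u) > 0" "I y (proj k v) (proj k v) < 0"
    by (simp_all add: first_form_def dird_proj y)
  then show "\<exists>x\<in>{u. u $ k = 0}. I y x x > 0" "\<exists>x\<in>{u. u $ k = 0}. I y x x < 0"
    using proj_k[of k u] proj_k[of k v] by blast+
qed

end

context conformal_pair
begin

text \<open>Comparing the Gauss equations needs a vanishing derivative of \<sigma> on an open set,
  so the conclusion from Codazzi is first extended by density to all of W. Density is used again to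
  carry \<sigma> = 1 and \<rho> = 0 to every point.\<close>

lemma isometric_and_second_form:
  assumes card: "CARD('m) \<ge> 4"
    and pos: "\<And>y. y \<in> W \<Longrightarrow> \<exists>u. g y u u > 0" and neg: "\<And>y. y \<in> W \<Longrightarrow> \<exists>u. g y u u < 0"
    and u0: "\<And>y. y \<in> W \<Longrightarrow> g y u0 u0 \<noteq> 0"
    and dense: "\<And>y. y \<in> W \<Longrightarrow> y \<in> closure {z \<in> W. \<not> quasi_umbilic_form {u. u $ k = 0} (g z) (h z)}"
    and y: "y \<in> W"
  shows "g' y u v = g y u v \<and> h' y u v = h y u v"
proof -
  define E where "E = {u::real ^ 'm. u $ k = 0}"
  define D where "D = {z \<in> W. \<not> quasi_umbilic_form E (g z) (h z)}"
  have sp: "indefinite_scalar_product E (g z)" if "z \<in> W" for z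
    unfolding E_def by (rule A.parameter_scalar_product[OF that card pos[OF that] neg[OF that]])
  have sym: "sym_form_on E (h z)" if "z \<in> W" for z
    unfolding sym_form_on_def using A.bilinear_forms[OF that] A.second_form_commute[OF that] by blast
  have D0: "dird \<sigma> w z = 0" if z: "z \<in> D" for w z
  proof (rule ccontr)
    assume n: "dird \<sigma> w z \<noteq> 0"
    have zW: "z \<in> W" and nqu: "\<not> quasi_umbilic_form E (g z) (h z)" using z by (auto simp: D_def)
    interpret indefinite_scalar_product E "g z" by (rule sp[OF zW])
    have lin: "linear (\<lambda>u. dird \<sigma> u z)"
      using linear_frechet_derivative[OF \<sigma>_differentiable[OF zW]] .
    obtain \<theta> where \<theta>: "\<And>u v w. (dird \<sigma> w z / 2) * h z u v - (dird \<sigma> u z / 2) * h z w v =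
      \<theta> w * g z u v - \<theta> u * g z w v"
      using conformal_codazzi[OF zW] by blast
    have lin2: "linear (\<lambda>u. dird \<sigma> u z / 2)"
      using lin by (simp add: linear_iff add_divide_distrib)
    have E0: "dird \<sigma> u z = 0" if "u \<in> E" for u
    proof (rule ccontr)
      assume "dird \<sigma> u z \<noteq> 0"
      then have "quasi_umbilic_form E (g z) (h z)"
        by (intro codazzi_imp_quasi_umbilic[OF sym[OF zW] lin2 \<theta> that]) simp
      then show False using nqu by blast
    qed
    \<comment> \<open>The redundant direction is treated separately: g and h vanish once
      \<open>axis k 1\<close> is inserted, so a nonzero derivative of \<sigma> along it would make h
      a multiple of g.\<close>
    have "dird \<sigma> w z = dird \<sigma> (proj k w) z + w $ k * dird \<sigma> (axis k 1) z"
      unfolding proj_def using linear_diff[OF lin] linear_cmul[OF lin] by simp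
    then have nk: "dird \<sigma> (axis k 1) z \<noteq> 0" using n E0[of "proj k w"] by (auto simp: E_def)
    have "h z (axis k 1) v = 0" "g z (axis k 1) v = 0" for v
      using A.second_form_commute[OF zW, of "axis k 1" v]
      by (simp_all add: first_form_def second_form_def A.dird_k[OF zW] pdot_simps)
    then have "dird \<sigma> (axis k 1) z / 2 * h z u v = \<theta> (axis k 1) * g z u v" for u v
      using \<theta>[of "axis k 1" u v] by simp
    then have "h z u v = (\<theta> (axis k 1) * 2 / dird \<sigma> (axis k 1) z) * g z u v" for u v
      using nk by (simp add: field_simps)
    then have "proportional_on E (h z) (g z)" unfolding proportional_on_def by blast
    then show False using nqu proportional_on_imp_quasi_umbilic by blast
  qed
  have cl: "z \<in> closure D" if "z \<in> W" for z using dense[OF that] by (simp add: D_def E_def)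
  have d0: "dird \<sigma> a z = 0" if "z \<in> W" for a z
    by (rule continuous_zero_on_closure[OF A.open_W continuous_dird_\<sigma>[OF u0] D0 that cl[OF that]])
  have G: "\<sigma> z = 1 \<and> \<rho> z = 0" if z: "z \<in> D" for z
  proof -
    have zW: "z \<in> W" and nqu: "\<not> quasi_umbilic_form E (g z) (h z)" using z by (auto simp: D_def)
    interpret indefinite_scalar_product E "g z" by (rule sp[OF zW])
    show ?thesis
      by (rule gauss_imp_isometric[OF sym[OF zW] nqu conformal_nz[OF zW] second[OF zW]
            conformal_gauss[OF d0 zW]])
  qed
  have "\<sigma> y - 1 = 0"
    by (rule continuous_zero_on_closure[OF A.open_W _ _ y cl[OF y]])
      (use G in \<open>auto intro!: continuous_intros continuous_\<sigma>\<close>)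
  moreover have "\<rho> y = 0"
    by (rule continuous_zero_on_closure[OF A.open_W continuous_\<rho> _ y cl[OF y]]) (use G in auto)
  ultimately show ?thesis using metric[OF y] second[OF y] by simp
qed

end

section \<open>Congruence of patches with equal fundamental forms\<close>

lemma det_differentiable:
  fixes F :: "'a::real_normed_vector \<Rightarrow> real ^ 'n ^ 'n"
  assumes "\<And>i j. (\<lambda>y. F y $ i $ j) differentiable (at y)"
  shows "(\<lambda>y. det (F y)) differentiable (at y)"
proof -
  have "(\<lambda>y. \<Prod>i\<in>S. F y $ i $ p i) differentiable (at y)" if "finite S" for S and p :: "'n \<Rightarrow> 'n"
    using that by (induction S rule: finite_induct) (simp_all add: assms)
  then show ?thesis unfolding det_def by (intro differentiable_sum differentiable_mult) auto
qed

context patch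
begin

text \<open>Cramer's rule expresses the coordinates as quotients of determinants.\<close>

lemma frame_coordinates_differentiable:
  assumes y: "y \<in> W"
  shows "(\<lambda>y. inv (frame y) v $ j) differentiable (at y)"
proof -
  have entry: "(\<lambda>y. matrix (frame y) $ i $ j) differentiable (at y)" for i j
  proof -
    have "Cinf_on (\<lambda>y. frame y (axis j 1) $ i) W"
      unfolding frame_def
      by (rule Cinf_on_linear[OF bounded_linear_vec_nth], rule Cinf_on_add[OF smooth_dX],
          rule Cinf_on_linear[OF bounded_linear_scaleR_right smooth_n])
    then show ?thesis using Cinf_on_differentiable[OF _ y] by (simp add: matrix_def)
  qed
  have nz: "det (matrix (frame z)) \<noteq> 0" if "z \<in> W" for z
    using det_nz_iff_inj[OF linear_frame[OF that]] inj_frame[OF that] by simp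
  let ?C = "\<lambda>y. (\<chi> i l. if l = j then v $ i else matrix (frame y) $ i $ l)"
  have eq: "det (?C z) / det (matrix (frame z)) = inv (frame z) v $ j" if "z \<in> W" for z
  proof -
    have "matrix (frame z) *v inv (frame z) v = v"
      using surj_f_inv_f[OF surj_frame[OF that]] matrix_works[of "frame z"] linear_frame[OF that]
      by (simp add: linear_matrix_vector_mul_eq)
    then show ?thesis unfolding cramer[OF nz[OF that]] by (simp add: vec_eq_iff)
  qed
  have "(\<lambda>y. det (?C y) / det (matrix (frame y))) differentiable (at y)"
  proof (intro differentiable_divide det_differentiable nz[OF y] entry)
    show "(\<lambda>y. ?C y $ i $ l) differentiable (at y)" for i l
      using entry by (cases "l = j") simp_all
  qed
  then show ?thesis by (rule differentiable_cong_open[OF open_W y, rotated]) (rule eq)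
qed

lemma smooth_frame: "Cinf_on (\<lambda>y. frame y e) W"
  unfolding frame_def
  by (rule Cinf_on_add[OF smooth_dX], rule Cinf_on_linear[OF bounded_linear_scaleR_right smooth_n])

lemma dird_frame:
  assumes y: "y \<in> W"
  shows "dird (\<lambda>y. frame y e) u y = dird (dird X e) u y + e $ k *\<^sub>R dird n u y"
  unfolding frame_def
  by (rule dirdI, intro has_derivative_add has_derivative_scaleR_right Cinf_on_has_derivative[OF smooth_dX y]
      Cinf_on_has_derivative[OF smooth_n y])

end

context patch_pair
begin

text \<open>Equal fundamental forms give both frames the same structure equations, so the map from
  one frame to the other has derivative zero; convexity of W makes it constant.\<close>

lemma rigidity:
  assumes conv: "convex W" and ne: "y0 \<in> W"
    and metric: "\<And>y u v. y \<in> W \<Longrightarrow> g' y u v = g y u v"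
    and second: "\<And>y u v. y \<in> W \<Longrightarrow> h' y u v = h y u v"
  obtains L b where "linear L" "\<And>v w. pdot N (L v) (L w) = pdot N v w"
    "\<And>y. y \<in> W \<Longrightarrow> X' y = L (X y) + b" "\<And>y. y \<in> W \<Longrightarrow> n' y = L (n y)"
    "\<And>y u. y \<in> W \<Longrightarrow> dird X' u y = L (dird X u y)"
proof -
  \<comment> \<open>With factors 1 and 0, the paired Gauss and Weingarten formulas provide common
    parameter vectors for both hypersurfaces.\<close>
  interpret conformal_pair N \<epsilon> X n X' n' W k "\<lambda>_. 1" "\<lambda>_. 0"
    by unfold_locales (simp_all add: metric second)
  have struct: "\<exists>c. dird (\<lambda>y. A.frame y e) u y = A.frame y c \<and> dird (\<lambda>y. B.frame y e) u y = B.frame y c"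
    if y: "y \<in> W" for y e u
  proof -
    obtain p where p: "dird (dird X e) u y = dird X p y + h y e u *\<^sub>R n y"
      "dird (dird X' e) u y = dird X' p y + h' y e u *\<^sub>R n' y"
      by (rule gauss_formula_pair[OF y]) simp
    obtain q where q: "dird n u y = - \<epsilon> *\<^sub>R dird X q y"
      "dird n' u y = - \<epsilon> *\<^sub>R (dird X' q y + (0 / 1) *\<^sub>R dird X' u y)"
      by (rule weingarten_pair[OF y])
    \<comment> \<open>The k-th coordinate of c is the normal component of the derivative;
      \<open>proj\<close> keeps p and q from contributing to it.\<close>
    define c where "c = proj k (p - (e $ k * \<epsilon>) *\<^sub>R q) + h y e u *\<^sub>R axis k 1"
    have ck: "c $ k = h y e u" by (simp add: c_def)
    have "dird X c y = dird X p y - (e $ k * \<epsilon>) *\<^sub>R dird X q y"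
      "dird X' c y = dird X' p y - (e $ k * \<epsilon>) *\<^sub>R dird X' q y"
      unfolding c_def proj_def
      by (simp_all add: A.dird_X_simps[OF y] B.dird_X_simps[OF y] A.dird_k[OF y] B.dird_k[OF y])
    then have "dird (\<lambda>y. A.frame y e) u y = A.frame y c" "dird (\<lambda>y. B.frame y e) u y = B.frame y c"
      unfolding A.dird_frame[OF y] B.dird_frame[OF y] A.frame_def[of _ c] B.frame_def[of _ c] ck p q
      using second[OF y] by simp_all
    then show ?thesis by blast
  qed
  define R where "R y v = B.frame y (inv (A.frame y) v)" for y v
  have R0: "((\<lambda>y. R y v) has_derivative (\<lambda>u. 0)) (at y)" if y: "y \<in> W" for y v
  proof -
    define E where "E j y = inv (A.frame y) v $ j" for j y
    have dE: "(E j has_derivative (\<lambda>u. dird (E j) u y)) (at y)" for j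
      unfolding E_def by (rule differentiable_imp_dird[OF A.frame_coordinates_differentiable[OF y]])
    have expand: "F (inv (A.frame z) v) = (\<Sum>j\<in>UNIV. E j z *\<^sub>R F (axis j 1))"
      if "linear F" for F :: "real ^ 'm \<Rightarrow> real ^ 'm" and z
    proof -
      have "inv (A.frame z) v = (\<Sum>j\<in>UNIV. E j z *\<^sub>R axis j 1)"
        unfolding E_def by (subst basis_expansion[symmetric]) (simp add: scalar_mult_eq_scaleR)
      then show ?thesis by (simp add: linear_sum[OF that] linear_cmul[OF that])
    qed
    obtain c where c: "\<And>j u. dird (\<lambda>y. A.frame y (axis j 1)) u y = A.frame y (c j u)"
      "\<And>j u. dird (\<lambda>y. B.frame y (axis j 1)) u y = B.frame y (c j u)"
    proof -
      have "\<forall>j u. \<exists>c. dird (\<lambda>y. A.frame y (axis j 1)) u y = A.frame y c \<and>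
          dird (\<lambda>y. B.frame y (axis j 1)) u y = B.frame y c"
        using struct[OF y] by blast
      then show thesis using that by metis
    qed
    \<comment> \<open>This avoids differentiating the inverse frame. A fixed v is expanded in the
      first frame with coordinates E j; in either frame the derivative of the sum is the frame
      applied to the same d u. For the first frame the sum is constant, so injectivity gives d u =
      0, and the second sum has derivative zero too.\<close>
    define d where "d u = (\<Sum>j\<in>UNIV. E j y *\<^sub>R c j u + dird (E j) u y *\<^sub>R axis j 1)" for u
    have D: "((\<lambda>z. \<Sum>j\<in>UNIV. E j z *\<^sub>R Fr z (axis j 1)) has_derivative (\<lambda>u. Fr y (d u))) (at y)"
      if sm: "\<And>e. Cinf_on (\<lambda>z. Fr z e) W" and lin: "linear (Fr y)"
        and dc: "\<And>j u. dird (\<lambda>z. Fr z (axis j 1)) u y = Fr y (c j u)"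
      for Fr :: "real ^ 'm \<Rightarrow> real ^ 'm \<Rightarrow> real ^ 'm"
    proof -
      have "((\<lambda>z. \<Sum>j\<in>UNIV. E j z *\<^sub>R Fr z (axis j 1)) has_derivative
          (\<lambda>u. \<Sum>j\<in>UNIV. E j y *\<^sub>R Fr y (c j u) + dird (E j) u y *\<^sub>R Fr y (axis j 1))) (at y)"
      proof (rule has_derivative_sum)
        fix j
        have "((\<lambda>z. Fr z (axis j 1)) has_derivative (\<lambda>u. Fr y (c j u))) (at y)"
          unfolding dc[symmetric] by (rule Cinf_on_has_derivative[OF sm y])
        from has_derivative_scaleR[OF dE this]
        show "((\<lambda>z. E j z *\<^sub>R Fr z (axis j 1)) has_derivative
          (\<lambda>u. E j y *\<^sub>R Fr y (c j u) + dird (E j) u y *\<^sub>R Fr y (axis j 1))) (at y)" .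
      qed
      moreover have "Fr y (d u) = (\<Sum>j\<in>UNIV. E j y *\<^sub>R Fr y (c j u) + dird (E j) u y *\<^sub>R Fr y (axis j 1))" for u
        unfolding d_def by (simp add: linear_sum[OF lin] linear_add[OF lin] linear_cmul[OF lin])
      ultimately show ?thesis by simp
    qed
    have "((\<lambda>z. \<Sum>j\<in>UNIV. E j z *\<^sub>R A.frame z (axis j 1)) has_derivative (\<lambda>u. A.frame y (d u))) (at y)"
      by (rule D[OF A.smooth_frame A.linear_frame[OF y] c(1)])
    moreover have "(\<Sum>j\<in>UNIV. E j z *\<^sub>R A.frame z (axis j 1)) = v" if "z \<in> W" for z
      using expand[OF A.linear_frame[OF that]] surj_f_inv_f[OF A.surj_frame[OF that]] by metis
    ultimately have "((\<lambda>z. v) has_derivative (\<lambda>u. A.frame y (d u))) (at y)"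
      by (rule has_derivative_transform_within_open[OF _ A.open_W y])
    then have "A.frame y (d u) = 0" for u
      using has_derivative_unique[OF _ has_derivative_const[of v "at y"]] by metis
    then have "d u = 0" for u
      using A.inj_frame[OF y] linear_0[OF A.linear_frame[OF y]] by (metis injD)
    then have "((\<lambda>z. \<Sum>j\<in>UNIV. E j z *\<^sub>R B.frame z (axis j 1)) has_derivative (\<lambda>u. 0)) (at y)"
      using D[OF B.smooth_frame B.linear_frame[OF y] c(2)] linear_0[OF B.linear_frame[OF y]] by simp
    then show ?thesis
      by (rule has_derivative_transform_within_open[OF _ A.open_W y])
        (simp add: R_def expand[OF B.linear_frame])
  qed
  have Rc: "R y v = R y0 v" if "y \<in> W" for y v
    by (rule has_derivative_zero_unique[OF conv _ that ne])
      (rule has_derivative_at_withinI[OF R0])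
  define L where "L = R y0"
  have LF: "L (A.frame y e) = B.frame y e" if "y \<in> W" for y e
    using Rc[OF that, of "A.frame y e"] inv_f_f[OF A.inj_frame[OF that]] by (simp add: L_def R_def)
  have lin: "linear L"
    unfolding L_def R_def
    using linear_compose[OF inj_linear_imp_inv_linear[OF A.linear_frame[OF ne] A.inj_frame[OF ne]]
        B.linear_frame[OF ne]] by (simp add: o_def)
  have pd: "pdot N (L v) (L w) = pdot N v w" for v w
  proof -
    obtain a c where ac: "v = A.frame y0 a" "w = A.frame y0 c"
      using A.surj_frame[OF ne] unfolding surj_def by metis
    have "pdot N (A.frame y0 a) (A.frame y0 c) = g y0 a c + a $ k * c $ k * \<epsilon>"
      using A.n_normal[OF ne] pdot_commute[of N "dird X a y0" "n y0"]
      by (simp add: A.frame_def pdot_simps first_form_def A.n_unit[OF ne])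
    moreover have "pdot N (B.frame y0 a) (B.frame y0 c) = g' y0 a c + a $ k * c $ k * \<epsilon>"
      using B.n_normal[OF ne] pdot_commute[of N "dird X' a y0" "n' y0"]
      by (simp add: B.frame_def pdot_simps first_form_def B.n_unit[OF ne])
    ultimately show ?thesis unfolding ac LF[OF ne] using metric[OF ne] by simp
  qed
  have Ln: "n' y = L (n y)" if "y \<in> W" for y
    using LF[OF that, of "axis k 1"] by (simp add: A.frame_def B.frame_def A.dird_k[OF that] B.dird_k[OF that])
  have LX: "dird X' u y = L (dird X u y)" if "y \<in> W" for y u
    using LF[OF that, of "proj k u"] A.dird_proj[OF that, of u] B.dird_proj[OF that, of u]
    by (simp add: A.frame_def B.frame_def proj_def)
  define b where "b = X' y0 - L (X y0)"
  have bl: "bounded_linear L" using lin linear_conv_bounded_linear by blast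
  have D: "((\<lambda>y. X' y - L (X y)) has_derivative (\<lambda>h. 0)) (at z within W)" if z: "z \<in> W" for z
  proof -
    have "((\<lambda>y. L (X y)) has_derivative (\<lambda>u. L (dird X u z))) (at z)"
      by (rule bounded_linear.has_derivative[OF bl Cinf_on_has_derivative[OF A.smooth_X z]])
    then have "((\<lambda>y. X' y - L (X y)) has_derivative (\<lambda>u. dird X' u z - L (dird X u z))) (at z)"
      by (rule has_derivative_diff[OF Cinf_on_has_derivative[OF B.smooth_X z]])
    then have "((\<lambda>y. X' y - L (X y)) has_derivative (\<lambda>u. 0)) (at z)"
      by (simp only: LX[OF z] diff_self)
    then show ?thesis by (rule has_derivative_at_withinI)
  qed
  have "X' y - L (X y) = X' y0 - L (X y0)" if "y \<in> W" for y
    using has_derivative_zero_unique[OF conv D that ne] by simp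
  then have "X' y = L (X y) + b" if "y \<in> W" for y
    using that by (simp add: b_def algebra_simps)
  then show thesis by (rule that[OF lin pd _ Ln LX])
qed

end

section \<open>Charts and tangent spaces\<close>

lemma norm_proj_le: "norm (proj k u) \<le> norm u"
  by (rule norm_le_componentwise_cart) (simp add: proj_def axis_def)

lemma bounded_linear_proj: "bounded_linear (proj k)"
  using linear_proj linear_conv_bounded_linear by blast

text \<open>X is the inverse of a straightening diffeomorphism preceded by \<open>proj k\<close>, so
  it ignores the k-th coordinate, and P inverts it only up to this projection.\<close>

lemma hypersurface_chart:
  fixes M :: "(real ^ 'm::finite) set"
  assumes "hypersurface M" "p \<in> M"
  obtains k r U and y0 :: "real ^ 'm" and X P :: "real ^ 'm \<Rightarrow> real ^ 'm" where "r > 0" "Cinf_on X (ball y0 r)" "Cinf_on P U" "p \<in> U"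
    "\<And>y. y \<in> ball y0 r \<Longrightarrow> X y \<in> M" "\<And>y. y \<in> ball y0 r \<Longrightarrow> X y \<in> U"
    "\<And>y. y \<in> ball y0 r \<Longrightarrow> P (X y) = proj k y"
    "\<And>q. q \<in> M \<Longrightarrow> q \<in> U \<Longrightarrow> P q \<in> ball y0 r" "\<And>q. q \<in> M \<Longrightarrow> q \<in> U \<Longrightarrow> X (P q) = q"
proof -
  obtain U V \<Phi> k where U: "open U" "p \<in> U" and V: "open V" and \<Phi>: "diffeomorphism U V \<Phi>"
    and im: "\<Phi> ` (M \<inter> U) = V \<inter> {y :: real ^ 'm. y $ k = 0}"
    using assms unfolding hypersurface_def by meson
  have bij: "bij_betw \<Phi> U V" and s: "Cinf_on \<Phi> U" "Cinf_on (inv_into U \<Phi>) V"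
    using \<Phi> U(1) V by (simp_all add: diffeomorphism_def smooth_on_open_iff)
  define \<Psi> where "\<Psi> = inv_into U \<Phi>"
  have \<Phi>\<Psi>: "\<Phi> (\<Psi> y) = y" if "y \<in> V" for y
    using bij that unfolding \<Psi>_def by (simp add: bij_betw_inv_into_right)
  have \<Psi>\<Phi>: "\<Psi> (\<Phi> q) = q" if "q \<in> U" for q
    using bij that unfolding \<Psi>_def by (simp add: bij_betw_inv_into_left)
  define y0 where "y0 = \<Phi> p"
  have y0: "y0 \<in> V" "y0 $ k = 0" using im assms(2) U(2) by (auto simp: y0_def)
  obtain r where r: "r > 0" "ball y0 r \<subseteq> V" using V y0(1) open_contains_ball by blast
  \<comment> \<open>The centre lies in the hyperplane, so projecting does not leave the
    ball.\<close>
  have pr: "proj k y \<in> ball y0 r" if "y \<in> ball y0 r" for y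
  proof -
    have "y0 - proj k y = proj k (y0 - y)" using y0(2) by (simp add: proj_def algebra_simps)
    then show ?thesis using norm_proj_le[of k "y0 - y"] that by (simp add: dist_norm)
  qed
  define X where "X y = \<Psi> (proj k y)" for y
  define U' where "U' = U \<inter> \<Phi> -` ball y0 r"
  have U': "open U'"
    unfolding U'_def by (rule continuous_open_preimage[OF Cinf_on_continuous[OF s(1)] U(1) open_ball])
  have XM: "X y \<in> M \<and> X y \<in> U \<and> \<Phi> (X y) = proj k y" if "y \<in> ball y0 r" for y
  proof -
    have "proj k y \<in> \<Phi> ` (M \<inter> U)" unfolding im using pr[OF that] r(2) by auto
    then obtain q where q: "proj k y = \<Phi> q" "q \<in> M \<inter> U" by (rule imageE)
    then have "X y = q" using \<Psi>\<Phi>[of q] by (simp add: X_def)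
    then show ?thesis using q by simp
  qed
  show thesis
  proof (rule that[where r = r and X = X and P = \<Phi> and U = U' and k = k and ?y0.0 = y0])
    show "r > 0" by (rule r(1))
    show "Cinf_on X (ball y0 r)"
      unfolding X_def \<Psi>_def
      by (rule Cinf_on_compose[OF s(2) Cinf_on_linear[OF bounded_linear_proj Cinf_on_ident[OF open_ball]]])
        (use pr r(2) in blast)
    show "Cinf_on \<Phi> U'" by (rule Cinf_on_subset[OF s(1) U']) (simp add: U'_def)
    show "p \<in> U'" using U(2) r(1) by (simp add: U'_def y0_def)
    fix y assume y: "y \<in> ball y0 r"
    show "X y \<in> M" "\<Phi> (X y) = proj k y" "X y \<in> U'" using XM[OF y] pr[OF y] by (simp_all add: U'_def)
  next
    fix q assume q: "q \<in> M" "q \<in> U'"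
    show "\<Phi> q \<in> ball y0 r" using q by (simp add: U'_def)
    have "\<Phi> q $ k = 0" using im q by (auto simp: U'_def)
    then show "X (\<Phi> q) = q" using q \<Psi>\<Phi> by (simp add: X_def proj_eq_self U'_def)
  qed
qed

lemma dird_in_tangent_space:
  assumes X: "Cinf_on X W" "X ` W \<subseteq> M" and y: "y \<in> W"
  shows "dird X u y \<in> tangent_space M (X y)"
proof -
  have lin: "bounded_linear (\<lambda>t::real. t *\<^sub>R u)" by (rule bounded_linear_scaleR_left)
  have C: "Cinf_on (\<lambda>t. y + t *\<^sub>R u) (UNIV :: real set)"
    by (intro Cinf_on_add Cinf_on_const Cinf_on_linear[OF lin] Cinf_on_ident) auto
  have "open (UNIV \<inter> (\<lambda>t. y + t *\<^sub>R u) -` W)"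
    by (rule continuous_open_preimage[OF Cinf_on_continuous[OF C] open_UNIV Cinf_on_open[OF X(1)]])
  moreover have "0 \<in> UNIV \<inter> (\<lambda>t. y + t *\<^sub>R u) -` W" using y by simp
  ultimately obtain \<delta> where \<delta>: "\<delta> > 0" "ball 0 \<delta> \<subseteq> UNIV \<inter> (\<lambda>t. y + t *\<^sub>R u) -` W"
    unfolding open_contains_ball by blast
  have b: "ball 0 \<delta> = {- \<delta><..<\<delta>}" by (auto simp: dist_real_def)
  have sub: "y + t *\<^sub>R u \<in> W" if "t \<in> {- \<delta><..<\<delta>}" for t using \<delta>(2) that unfolding b by blast
  define c where "c t = X (y + t *\<^sub>R u)" for t
  have "Cinf_on c {- \<delta><..<\<delta>}"
    unfolding c_def by (rule Cinf_on_compose[OF X(1) Cinf_on_subset[OF C]]) (use sub in auto)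
  then have "smooth_on {- \<delta><..<\<delta>} c" by (simp add: smooth_on_open_iff)
  moreover have "c ` {- \<delta><..<\<delta>} \<subseteq> M" using sub X(2) by (auto simp: c_def)
  moreover have "(c has_vector_derivative dird X u y) (at 0)"
  proof -
    have "((\<lambda>t. y + t *\<^sub>R u) has_derivative (\<lambda>t. t *\<^sub>R u)) (at (0::real))"
      by (auto intro!: derivative_eq_intros)
    moreover have "(X has_derivative (\<lambda>v. dird X v y)) (at (y + 0 *\<^sub>R u))"
      using Cinf_on_has_derivative[OF X(1) y] by simp
    ultimately have "(c has_derivative (\<lambda>t. dird X (t *\<^sub>R u) y)) (at 0)"
      unfolding c_def by (rule has_derivative_compose)
    then show ?thesis
      unfolding has_vector_derivative_def by (simp add: linear_cmul[OF dird_linear[OF X(1) y]])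
  qed
  moreover have "c 0 = X y" by (simp add: c_def)
  ultimately show ?thesis using \<delta>(1) unfolding tangent_space_def by blast
qed

text \<open>Near 0 a curve c in M equals X o Q o c, and the chain rule reads off its velocity. Q is
  kept general so that M' can be treated with a map built from the inverse of f.\<close>

lemma tangent_space_subset:
  assumes X: "Cinf_on X W" and Q: "Cinf_on Q U" and p: "p \<in> U"
    and QX: "\<And>q. q \<in> M \<Longrightarrow> q \<in> U \<Longrightarrow> Q q \<in> W" "\<And>q. q \<in> M \<Longrightarrow> q \<in> U \<Longrightarrow> X (Q q) = q"
    and v: "v \<in> tangent_space M p"
  shows "v = dird X (dird Q v p) (Q p)"
proof -
  obtain c \<delta> where c: "\<delta> > 0" "c ` {- \<delta><..<\<delta>} \<subseteq> M" "c (0::real) = p" "(c has_vector_derivative v) (at 0)"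
    using v unfolding tangent_space_def by blast
  have pM: "p \<in> M" using c(1-3) by force
  have dc: "(c has_derivative (\<lambda>t. t *\<^sub>R v)) (at 0)" using c(4) by (simp add: has_vector_derivative_def)
  have "(Q has_derivative (\<lambda>v. dird Q v p)) (at (c 0))"
    using Cinf_on_has_derivative[OF Q p] c(3) by simp
  from has_derivative_compose[OF dc this]
  have "((\<lambda>t. Q (c t)) has_derivative (\<lambda>t. dird Q (t *\<^sub>R v) p)) (at 0)" .
  moreover have "(X has_derivative (\<lambda>v. dird X v (Q p))) (at (Q (c 0)))"
    using Cinf_on_has_derivative[OF X QX(1)[OF pM p]] c(3) by simp
  ultimately have d: "((\<lambda>t. X (Q (c t))) has_derivative (\<lambda>t. dird X (dird Q (t *\<^sub>R v) p) (Q p))) (at 0)"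
    by (rule has_derivative_compose)
  have "isCont c 0" using has_derivative_continuous[OF dc] .
  then have "eventually (\<lambda>t. c t \<in> U) (at 0)"
    using Cinf_on_open[OF Q] p c(3) unfolding isCont_def by (intro topological_tendstoD) auto
  moreover have "eventually (\<lambda>t. t \<in> {- \<delta><..<\<delta>}) (at 0)"
    by (rule eventually_at_in_open') (use c(1) in auto)
  ultimately have "eventually (\<lambda>t. X (Q (c t)) = c t) (at 0)"
    by eventually_elim (use c(2) QX(2) in blast)
  then have "(c has_derivative (\<lambda>t. dird X (dird Q (t *\<^sub>R v) p) (Q p))) (at 0)"
    by (rule has_derivative_transform_eventually[OF d]) (simp_all add: c(3) QX(2)[OF pM p])
  then have "(\<lambda>t. t *\<^sub>R v) = (\<lambda>t. dird X (dird Q (t *\<^sub>R v) p) (Q p))"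
    by (rule has_derivative_unique[OF dc])
  from fun_cong[OF this, of 1] show ?thesis by simp
qed

lemma differential_dird:
  assumes f: "smooth_on M f" and X: "Cinf_on X W" "X ` W \<subseteq> M" and y: "y \<in> W"
  shows "differential M f (X y) (dird X u y) = dird (\<lambda>y. f (X y)) u y"
proof -
  have "X y \<in> M" using X(2) y by blast
  then have "(f has_derivative differential M f (X y)) (at (X y) within X ` W)"
    using has_derivative_subset[OF smooth_on_imp_has_derivative_within[OF f] X(2)] by blast
  then have "((\<lambda>y. f (X y)) has_derivative (\<lambda>u. differential M f (X y) (dird X u y))) (at y within W)"
    by (rule has_derivative_in_compose[OF has_derivative_at_withinI[OF Cinf_on_has_derivative[OF X(1) y]]])
  then have "((\<lambda>y. f (X y)) has_derivative (\<lambda>u. differential M f (X y) (dird X u y))) (at y)"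
    using at_within_open[OF y Cinf_on_open[OF X(1)]] by simp
  then show ?thesis by (rule dirdI[symmetric])
qed

lemma linear_differential: "smooth_on M f \<Longrightarrow> p \<in> M \<Longrightarrow> linear (differential M f p)"
  by (rule has_derivative_linear[OF smooth_on_imp_has_derivative_within])

lemma dird_proj_invariant:
  assumes X: "Cinf_on X W" and W: "\<And>y. y \<in> W \<Longrightarrow> proj k y \<in> W" "\<And>y. y \<in> W \<Longrightarrow> X (proj k y) = X y"
    and y: "y \<in> W"
  shows "dird X u y = dird X (proj k u) (proj k y)"
proof -
  have "(X has_derivative (\<lambda>u. dird X (proj k u) (proj k y))) (at y)"
  proof (rule has_derivative_transform_within_open[OF _ Cinf_on_open[OF X] y])
    show "((\<lambda>y. X (proj k y)) has_derivative (\<lambda>u. dird X (proj k u) (proj k y))) (at y)"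
      by (rule has_derivative_compose[OF bounded_linear_imp_has_derivative[OF bounded_linear_proj]
            Cinf_on_has_derivative[OF X W(1)[OF y]]])
  qed (rule W(2))
  then show ?thesis by (rule dirdI)
qed

lemma patch_subset:
  assumes "patch N \<epsilon> X n W k" "open W'" "W' \<subseteq> W"
  shows "patch N \<epsilon> X n W' k"
proof -
  interpret patch N \<epsilon> X n W k by fact
  show ?thesis
    by unfold_locales
      (use assms(2,3) eps in \<open>auto intro: Cinf_on_subset[OF smooth_X] Cinf_on_subset[OF smooth_n]
        simp: n_unit n_normal dird_k dest: immersion[rotated, rotated] subsetD\<close>)
qed

section \<open>Hypersurfaces with asymptotically equal bendings\<close>

locale bending_pair =
  fixes N :: "'m::finite set" and M M' :: "(real ^ 'm) set" and \<nu> \<nu>' f :: "real ^ 'm \<Rightarrow> real ^ 'm"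
    and \<epsilon> :: real
  assumes card: "CARD('m) \<ge> 4" and hypersurface: "hypersurface M"
    and indefinite: "indefinite_metric N M" and indefinite': "indefinite_metric N M'"
    and eps: "\<epsilon> = 1 \<or> \<epsilon> = - 1"
    and normal: "unit_normal_field N M \<epsilon> \<nu>" and normal': "unit_normal_field N M' \<epsilon> \<nu>'"
    and diffeo: "diffeomorphism M M' f"
    and bending: "asymptotically_bending_preserving N M \<nu> M' \<nu>' f"
    and dense: "M \<subseteq> closure {p \<in> M. \<not> quasi_umbilic N M \<nu> p}"
begin

definition "f_inv = inv_into M f"

lemma bij: "bij_betw f M M'" and smooth_f: "smooth_on M f" and smooth_f_inv: "smooth_on M' f_inv"
  using diffeo by (simp_all add: diffeomorphism_def f_inv_def)

lemma f_mem: "p \<in> M \<Longrightarrow> f p \<in> M'" and f_inv_mem: "q \<in> M' \<Longrightarrow> f_inv q \<in> M"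
  and f_inv_f: "p \<in> M \<Longrightarrow> f_inv (f p) = p" and f_f_inv: "q \<in> M' \<Longrightarrow> f (f_inv q) = q"
  using bij unfolding f_inv_def
  by (auto simp: bij_betw_apply bij_betw_inv_into_left bij_betw_inv_into_right
      bij_betw_apply[OF bij_betw_inv_into])

lemma smooth_normal: "smooth_on M \<nu>" "smooth_on M' \<nu>'"
  using normal normal' by (simp_all add: unit_normal_field_def)

lemma normal_unit: "p \<in> M \<Longrightarrow> pdot N (\<nu> p) (\<nu> p) = \<epsilon>" "q \<in> M' \<Longrightarrow> pdot N (\<nu>' q) (\<nu>' q) = \<epsilon>"
  using normal normal' by (simp_all add: unit_normal_field_def)

lemma normal_orthogonal:
  "p \<in> M \<Longrightarrow> v \<in> tangent_space M p \<Longrightarrow> pdot N (\<nu> p) v = 0"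
  "q \<in> M' \<Longrightarrow> v \<in> tangent_space M' q \<Longrightarrow> pdot N (\<nu>' q) v = 0"
  using normal normal' by (simp_all add: unit_normal_field_def)

end

section \<open>The two hypersurfaces in a common chart\<close>

locale bending_chart = bending_pair N M M' \<nu> \<nu>' f \<epsilon>
  for N :: "'m::finite set" and M M' \<nu> \<nu>' f \<epsilon> +
  fixes W U :: "(real ^ 'm) set" and k and X P :: "real ^ 'm \<Rightarrow> real ^ 'm"
  assumes smooth_X: "Cinf_on X W" and smooth_P: "Cinf_on P U"
    and XM: "y \<in> W \<Longrightarrow> X y \<in> M" and XU: "y \<in> W \<Longrightarrow> X y \<in> U"
    and PX: "y \<in> W \<Longrightarrow> P (X y) = proj k y"
    and PW: "q \<in> M \<Longrightarrow> q \<in> U \<Longrightarrow> P q \<in> W" and XP: "q \<in> M \<Longrightarrow> q \<in> U \<Longrightarrow> X (P q) = q"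
begin

abbreviation "n y \<equiv> \<nu> (X y)"
abbreviation "X' y \<equiv> f (X y)"
abbreviation "n' y \<equiv> \<nu>' (f (X y))"

lemma open_W: "open W" using smooth_X by (rule Cinf_on_open)

lemma X_image: "X ` W \<subseteq> M" using XM by blast

lemma X'M: "y \<in> W \<Longrightarrow> X' y \<in> M'" using XM f_mem by blast

lemma X'_image: "X' ` W \<subseteq> M'" using X'M by blast

lemma smooth_X': "Cinf_on X' W"
  by (rule smooth_on_compose[OF smooth_f smooth_X X_image])

lemma smooth_n: "Cinf_on n W" "Cinf_on n' W"
  by (rule smooth_on_compose[OF smooth_normal(1) smooth_X X_image],
      rule smooth_on_compose[OF smooth_normal(2) smooth_X' X'_image])

lemma proj_W: "y \<in> W \<Longrightarrow> proj k y \<in> W"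
  using PW[OF XM XU] PX by metis

lemma X_proj: "y \<in> W \<Longrightarrow> X (proj k y) = X y"
  using XP[OF XM XU] PX by metis

lemma dird_X_invariant:
  assumes "y \<in> W"
  shows "dird X u y = dird X (proj k u) (proj k y)" "dird X' u y = dird X' (proj k u) (proj k y)"
proof -
  show "dird X u y = dird X (proj k u) (proj k y)"
    by (rule dird_proj_invariant[OF smooth_X proj_W X_proj assms])
  show "dird X' u y = dird X' (proj k u) (proj k y)"
    by (rule dird_proj_invariant[OF smooth_X' proj_W _ assms]) (simp_all only: X_proj)
qed

lemma dird_X_at_proj:
  assumes "y \<in> W"
  shows "dird X u (proj k y) = dird X u y" "dird X' u (proj k y) = dird X' u y"
  using dird_X_invariant[OF assms, of u] dird_X_invariant[OF proj_W[OF assms], of u]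
  by (simp_all add: proj_eq_self)

lemma dird_P:
  assumes y: "y \<in> W"
  shows "dird P (dird X u y) (X y) = proj k u"
proof -
  have "((\<lambda>y. P (X y)) has_derivative (\<lambda>u. dird P (dird X u y) (X y))) (at y)"
    by (rule has_derivative_compose[OF Cinf_on_has_derivative[OF smooth_X y]
          Cinf_on_has_derivative[OF smooth_P XU[OF y]]])
  then have "(proj k has_derivative (\<lambda>u. dird P (dird X u y) (X y))) (at y)"
    by (rule has_derivative_transform_within_open[OF _ open_W y]) (rule PX)
  then show ?thesis
    using has_derivative_unique[OF _ bounded_linear_imp_has_derivative[OF bounded_linear_proj]] by metis
qed

lemma differential_f: "y \<in> W \<Longrightarrow> differential M f (X y) (dird X u y) = dird X' u y"
  by (rule differential_dird[OF smooth_f smooth_X X_image])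

lemma differential_normal:
  assumes "y \<in> W"
  shows "differential M \<nu> (X y) (dird X u y) = dird n u y"
    "differential M' \<nu>' (X' y) (dird X' u y) = dird n' u y"
  using differential_dird[OF smooth_normal(1) smooth_X X_image assms]
    differential_dird[OF smooth_normal(2) smooth_X' X'_image assms] by blast+

lemma differential_f_inv:
  assumes y: "y \<in> W"
  shows "differential M' f_inv (X' y) (dird X' u y) = dird X u y"
proof -
  have "differential M' f_inv (X' y) (dird X' u y) = dird (\<lambda>y. f_inv (X' y)) u y"
    by (rule differential_dird[OF smooth_f_inv smooth_X' X'_image y])
  also have "\<dots> = dird X u y"
    by (rule dird_cong[OF open_W y, symmetric]) (simp_all add: f_inv_f XM Cinf_on_differentiable[OF smooth_X y])
  finally show ?thesis .
qed

lemma tangent_space_X: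
  assumes y: "y \<in> W"
  shows "tangent_space M (X y) = range (\<lambda>u. dird X u y)"
proof
  show "range (\<lambda>u. dird X u y) \<subseteq> tangent_space M (X y)"
    using dird_in_tangent_space[OF smooth_X X_image y] by blast
  show "tangent_space M (X y) \<subseteq> range (\<lambda>u. dird X u y)"
  proof
    fix v assume "v \<in> tangent_space M (X y)"
    then have "v = dird X (dird P v (X y)) (P (X y))"
      by (intro tangent_space_subset[OF smooth_X smooth_P XU[OF y] PW XP])
    then show "v \<in> range (\<lambda>u. dird X u y)" by (simp add: PX[OF y] dird_X_at_proj[OF y])
  qed
qed

lemma tangent_space_X':
  assumes y: "y \<in> W"
  shows "tangent_space M' (X' y) = range (\<lambda>u. dird X' u y)"
proof
  show "range (\<lambda>u. dird X' u y) \<subseteq> tangent_space M' (X' y)"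
    using dird_in_tangent_space[OF smooth_X' X'_image y] by blast
  show "tangent_space M' (X' y) \<subseteq> range (\<lambda>u. dird X' u y)"
  proof
    fix v assume v: "v \<in> tangent_space M' (X' y)"
    obtain F V where F: "Cinf_on F V" "X' y \<in> V" "\<forall>q\<in>M' \<inter> V. F q = f_inv q"
      using smooth_onE[OF smooth_f_inv X'M[OF y]] by metis
    \<comment> \<open>F extends the inverse of f; on V' it maps into the domain of P, so P o F plays
      the role of Q for the parametrisation f o X.\<close>
    define V' where "V' = V \<inter> F -` U"
    have V': "open V'"
      unfolding V'_def
      by (rule continuous_open_preimage[OF Cinf_on_continuous[OF F(1)] Cinf_on_open[OF F(1)] Cinf_on_open[OF smooth_P]])
    have Fy: "F (X' y) = X y" using F(2,3) X'M[OF y] f_inv_f[OF XM[OF y]] by simp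
    have Q: "Cinf_on (\<lambda>q. P (F q)) V'"
      by (rule Cinf_on_compose[OF smooth_P Cinf_on_subset[OF F(1) V']]) (auto simp: V'_def)
    have Fq: "F q \<in> M \<and> F q \<in> U \<and> f (F q) = q" if "q \<in> M'" "q \<in> V'" for q
    proof -
      have "F q = f_inv q" using that F(3) by (simp add: V'_def)
      moreover have "F q \<in> U" using that(2) by (simp add: V'_def)
      ultimately show ?thesis using f_inv_mem[OF that(1)] f_f_inv[OF that(1)] by simp
    qed
    have "v = dird X' (dird (\<lambda>q. P (F q)) v (X' y)) (P (F (X' y)))"
    proof (rule tangent_space_subset[OF smooth_X' Q _ _ _ v])
      show "X' y \<in> V'" using F(2) Fy XU[OF y] by (simp add: V'_def)
      show "P (F q) \<in> W" "X' (P (F q)) = q" if "q \<in> M'" "q \<in> V'" for q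
        using Fq[OF that] PW XP by simp_all
    qed
    then show "v \<in> range (\<lambda>u. dird X' u y)" by (simp add: Fy PX[OF y] dird_X_at_proj[OF y])
  qed
qed

sublocale patch_pair N \<epsilon> X n X' n' W k
proof (intro patch_pair.intro)
  have k0: "dird X (axis k 1) y = 0" "dird X' (axis k 1) y = 0" if "y \<in> W" for y
    using dird_X_invariant[OF that, of "axis k 1"] linear_0[OF dird_linear[OF smooth_X proj_W[OF that]]]
      linear_0[OF dird_linear[OF smooth_X' proj_W[OF that]]] by (simp_all add: proj_def)
  have im: "u = 0" if "y \<in> W" "u $ k = 0" "dird X u y = 0" for y u
    using dird_P[OF that(1), of u] that linear_0[OF dird_linear[OF smooth_P XU[OF that(1)]]]
    by (simp add: proj_eq_self)
  show "patch N \<epsilon> X n W k"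
    by unfold_locales
      (use smooth_X smooth_n eps normal_unit normal_orthogonal XM k0 im tangent_space_X in auto)
  show "patch N \<epsilon> X' n' W k"
  proof
    fix y u assume y: "y \<in> W" "u $ k = 0" "dird X' u y = 0"
    \<comment> \<open>f o X is an immersion because the differential of the inverse map recovers the
      derivative of X from that of f o X.\<close>
    have "dird X u y = 0"
      using differential_f_inv[OF y(1), of u] y(3) linear_0[OF linear_differential[OF smooth_f_inv X'M[OF y(1)]]]
      by simp
    then show "u = 0" using im y by blast
  qed (use smooth_X' smooth_n eps normal_unit normal_orthogonal X'M k0 tangent_space_X' in auto)
qed

lemma second_fundamental_form_X:
  assumes "y \<in> W"
  shows "second_fundamental_form N M \<nu> (X y) (dird X u y) (dird X v y) = h y u v"
    "second_fundamental_form N M' \<nu>' (X' y) (dird X' u y) (dird X' v y) = h' y u v"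
  using assms unfolding second_fundamental_form_def second_form_def
  by (simp_all add: differential_normal normal_unit XM X'M)

lemma bending_X:
  assumes "y \<in> W"
  shows "bending N M \<nu> (X y) (dird X u y) = h y u u / g y u u"
    "bending N M' \<nu>' (X' y) (dird X' u y) = h' y u u / g' y u u"
  using assms unfolding bending_def by (simp_all add: second_fundamental_form_X first_form_def)

lemma pos: "y \<in> W \<Longrightarrow> \<exists>u. g y u u > 0" and neg: "y \<in> W \<Longrightarrow> \<exists>u. g y u u < 0"
  and pos': "y \<in> W \<Longrightarrow> \<exists>u. g' y u u > 0"
  using indefinite indefinite' XM X'M tangent_space_X tangent_space_X'
  unfolding indefinite_metric_def first_form_def by fastforce+

lemma quasi_umbilic_X:
  assumes y: "y \<in> W" and q: "quasi_umbilic_form {u. u $ k = 0} (g y) (h y)"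
  shows "quasi_umbilic N M \<nu> (X y)"
proof -
  obtain \<alpha> \<beta> \<omega> where \<omega>: "linear \<omega>"
    "\<And>u v. u $ k = 0 \<Longrightarrow> v $ k = 0 \<Longrightarrow> h y u v = \<alpha> * g y u v + \<beta> * \<omega> u * \<omega> v"
    using q unfolding quasi_umbilic_form_def by auto
  define \<omega>' where "\<omega>' v = \<omega> (dird P v (X y))" for v
  have "linear \<omega>'"
    unfolding \<omega>'_def
    using linear_compose[OF dird_linear[OF smooth_P XU[OF y]] \<omega>(1)] by (simp add: o_def)
  moreover have "second_fundamental_form N M \<nu> (X y) v w = \<alpha> * pdot N v w + \<beta> * \<omega>' v * \<omega>' w"
    if vw: "v \<in> tangent_space M (X y)" "w \<in> tangent_space M (X y)" for v w
  proof -
    obtain a b where ab: "v = dird X a y" "w = dird X b y" using vw tangent_space_X[OF y] by blast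
    have "h y a b = \<alpha> * g y a b + \<beta> * \<omega> (proj k a) * \<omega> (proj k b)"
      using \<omega>(2)[of "proj k a" "proj k b"] by (simp add: A.forms_proj[OF y])
    then show ?thesis
      by (simp add: ab second_fundamental_form_X[OF y] \<omega>'_def dird_P[OF y] first_form_def)
  qed
  ultimately show ?thesis unfolding quasi_umbilic_def by blast
qed

lemma bending_limit_X:
  assumes y: "y \<in> W" and \<xi>: "\<xi> $ k = 0" "\<xi> \<noteq> 0" "g y \<xi> \<xi> = 0"
  shows "((\<lambda>u. (h' y u u / g' y u u) / (h y u u / g y u u)) \<longlongrightarrow> 1)
    (at \<xi> within {u \<in> {u. u $ k = 0}. g y u u \<noteq> 0 \<and> g' y u u \<noteq> 0 \<and> h y u u / g y u u \<noteq> 0})"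
proof -
  define S where "S = {u \<in> {u. u $ k = 0}. g y u u \<noteq> 0 \<and> g' y u u \<noteq> 0 \<and> h y u u / g y u u \<noteq> 0}"
  let ?x = "\<lambda>u. dird X u y"
  define D where "D = {x \<in> tangent_space M (X y). pdot N x x \<noteq> 0 \<and>
    pdot N (differential M f (X y) x) (differential M f (X y) x) \<noteq> 0 \<and> bending N M \<nu> (X y) x \<noteq> 0}"
  have "?x \<xi> \<noteq> 0" using A.immersion[OF y \<xi>(1)] \<xi>(2) by blast
  then have "isotropic N (?x \<xi>)" using \<xi>(3) by (simp add: isotropic_def first_form_def)
  moreover have "?x \<xi> \<in> tangent_space M (X y)" using tangent_space_X[OF y] by blast
  ultimately have lim: "((\<lambda>x. bending N M' \<nu>' (X' y) (differential M f (X y) x) / bending N M \<nu> (X y) x) \<longlongrightarrow> 1)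
      (at (?x \<xi>) within D)"
    using bending XM[OF y] unfolding asymptotically_bending_preserving_def D_def by blast
  have "filterlim ?x (at (?x \<xi>) within D) (at \<xi> within S)"
    unfolding filterlim_at
  proof (rule conjI[rotated])
    have "isCont ?x \<xi>"
      using linear_continuous_at[OF linear_conv_bounded_linear[THEN iffD1, OF A.linear_X[OF y]]] .
    then show "(?x \<longlongrightarrow> ?x \<xi>) (at \<xi> within S)"
      using continuous_at_imp_continuous_within unfolding continuous_within by blast
    \<comment> \<open>\<open>?x u\<close> differs from \<open>?x \<xi>\<close> because the former is
      nonisotropic and the latter isotropic.\<close>
    have "?x u \<in> D \<and> ?x u \<noteq> ?x \<xi>" if "u \<in> S" for u
      using that \<xi>(3) tangent_space_X[OF y]
      by (auto simp: D_def S_def bending_X[OF y] differential_f[OF y] first_form_def)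
    then show "\<forall>\<^sub>F u in at \<xi> within S. ?x u \<in> D \<and> ?x u \<noteq> ?x \<xi>"
      unfolding eventually_at_filter by (simp add: eventually_mono)
  qed
  from filterlim_compose[OF lim this] show ?thesis
    unfolding S_def[symmetric] by (simp only: differential_f[OF y] bending_X[OF y])
qed

lemma conformal_at_nonquasi_umbilic:
  assumes y: "y \<in> W" and nqu: "\<not> quasi_umbilic_form {u. u $ k = 0} (g y) (h y)"
  obtains \<sigma> \<rho> where "\<And>u v. g' y u v = \<sigma> * g y u v" "\<And>u v. h' y u v = \<sigma> * h y u v + \<rho> * g y u v"
proof -
  note main = that
  define E where "E = {u::real ^ 'm. u $ k = 0}"
  interpret indefinite_scalar_product E "g y"
    unfolding E_def by (rule A.parameter_scalar_product[OF y card pos[OF y] neg[OF y]])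
  have sym: "sym_form_on E (h y)" "sym_form_on E (g' y)" "sym_form_on E (h' y)"
    unfolding sym_form_on_def
    using A.bilinear_forms[OF y] B.bilinear_forms[OF y] A.second_form_commute[OF y]
      B.first_form_commute B.second_form_commute[OF y] by blast+
  have np: "\<not> proportional_on E (h y) (g y)"
    using nqu proportional_on_imp_quasi_umbilic unfolding E_def by blast
  obtain u where "g' y u u > 0" using pos'[OF y] by blast
  then have "g' y (proj k u) (proj k u) \<noteq> 0" by (simp add: B.forms_proj[OF y])
  then have nz: "\<exists>x\<in>E. g' y x x \<noteq> 0" unfolding E_def by (intro bexI[of _ "proj k u"]) simp_all
  have lim: "((\<lambda>u. (h' y u u / g' y u u) / (h y u u / g y u u)) \<longlongrightarrow> 1)
    (at \<xi> within {u \<in> E. g y u u \<noteq> 0 \<and> g' y u u \<noteq> 0 \<and> h y u u / g y u u \<noteq> 0})"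
    if "\<xi> \<in> E" "\<xi> \<noteq> 0" "g y \<xi> \<xi> = 0" for \<xi>
    using bending_limit_X[OF y _ that(2,3)] that(1) unfolding E_def by simp
  show thesis
  proof (rule bending_limit[OF sym np nz lim])
    fix \<sigma> \<rho>
    assume \<sigma>: "\<And>u v. u \<in> E \<Longrightarrow> v \<in> E \<Longrightarrow> g' y u v = \<sigma> * g y u v"
      "\<And>u v. u \<in> E \<Longrightarrow> v \<in> E \<Longrightarrow> h' y u v = \<sigma> * h y u v + \<rho> * g y u v"
    show thesis
    proof (rule main)
      fix u v
      have "proj k u \<in> E" "proj k v \<in> E" by (simp_all add: E_def)
      then show "g' y u v = \<sigma> * g y u v" "h' y u v = \<sigma> * h y u v + \<rho> * g y u v"
        using \<sigma>[of "proj k u" "proj k v"] by (simp_all add: A.forms_proj[OF y] B.forms_proj[OF y])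
    qed
  qed
qed

text \<open>Nonquasi-umbilic points near X y have to be lifted to parameters near y, although P
  forgets the k-th coordinate.\<close>

lemma dense_X:
  assumes y: "y \<in> W" and W': "open W'" "y \<in> W'"
  shows "y \<in> closure {z \<in> W'. z \<in> W \<and> \<not> quasi_umbilic_form {u. u $ k = 0} (g z) (h z)}"
    (is "y \<in> closure ?D")
  unfolding closure_iff_nhds_not_empty
proof (intro allI impI)
  fix A V assume V: "V \<subseteq> A" "open V" "y \<in> V"
  \<comment> \<open>The lift that restores the k-th coordinate of y, so that
    \<open>Z (X y) = y\<close>.\<close>
  define Z where "Z q = P q + (y $ k) *\<^sub>R axis k 1" for q
  have "Cinf_on Z U"
    unfolding Z_def by (intro Cinf_on_add smooth_P Cinf_on_const Cinf_on_open[OF smooth_P])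
  then have "open (U \<inter> Z -` (V \<inter> W \<inter> W'))"
    using V(2) W'(1) open_W Cinf_on_open[OF smooth_P]
    by (intro continuous_open_preimage[OF Cinf_on_continuous]) auto
  moreover have "Z (X y) = y" by (simp add: Z_def PX[OF y] proj_def)
  then have "X y \<in> U \<inter> Z -` (V \<inter> W \<inter> W')" using y V W' XU by simp
  moreover have "X y \<in> closure {p \<in> M. \<not> quasi_umbilic N M \<nu> p}" using dense XM[OF y] by blast
  ultimately obtain q where q: "q \<in> M" "\<not> quasi_umbilic N M \<nu> q" "q \<in> U" "Z q \<in> V" "Z q \<in> W" "Z q \<in> W'"
    unfolding closure_iff_nhds_not_empty by blast
  have "P q $ k = 0" using PX[OF PW[OF q(1,3)]] XP[OF q(1,3)] proj_k by metis
  then have "proj k (Z q) = P q" by (simp add: Z_def proj_def)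
  then have "X (Z q) = q" using X_proj[OF q(5)] XP[OF q(1,3)] by simp
  then have "Z q \<in> ?D" using q quasi_umbilic_X[OF q(5)] by auto
  then show "?D \<inter> A \<noteq> {}" using q V(1) by blast
qed

text \<open>Pointwise algebra yields the factors \<sigma> and \<rho> only at nonquasi-umbilic
  points. As quotients at one u0, nonisotropic near y, they are continuous there, and both
  identities extend by density.\<close>

lemma isometric_with_equal_second_forms:
  assumes y: "y \<in> W"
  shows "g' y u v = g y u v" "h' y u v = h y u v"
proof -
  obtain u0 where u0: "g y u0 u0 > 0" using pos[OF y] by blast
  define W' where "W' = W \<inter> (\<lambda>z. g z u0 u0) -` (- {0})"
  have W': "open W'" "y \<in> W'" "W' \<subseteq> W"
    unfolding W'_def using u0 y
    by (auto intro!: continuous_open_preimage[OF Cinf_on_continuous[OF A.smooth_first_form] open_W] open_Compl)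
  have nz: "g z u0 u0 \<noteq> 0" if "z \<in> W'" for z using that by (simp add: W'_def)
  define D where "D = {z \<in> W'. \<not> quasi_umbilic_form {u. u $ k = 0} (g z) (h z)}"
  have cl: "z \<in> closure D" if "z \<in> W'" for z
  proof -
    have "D = {z \<in> W'. z \<in> W \<and> \<not> quasi_umbilic_form {u. u $ k = 0} (g z) (h z)}"
      using W'(3) by (auto simp: D_def)
    then show ?thesis using dense_X[OF _ W'(1) that] that W'(3) by auto
  qed
  define \<sigma> where "\<sigma> z = g' z u0 u0 / g z u0 u0" for z
  define \<rho> where "\<rho> z = (h' z u0 u0 - \<sigma> z * h z u0 u0) / g z u0 u0" for z
  have D: "g' z a b = \<sigma> z * g z a b \<and> h' z a b = \<sigma> z * h z a b + \<rho> z * g z a b" if z: "z \<in> D" for z a b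
  proof -
    have zW: "z \<in> W" "z \<in> W'" using z W'(3) by (auto simp: D_def)
    obtain s r where s: "\<And>u v. g' z u v = s * g z u v" "\<And>u v. h' z u v = s * h z u v + r * g z u v"
      using conformal_at_nonquasi_umbilic[OF zW(1)] z unfolding D_def by blast
    have \<sigma>: "\<sigma> z = s" unfolding \<sigma>_def s(1) using nz[OF zW(2)] by simp
    then have "\<rho> z = r" unfolding \<rho>_def s(2) using nz[OF zW(2)] by simp
    then show ?thesis using s \<sigma> by simp
  qed
  have cont: "continuous_on W' (\<lambda>z. g z a b)" "continuous_on W' (\<lambda>z. h z a b)"
    "continuous_on W' (\<lambda>z. g' z a b)" "continuous_on W' (\<lambda>z. h' z a b)" for a b
    using Cinf_on_continuous[OF A.smooth_first_form] Cinf_on_continuous[OF A.smooth_second_form]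
      Cinf_on_continuous[OF B.smooth_first_form] Cinf_on_continuous[OF B.smooth_second_form]
      continuous_on_subset[OF _ W'(3)] by blast+
  have c\<sigma>: "continuous_on W' \<sigma>" unfolding \<sigma>_def by (intro continuous_intros cont) (use nz in blast)
  have c\<rho>: "continuous_on W' \<rho>" unfolding \<rho>_def by (intro continuous_intros cont c\<sigma>) (use nz in blast)
  have metric: "g' z a b = \<sigma> z * g z a b" if "z \<in> W'" for z a b
  proof -
    have "g' z a b - \<sigma> z * g z a b = 0"
      by (rule continuous_zero_on_closure[where f = "\<lambda>z. g' z a b - \<sigma> z * g z a b", OF W'(1) _ _ that cl[OF that]])
        (use D in \<open>auto intro!: continuous_intros cont c\<sigma>\<close>)
    then show ?thesis by simp
  qed
  have second: "h' z a b = \<sigma> z * h z a b + \<rho> z * g z a b" if "z \<in> W'" for z a b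
  proof -
    have "h' z a b - (\<sigma> z * h z a b + \<rho> z * g z a b) = 0"
      by (rule continuous_zero_on_closure[where f = "\<lambda>z. h' z a b - (\<sigma> z * h z a b + \<rho> z * g z a b)",
            OF W'(1) _ _ that cl[OF that]])
        (use D in \<open>auto intro!: continuous_intros cont c\<sigma> c\<rho>\<close>)
    then show ?thesis by simp
  qed
  \<comment> \<open>g' is positive on some vector at every point, which excludes a zero of \<sigma>
    also at the points added by continuity.\<close>
  have \<sigma>0: "\<sigma> z \<noteq> 0" if z: "z \<in> W'" for z
  proof
    assume "\<sigma> z = 0"
    then have "g' z a a = 0" for a using metric[OF z] by simp
    moreover obtain a where "g' z a a > 0" using pos' z W'(3) by blast
    ultimately show False by simp
  qed
  interpret C: patch_pair N \<epsilon> X n X' n' W' k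
    by (intro patch_pair.intro patch_subset[OF _ W'(1,3)]) (rule A.patch_axioms B.patch_axioms)+
  have \<sigma>d: "\<sigma> differentiable (at z)" if "z \<in> W'" for z
    by (rule C.conformal_factor_differentiable[OF metric nz that])
  have \<rho>d: "\<rho> differentiable (at z)" if "z \<in> W'" for z
    by (rule C.umbilic_factor_differentiable[OF second nz that \<sigma>d[OF that]])
  interpret C: conformal_pair N \<epsilon> X n X' n' W' k \<sigma> \<rho>
    by unfold_locales (use metric second \<sigma>0 \<sigma>d \<rho>d in auto)
  have "g' y u v = g y u v \<and> h' y u v = h y u v"
    by (rule C.isometric_and_second_form[OF card _ _ nz _ W'(2)])
      (use pos neg W'(3) cl D_def in auto)
  then show "g' y u v = g y u v" "h' y u v = h y u v" by simp_all
qed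

end

section \<open>From charts to a global motion\<close>

context bending_chart
begin

lemma rigid_on_ball:
  assumes W: "W = ball y0 r" "r > 0"
  obtains L b where "linear L" "\<And>v w. pdot N (L v) (L w) = pdot N v w"
    "\<And>q. q \<in> M \<Longrightarrow> q \<in> U \<Longrightarrow> f q = L q + b \<and> \<nu>' (f q) = L (\<nu> q) \<and>
      (\<forall>v\<in>tangent_space M q. differential M f q v = L v)"
proof -
  note main = that
  have y0: "y0 \<in> W" and conv: "convex W" using W by simp_all
  show thesis
  proof (rule rigidity[OF conv y0 isometric_with_equal_second_forms])
    fix L b
    assume L: "linear L" "\<And>v w. pdot N (L v) (L w) = pdot N v w"
      "\<And>y. y \<in> W \<Longrightarrow> X' y = L (X y) + b" "\<And>y. y \<in> W \<Longrightarrow> n' y = L (n y)"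
      "\<And>y u. y \<in> W \<Longrightarrow> dird X' u y = L (dird X u y)"
    show thesis
    proof (rule main[OF L(1,2)])
      fix q assume q: "q \<in> M" "q \<in> U"
      define y where "y = P q"
      have y: "y \<in> W" and Xy: "X y = q" unfolding y_def by (rule PW[OF q], rule XP[OF q])
      have "differential M f q v = L v" if v: "v \<in> tangent_space M q" for v
      proof -
        have "v \<in> range (\<lambda>u. dird X u y)" using v tangent_space_X[OF y] unfolding Xy by simp
        then obtain u where u: "v = dird X u y" by (rule rangeE)
        show ?thesis
          using differential_f[OF y, of u] L(5)[OF y, of u] unfolding Xy u by (rule trans)
      qed
      then show "f q = L q + b \<and> \<nu>' (f q) = L (\<nu> q) \<and> (\<forall>v\<in>tangent_space M q. differential M f q v = L v)"
        using L(3)[OF y] L(4)[OF y] unfolding Xy by blast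
    qed
  qed
qed

text \<open>Tangent vectors and the normal together span the ambient space.\<close>

lemma span_tangent_normal:
  assumes "q \<in> M" "q \<in> U" "linear L" "linear L'"
    and "\<And>v. v \<in> tangent_space M q \<Longrightarrow> L v = L' v" "L (\<nu> q) = L' (\<nu> q)"
  shows "L = L'"
proof
  fix Z
  have y: "P q \<in> W" and Xy: "X (P q) = q" by (rule PW[OF assms(1,2)], rule XP[OF assms(1,2)])
  obtain e where e: "Z = dird X e (P q) + (\<epsilon> * pdot N (n (P q)) Z) *\<^sub>R n (P q)"
    by (rule A.decompose[OF y])
  define c where "c = \<epsilon> * pdot N (n (P q)) Z"
  have Z: "Z = dird X e (P q) + c *\<^sub>R \<nu> q" using e unfolding c_def[symmetric] unfolding Xy .
  have "dird X e (P q) \<in> tangent_space M q"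
    using tangent_space_X[OF y] unfolding Xy by blast
  then have "L (dird X e (P q)) = L' (dird X e (P q))" by (rule assms(5))
  then show "L Z = L' Z"
    unfolding Z linear_add[OF assms(3)] linear_add[OF assms(4)] linear_cmul[OF assms(3)] linear_cmul[OF assms(4)]
    using assms(6) by simp
qed

end

context bending_pair
begin

text \<open>The clauses on the differential and the normals make the motion unique at a single
  point: they fix the linear part, and the value of f then fixes the translation.\<close>

definition "local_motion q Lb \<longleftrightarrow> linear (fst Lb) \<and> (\<forall>v\<in>tangent_space M q. differential M f q v = fst Lb v) \<and>
  \<nu>' (f q) = fst Lb (\<nu> q) \<and> f q = fst Lb q + snd Lb"

text \<open>One pair serves a whole neighbourhood and is the only one at each point of M in it;
  together this makes the pointwise choice locally constant.\<close>

lemma local_motion_exists: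
  assumes "p \<in> M"
  obtains U Lb where "open U" "p \<in> U" "\<And>v w. pdot N (fst Lb v) (fst Lb w) = pdot N v w"
    "\<And>q. q \<in> M \<Longrightarrow> q \<in> U \<Longrightarrow> local_motion q Lb"
    "\<And>q Lb'. q \<in> M \<Longrightarrow> q \<in> U \<Longrightarrow> local_motion q Lb' \<Longrightarrow> Lb' = Lb"
proof -
  note main = that
  show thesis
  proof (rule hypersurface_chart[OF hypersurface assms])
    fix k r U and y0 :: "real ^ 'm" and X P :: "real ^ 'm \<Rightarrow> real ^ 'm"
    assume c: "r > 0" "Cinf_on X (ball y0 r)" "Cinf_on P U" "p \<in> U"
      "\<And>y. y \<in> ball y0 r \<Longrightarrow> X y \<in> M" "\<And>y. y \<in> ball y0 r \<Longrightarrow> X y \<in> U"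
      "\<And>y. y \<in> ball y0 r \<Longrightarrow> P (X y) = proj k y"
      "\<And>q. q \<in> M \<Longrightarrow> q \<in> U \<Longrightarrow> P q \<in> ball y0 r" "\<And>q. q \<in> M \<Longrightarrow> q \<in> U \<Longrightarrow> X (P q) = q"
    define W where "W = ball y0 r"
    interpret bending_chart N M M' \<nu> \<nu>' f \<epsilon> W U k X P
      by unfold_locales (use c in \<open>simp_all add: W_def\<close>)
    show thesis
    proof (rule rigid_on_ball[OF W_def c(1)])
      fix L b
      assume L: "linear L" "\<And>v w. pdot N (L v) (L w) = pdot N v w"
        "\<And>q. q \<in> M \<Longrightarrow> q \<in> U \<Longrightarrow> f q = L q + b \<and> \<nu>' (f q) = L (\<nu> q) \<and>
          (\<forall>v\<in>tangent_space M q. differential M f q v = L v)"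
      have lm: "local_motion q (L, b)" if "q \<in> M" "q \<in> U" for q
        unfolding local_motion_def fst_conv snd_conv using L(3)[OF that] L(1) by blast
      show thesis
      proof (rule main[where U = U and Lb = "(L, b)"])
        fix q Lb' assume q: "q \<in> M" "q \<in> U" and Lb': "local_motion q Lb'"
        have 1: "linear (fst Lb')" "\<forall>v\<in>tangent_space M q. differential M f q v = fst Lb' v"
          "\<nu>' (f q) = fst Lb' (\<nu> q)" "f q = fst Lb' q + snd Lb'"
          using Lb' unfolding local_motion_def by blast+
        have fL: "fst Lb' = L"
        proof (rule span_tangent_normal[OF q 1(1) L(1)])
          show "fst Lb' v = L v" if "v \<in> tangent_space M q" for v using 1(2) L(3)[OF q] that by metis
          show "fst Lb' (\<nu> q) = L (\<nu> q)" using 1(3) L(3)[OF q] by metis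
        qed
        moreover have "L q + snd Lb' = L q + b" using 1(4) L(3)[OF q] unfolding fL by metis
        then have "snd Lb' = b" by simp
        ultimately show "Lb' = (L, b)" by (simp add: prod_eq_iff)
      qed (use L(2) lm c(4) Cinf_on_open[OF c(3)] in simp_all)
    qed
  qed
qed

lemma isometry_extension:
  assumes conn: "connected M"
  obtains L b where "linear L" "\<And>v w. pdot N (L v) (L w) = pdot N v w" "\<And>p. p \<in> M \<Longrightarrow> f p = L p + b"
proof (cases "M = {}")
  case True
  then show thesis using that[of id 0] by (simp add: linear_id)
next
  case False
  then obtain p0 where p0: "p0 \<in> M" by blast
  define F where "F p = (SOME Lb. local_motion p Lb)" for p
  have F: "local_motion p (F p)" if "p \<in> M" for p
    unfolding F_def by (rule local_motion_exists[OF that]) (use that in \<open>blast intro: someI\<close>)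
  have const: "F p = F p0" if p: "p \<in> M" for p
  proof (rule connected_local_const[OF conn p p0], rule ballI)
    fix a assume a: "a \<in> M"
    show "\<forall>\<^sub>F b in at a within M. F a = F b"
    proof (rule local_motion_exists[OF a])
      fix U Lb
      assume U: "open U" "a \<in> U" and un: "\<And>q Lb'. q \<in> M \<Longrightarrow> q \<in> U \<Longrightarrow> local_motion q Lb' \<Longrightarrow> Lb' = Lb"
      have "F b = Lb" if "b \<in> M" "b \<in> U" for b using un[OF that F[OF that(1)]] .
      then show ?thesis
        unfolding eventually_at_topological using U a by (intro exI[of _ U]) simp
    qed
  qed
  show thesis
  proof (rule local_motion_exists[OF p0])
    fix U Lb
    assume iso: "\<And>v w. pdot N (fst Lb v) (fst Lb w) = pdot N v w" and U: "p0 \<in> U"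
      and un: "\<And>q Lb'. q \<in> M \<Longrightarrow> q \<in> U \<Longrightarrow> local_motion q Lb' \<Longrightarrow> Lb' = Lb"
    have Lb: "F p0 = Lb" using un[OF p0 U F[OF p0]] .
    show thesis
    proof (rule that)
      show "linear (fst Lb)" using F[OF p0] unfolding Lb local_motion_def by blast
      show "f p = fst Lb p + snd Lb" if "p \<in> M" for p
        using F[OF that] unfolding const[OF that] Lb local_motion_def by blast
    qed (rule iso)
  qed
qed

end

text \<open>Preserving a nondegenerate form makes L injective, hence bijective in finite dimension,
  and the inverse is again affine.\<close>

lemma motion_affine:
  fixes L :: "real ^ 'm::finite \<Rightarrow> real ^ 'm"
  assumes L: "linear L" and iso: "\<And>v w. pdot N (L v) (L w) = pdot N v w"
  shows "motion N (\<lambda>p. L p + b)"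
proof -
  have inj: "inj L"
  proof (rule linear_injective_0[THEN iffD2, OF L], intro allI impI)
    fix v assume "L v = 0"
    then have "pdot N v w = 0" for w using iso[of v w] by (simp add: pdot_simps)
    then show "v = 0" by (rule pdot_nondegenerate)
  qed
  have surj: "surj L" using linear_injective_imp_surjective[OF L inj] by simp
  have bl: "bounded_linear L" "bounded_linear (inv L)"
    using L inj_linear_imp_inv_linear[OF L inj] linear_conv_bounded_linear by blast+
  have C: "Cinf_on (\<lambda>p. A p + c) UNIV" if "bounded_linear A" for A :: "real ^ 'm \<Rightarrow> real ^ 'm" and c
    by (intro Cinf_on_add Cinf_on_linear[OF that] Cinf_on_ident Cinf_on_const open_UNIV)
  have bij: "bij (\<lambda>p. L p + b)"
    using inj surj unfolding bij_def inj_def surj_def by (metis add_diff_cancel_right' diff_add_cancel)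
  have "inv (\<lambda>p. L p + b) = (\<lambda>q. inv L q + inv L (- b))"
  proof (rule inv_equality)
    show "inv L (L p + b) + inv L (- b) = p" for p
      using linear_add[OF inj_linear_imp_inv_linear[OF L inj], of "L p + b" "- b"] inv_f_f[OF inj] by simp
    show "L (inv L q + inv L (- b)) + b = q" for q
      using linear_add[OF L] surj_f_inv_f[OF surj] by simp
  qed
  then have "diffeomorphism UNIV UNIV (\<lambda>p. L p + b)"
    unfolding diffeomorphism_def using C[OF bl(1)] C[OF bl(2)] bij
    by (simp add: smooth_on_open_iff)
  moreover have "differential UNIV (\<lambda>p. L p + b) p v = L v" for p v
  proof -
    have "((\<lambda>p. L p + b) has_derivative L) (at p)"
      using has_derivative_add[OF bounded_linear_imp_has_derivative[OF bl(1)] has_derivative_const[of b]] by simp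
    then show ?thesis unfolding differential_def by (rule dirdI)
  qed
  ultimately show ?thesis unfolding motion_def using iso by simp
qed

theorem theorem1:
  fixes N :: "'m::finite set"
    and M M' :: "(real ^ 'm) set"
    and \<nu> \<nu>' f :: "real ^ 'm \<Rightarrow> real ^ 'm"
    and n s :: nat and \<epsilon> :: real
  assumes "n > 2" and "CARD('m) = n + 1" and "card N = s"
    and "hypersurface M" and "connected M"
    and "nondegenerate_metric N M" and "indefinite_metric N M"
    and "hypersurface M'" and "connected M'"
    and "nondegenerate_metric N M'" and "indefinite_metric N M'"
    and "\<epsilon> = 1 \<or> \<epsilon> = -1"
    and "unit_normal_field N M \<epsilon> \<nu>" and "unit_normal_field N M' \<epsilon> \<nu>'"
    and "diffeomorphism M M' f"
    and "asymptotically_bending_preserving N M \<nu> M' \<nu>' f"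
    and "M \<subseteq> closure {p \<in> M. \<not> quasi_umbilic N M \<nu> p}"
    and "\<not> conformally_flat N M"
  shows "congruence N M f"
proof -
  interpret bending_pair N M M' \<nu> \<nu>' f \<epsilon>
    by unfold_locales (use assms in simp_all)
  show ?thesis
  proof (rule isometry_extension[OF assms(5)])
    fix L b
    assume L: "linear L" "\<And>v w. pdot N (L v) (L w) = pdot N v w" "\<And>p. p \<in> M \<Longrightarrow> f p = L p + b"
    show ?thesis
      unfolding congruence_def
      by (intro exI[of _ "\<lambda>p. L p + b"] conjI motion_affine L(1,2)) (simp add: L(3))
  qed
qed

end
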